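(* If $U\subset\mathbb{C}$ is a simply-connected domain whose boundary is a quasiarc, then $U$ is Schwartz equivalent to the open unit disc $\mathbb{D}$.
   Context: A domain is an open connected subset of $\mathbb{C}$; boundaries are taken in $\mathbb{C}$. Identify $\mathbb{C}$ with $\mathbb{R}^2$. $\mathcal{S}(\mathbb{R}^n)$ is the usual Fréchet space of real-valued Schwartz functions on $\mathbb{R}^n$. For an open $U\subset\mathbb{R}^n$, $\mathcal{S}(U)$ is the closed subspace of those $f\in\mathcal{S}(\mathbb{R}^n)$ such that $f$ and all its partial derivatives vanish at every point of $\mathbb{R}^n\setminus U$, with the induced Fréchet topology; its elements are regarded (by restriction) as smooth functions on $U$. Two open subsets $U,V\subset\mathbb{R}^n$ are called Schwartz equivalent if there exists a $C^\infty$-diffeomorphism $\phi\colon U\to V$ such that $s\mapsto s\circ\phi$ is an isomorphism of Fréchet spaces $\mathcal{S}(V)\to\mathcal{S}(U)$. A closed subset $J^0\subset\mathbb{C}$ is a quasicircle if its closure in the Riemann sphere $\widehat{\mathbb{C}}$ is a Jordan curve and there is $C>0$ such that for all distinct $x,y\in J^0$ the smallest diameter of a connected component of $J^0\setminus\{x,y\}$ is at most $C|x-y|$. A quasiarc is a subset of $\mathbb{C}$ that is contained in some quasicircle and whose closure in $\widehat{\mathbb{C}}$ is homeomorphic to $[0,1]$. *)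

theory Defs
  imports "HOL-Analysis.Analysis"
begin

section \<open>Partial derivatives and smooth maps\<close>

definition partial_deriv ::
    "'a::euclidean_space \<Rightarrow> ('a \<Rightarrow> 'b::real_normed_vector) \<Rightarrow> 'a \<Rightarrow> 'b" where
  "partial_deriv b f x = frechet_derivative f (at x) b"

text \<open>A multi-index is encoded as a list of basis vectors (with repetitions), one entry for each
  differentiation; the empty list stands for the function itself.\<close>

definition iter_partial ::
    "'a::euclidean_space list \<Rightarrow> ('a \<Rightarrow> 'b::real_normed_vector) \<Rightarrow> 'a \<Rightarrow> 'b" where
  "iter_partial bs f = foldr partial_deriv bs f"

text \<open>Only meaningful for open \<open>U\<close>, where the iterated derivatives at points of \<open>U\<close> do not depend
  on the values of \<open>f\<close> outside \<open>U\<close>. Differentiability of all iterated partial derivatives also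
  gives their existence (as honest derivatives) and continuity, i.e. \<open>f\<close> is \<open>C\<close>-infinity on \<open>U\<close>.
  Differentiability is over the reals, also for maps between open subsets of the complex plane.\<close>

definition smooth_on :: "'a::euclidean_space set \<Rightarrow> ('a \<Rightarrow> 'b::real_normed_vector) \<Rightarrow> bool" where
  "smooth_on U f \<longleftrightarrow>
     (\<forall>bs\<in>lists Basis. \<forall>x\<in>U. iter_partial bs f differentiable (at x))"

definition smooth_diffeomorphism ::
    "'a::euclidean_space set \<Rightarrow> 'a set \<Rightarrow> ('a \<Rightarrow> 'a) \<Rightarrow> bool" where
  "smooth_diffeomorphism U V \<phi> \<longleftrightarrow>
     bij_betw \<phi> U V \<and> smooth_on U \<phi> \<and> smooth_on V (inv_into U \<phi>)"


section \<open>Schwartz spaces\<close>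

definition schwartz_space :: "('a::euclidean_space \<Rightarrow> real) set" where
  "schwartz_space =
     {f. smooth_on UNIV f \<and>
         (\<forall>k::nat. \<forall>bs\<in>lists Basis. bounded (range (\<lambda>x. (1 + norm x) ^ k * iter_partial bs f x)))}"

definition schwartz_seminorm ::
    "nat \<Rightarrow> 'a::euclidean_space list \<Rightarrow> ('a \<Rightarrow> real) \<Rightarrow> real" where
  "schwartz_seminorm k bs f = (SUP x. (1 + norm x) ^ k * \<bar>iter_partial bs f x\<bar>)"

text \<open>The Frechet topology: the open balls of all the seminorms, around all points, form a
  subbase.\<close>

definition schwartz_topology :: "('a::euclidean_space \<Rightarrow> real) topology" where
  "schwartz_topology = topology_generated_by
     {{g \<in> schwartz_space. schwartz_seminorm k bs (\<lambda>x. g x - f x) < e} | f k bs e.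
        f \<in> schwartz_space \<and> bs \<in> lists Basis \<and> e > 0}"

definition schwartz_space_on :: "'a::euclidean_space set \<Rightarrow> ('a \<Rightarrow> real) set" where
  "schwartz_space_on U =
     {f \<in> schwartz_space. \<forall>bs\<in>lists Basis. \<forall>x. x \<notin> U \<longrightarrow> iter_partial bs f x = 0}"

definition schwartz_topology_on :: "'a::euclidean_space set \<Rightarrow> ('a \<Rightarrow> real) topology" where
  "schwartz_topology_on U = subtopology schwartz_topology (schwartz_space_on U)"

lemma topspace_schwartz_topology: "topspace schwartz_topology = schwartz_space"
proof -
  have "f \<in> {g \<in> schwartz_space. schwartz_seminorm 0 [] (\<lambda>x. g x - f x) < 1}"
    if "f \<in> schwartz_space" for f :: "'a \<Rightarrow> real"
    using that by (simp add: schwartz_seminorm_def iter_partial_def)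
  moreover have "[] \<in> lists (Basis :: 'a set)" "(0::real) < 1"
    by auto
  ultimately show ?thesis
    unfolding schwartz_topology_def topology_generated_by_topspace by blast
qed

lemma topspace_schwartz_topology_on: "topspace (schwartz_topology_on U) = schwartz_space_on U"
  by (auto simp: schwartz_topology_on_def topspace_schwartz_topology schwartz_space_on_def)

text \<open>Elements of \<open>schwartz_space_on U\<close> are functions on the whole space that vanish off \<open>U\<close>, hence
  are determined by their restriction to \<open>U\<close>; \<open>s \<circ> \<phi>\<close>, a function on \<open>U\<close>, therefore represents
  the element obtained by extending it by zero.\<close>

definition schwartz_pullback ::
    "'a::euclidean_space set \<Rightarrow> ('a \<Rightarrow> 'a) \<Rightarrow> ('a \<Rightarrow> real) \<Rightarrow> 'a \<Rightarrow> real" where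
  "schwartz_pullback U \<phi> s = (\<lambda>x. if x \<in> U then s (\<phi> x) else 0)"

definition schwartz_isomorphism ::
    "'a::euclidean_space set \<Rightarrow> 'a set \<Rightarrow> (('a \<Rightarrow> real) \<Rightarrow> 'a \<Rightarrow> real) \<Rightarrow> bool" where
  "schwartz_isomorphism V U T \<longleftrightarrow>
     (\<forall>f\<in>schwartz_space_on V. \<forall>g\<in>schwartz_space_on V.
        T (\<lambda>x. f x + g x) = (\<lambda>x. T f x + T g x)) \<and>
     (\<forall>c. \<forall>f\<in>schwartz_space_on V. T (\<lambda>x. c * f x) = (\<lambda>x. c * T f x)) \<and>
     homeomorphic_map (schwartz_topology_on V) (schwartz_topology_on U) T"

definition schwartz_equivalent :: "'a::euclidean_space set \<Rightarrow> 'a set \<Rightarrow> bool" where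
  "schwartz_equivalent U V \<longleftrightarrow>
     open U \<and> open V \<and>
     (\<exists>\<phi>. smooth_diffeomorphism U V \<phi> \<and> schwartz_isomorphism V U (schwartz_pullback U \<phi>))"


section \<open>Quasicircles and quasiarcs\<close>

abbreviation riemann_sphere :: "complex option topology" where
  "riemann_sphere \<equiv> Alexandroff_compactification euclidean"

definition sphere_closure :: "complex set \<Rightarrow> complex option set" where
  "sphere_closure A = riemann_sphere closure_of (Some ` A)"

text \<open>\<open>J\<close> may be unbounded (a Jordan curve through infinity), and then \<open>J - {x, y}\<close> has unbounded
  components, on which the library's \<open>diameter\<close> is unspecified. As \<open>J - {x, y}\<close> has only two or
  three components, the smallest diameter is attained, and it is at most the given bound iff some
  bounded component has diameter at most that bound.\<close>

definition quasicircle :: "complex set \<Rightarrow> bool" where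
  "quasicircle J \<longleftrightarrow>
     closed J \<and>
     subtopology riemann_sphere (sphere_closure J)
       homeomorphic_space top_of_set (sphere (0::complex) 1) \<and>
     (\<exists>C>0. \<forall>x\<in>J. \<forall>y\<in>J. x \<noteq> y \<longrightarrow>
        (\<exists>K\<in>components (J - {x, y}). bounded K \<and> diameter K \<le> C * dist x y))"

definition quasiarc :: "complex set \<Rightarrow> bool" where
  "quasiarc A \<longleftrightarrow>
     (\<exists>J. quasicircle J \<and> A \<subseteq> J) \<and>
     subtopology riemann_sphere (sphere_closure A)
       homeomorphic_space top_of_set {0..1::real}"

end

theory Submission
  imports Defs "HOL-Complex_Analysis.Complex_Analysis" "HOL-Real_Asymp.Real_Asymp"
begin

text \<open>
  Let \<open>f\<close> be a Riemann map from the disc onto \<open>U\<close> and \<open>g\<close> its inverse. Elements of the Schwartz space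
  of a domain are flat at the boundary: with all derivatives they are bounded by every power of
  \<open>min 1 (dist x (boundary)) / (1 + \<bar>x\<bar>)\<close>. Hence pulling back along \<open>f\<close> and \<open>g\<close> preserves these spaces
  as soon as the maps have moderate growth and each of these boundary gauges is bounded by a power of the
  other one. By Cauchy's inequality and Bloch's theorem, applied to \<open>log (f - a)\<close> for \<open>a\<close> outside \<open>U\<close>,
  all of this holds for every simply connected \<open>U\<close>, except for the estimate
  \<open>gauge (f z) ^ N \<le> C (1 - \<bar>z\<bar>)\<close>.

  For that estimate, move a point of \<open>U\<close> to infinity by an inversion, so that the boundary becomes a compact
  quasiarc \<open>\<alpha>\<close>. By the three-point condition the part of \<open>\<alpha>\<close> in a disc lies in a connected subset of
  \<open>\<alpha>\<close> inside a comparable concentric disc, so by Janiszewski's theorem two points outside the larger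
  disc can be joined off \<open>\<alpha>\<close> outside the smaller one. Thus a crosscut of diameter \<open>l\<close> cuts off a piece
  of diameter \<open>O(l)\<close>. Since \<open>l\<^sup>2\<close> is, for a suitable crosscut, bounded by the area of the adjacent cell,
  the area that is cut off decays geometrically on approaching a boundary point of the disc radially in
  logarithmic coordinates.
\<close>

section \<open>Schwartz functions and tempered maps\<close>

text \<open>The exceptional estimate is a Hoelder-type bound for \<open>f\<close> in which infinity
  counts as a boundary point, and it is where the geometry enters: for a strip, \<open>f\<close> is
  a logarithm, the gauge of \<open>f z\<close> decays only like 1 / log (1 / (1 - |z|)) along a
  radius towards an end of the strip, and no power of it is O(1 - |z|). The boundary being an arc,
  \<open>U\<close> may lie on both sides of it, as for a slit plane, so \<open>g\<close> need not
  extend continuously and no boundary homeomorphism is available. Crosscuts are used instead: only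
  their images inside the open set \<open>U\<close> are measured. The inversion serves two purposes.
  It makes the images of the half strips bounded, hence of finite area, and it replaces closeness to
  the boundary or to infinity by closeness to a single compact set. All comparisons are wanted up to
  a power only, which is why crude constants (84 from Bloch's theorem, 768 from the length-area
  step) suffice and why losing a third power when undoing the inversion is harmless.\<close>

lemma iter_partial_Nil [simp]: "iter_partial [] f = f"
  by (simp add: iter_partial_def)

lemma iter_partial_Cons [simp]: "iter_partial (b # bs) f = partial_deriv b (iter_partial bs f)"
  by (simp add: iter_partial_def)

lemma partial_deriv_eq: "(f has_derivative D) (at x) \<Longrightarrow> partial_deriv b f x = D b"
  by (simp add: partial_deriv_def flip: frechet_derivative_at)

lemma frechet_derivative_basis_expansion:
  fixes f :: "'a::euclidean_space \<Rightarrow> real"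
  assumes "f differentiable at x"
  shows "frechet_derivative f (at x) v = (\<Sum>b\<in>Basis. (v \<bullet> b) * partial_deriv b f x)"
proof -
  have lin: "linear (frechet_derivative f (at x))"
    using assms by (rule linear_frechet_derivative)
  show ?thesis
    by (subst linear_eq_stdbasis[OF lin, of "\<lambda>v. \<Sum>b\<in>Basis. (v \<bullet> b) * partial_deriv b f x"])
       (auto simp: linear_iff inner_add_left distrib_right sum.distrib sum_distrib_left
          partial_deriv_def inner_Basis mult.assoc if_distrib[of "\<lambda>y. y * _"] sum.delta cong: if_cong)
qed

lemma frechet_derivative_le_partial_derivs:
  fixes f :: "'a::euclidean_space \<Rightarrow> real"
  assumes "f differentiable at x"
  shows "\<bar>frechet_derivative f (at x) v\<bar> \<le> norm v * (\<Sum>b\<in>Basis. \<bar>partial_deriv b f x\<bar>)"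
proof -
  have "\<bar>frechet_derivative f (at x) v\<bar> \<le> (\<Sum>b\<in>Basis. \<bar>(v \<bullet> b) * partial_deriv b f x\<bar>)"
    unfolding frechet_derivative_basis_expansion[OF assms] by (rule sum_abs)
  also have "\<dots> \<le> (\<Sum>b\<in>Basis. norm v * \<bar>partial_deriv b f x\<bar>)"
    by (intro sum_mono) (auto simp: abs_mult Basis_le_norm intro!: mult_right_mono)
  finally show ?thesis by (simp add: sum_distrib_left)
qed

text \<open>An increasing sequence of norms equivalent to the whole family of seminorms; a single
  index \<open>n\<close> replaces finite sets of seminorms in all estimates.\<close>

definition schwartz_norm :: "nat \<Rightarrow> ('a::euclidean_space \<Rightarrow> real) \<Rightarrow> real" where
  "schwartz_norm n s =
     (\<Sum>(k, bs)\<in>{..n} \<times> {bs. set bs \<subseteq> Basis \<and> length bs \<le> n}. schwartz_seminorm k bs s)"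

lemma finite_multiindices: "finite {bs. set bs \<subseteq> (Basis :: 'a::euclidean_space set) \<and> length bs \<le> n}"
  by (rule finite_lists_length_le) simp

lemma schwartz_seminorm_upper:
  assumes "s \<in> schwartz_space" "bs \<in> lists Basis"
  shows "(1 + norm x) ^ k * \<bar>iter_partial bs s x\<bar> \<le> schwartz_seminorm k bs s"
proof -
  have "bounded (range (\<lambda>x. (1 + norm x) ^ k * iter_partial bs s x))"
    using assms by (auto simp: schwartz_space_def)
  then obtain B where "\<And>x. \<bar>(1 + norm x) ^ k * iter_partial bs s x\<bar> \<le> B"
    by (auto simp: bounded_iff)
  then have "bdd_above (range (\<lambda>x. (1 + norm x) ^ k * \<bar>iter_partial bs s x\<bar>))"
    by (auto simp: bdd_above_def abs_mult)
  then show ?thesis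
    unfolding schwartz_seminorm_def by (rule cSUP_upper2) auto
qed

lemma schwartz_seminorm_least:
  assumes "\<And>x. (1 + norm x) ^ k * \<bar>iter_partial bs s x\<bar> \<le> B"
  shows "schwartz_seminorm k bs s \<le> B"
  unfolding schwartz_seminorm_def using assms by (intro cSUP_least) auto

lemma schwartz_seminorm_nonneg:
  assumes "s \<in> schwartz_space" "bs \<in> lists Basis"
  shows "0 \<le> schwartz_seminorm k bs s"
  by (rule order_trans[OF _ schwartz_seminorm_upper[OF assms, of 0]]) simp

lemma schwartz_norm_mono:
  assumes "s \<in> schwartz_space" "n \<le> m"
  shows "schwartz_norm n s \<le> schwartz_norm m s"
  unfolding schwartz_norm_def
  by (rule sum_mono2)
     (use assms in \<open>auto simp: finite_multiindices lists_eq_set intro!: schwartz_seminorm_nonneg\<close>)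

lemma schwartz_norm_nonneg: "s \<in> schwartz_space \<Longrightarrow> 0 \<le> schwartz_norm n s"
  unfolding schwartz_norm_def
  by (intro sum_nonneg) (auto simp: lists_eq_set intro!: schwartz_seminorm_nonneg)

lemma schwartz_seminorm_le_norm:
  assumes "s \<in> schwartz_space" "bs \<in> lists Basis" "length bs \<le> n" "k \<le> n"
  shows "schwartz_seminorm k bs s \<le> schwartz_norm n s"
proof -
  have "(case (k, bs) of (k, bs) \<Rightarrow> schwartz_seminorm k bs s) \<le> schwartz_norm n s"
    unfolding schwartz_norm_def
    by (rule member_le_sum) (use assms in \<open>auto simp: finite_multiindices lists_eq_set
        intro!: schwartz_seminorm_nonneg\<close>)
  then show ?thesis by simp
qed

lemma schwartz_norm_upper:
  assumes "s \<in> schwartz_space" "bs \<in> lists Basis" "length bs \<le> n" "k \<le> n"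
  shows "(1 + norm x) ^ k * \<bar>iter_partial bs s x\<bar> \<le> schwartz_norm n s"
  using schwartz_seminorm_upper[OF assms(1,2)] schwartz_seminorm_le_norm[OF assms] by (rule order_trans)

lemma schwartz_differentiable:
  assumes "s \<in> schwartz_space" "bs \<in> lists Basis"
  shows "iter_partial bs s differentiable at x"
  using assms by (auto simp: schwartz_space_def smooth_on_def)

lemma schwartz_space_onD:
  assumes "s \<in> schwartz_space_on W"
  shows "s \<in> schwartz_space" "bs \<in> lists Basis \<Longrightarrow> x \<notin> W \<Longrightarrow> iter_partial bs s x = 0"
  using assms by (auto simp: schwartz_space_on_def)

text \<open>One more derivative buys one more power of the distance. If \<open>x\<close> is within
  distance 1 of the complement, the mean value inequality is applied on the segment from
  \<open>x\<close> to a nearest point \<open>p\<close> outside \<open>W\<close>, where the function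
  vanishes. Along this segment the distance to the complement does not exceed that at
  \<open>x\<close>, and the weight is smaller than at \<open>x\<close> by a factor of at most
  \<open>2 ^ k\<close>.\<close>

lemma flat_step:
  fixes W :: "'a::euclidean_space set"
  assumes W: "open W" "W \<noteq> UNIV"
    and IH: "\<And>b k. b \<in> Basis \<Longrightarrow> \<exists>C n. \<forall>s\<in>schwartz_space_on W. \<forall>x.
        (1 + norm x) ^ k * \<bar>iter_partial (b # bs) s x\<bar>
          \<le> C * min 1 (infdist x (- W)) ^ N * schwartz_norm n s"
    and bs: "bs \<in> lists Basis"
  shows "\<exists>C n. \<forall>s\<in>schwartz_space_on W. \<forall>x.
    (1 + norm x) ^ k * \<bar>iter_partial bs s x\<bar>
      \<le> C * min 1 (infdist x (- W)) ^ Suc N * schwartz_norm n s"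
proof -
  obtain C0 n0 where IH': "\<And>b s x. b \<in> Basis \<Longrightarrow> s \<in> schwartz_space_on W \<Longrightarrow>
        (1 + norm x) ^ k * \<bar>iter_partial (b # bs) s x\<bar>
          \<le> C0 b * min 1 (infdist x (- W)) ^ N * schwartz_norm (n0 b) s"
    using IH[of _ k] by metis
  \<comment> \<open>The summand 1 is for points at distance at least 1, where the claim is the plain
    seminorm bound; \<open>2 ^ k\<close> is the cost of comparing weights along the segment.\<close>
  define C where "C = 2 ^ k * (\<Sum>b\<in>Basis. \<bar>C0 b\<bar>) + 1"
  define n where "n = k + length bs + (\<Sum>b\<in>Basis. n0 b)"
  have n0: "n0 b \<le> n" if "b \<in> Basis" for b
    using member_le_sum[of b Basis n0] that by (simp add: n_def)
  show ?thesis
  proof (intro exI ballI allI)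
    fix s x assume s: "s \<in> schwartz_space_on W"
    note sS = schwartz_space_onD(1)[OF s]
    note nn = schwartz_norm_nonneg[OF sS]
    define m where "m = (\<lambda>x. min 1 (infdist x (- W)))"
    have m0: "0 \<le> m y" for y by (simp add: m_def infdist_nonneg)
    consider "infdist x (- W) \<ge> 1" | "infdist x (-W) < 1" by linarith
    then show "(1 + norm x) ^ k * \<bar>iter_partial bs s x\<bar>
      \<le> C * min 1 (infdist x (- W)) ^ Suc N * schwartz_norm n s"
    proof cases
      case 1
      have "(1 + norm x) ^ k * \<bar>iter_partial bs s x\<bar> \<le> schwartz_norm n s"
        using sS bs by (rule schwartz_norm_upper) (auto simp: n_def)
      also have "\<dots> \<le> C * schwartz_norm n s"
        using nn[of n] by (simp add: C_def algebra_simps sum_nonneg)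
      finally show ?thesis using 1 by simp
    next
      case 2
      obtain p where p: "p \<in> - W" "infdist x (- W) = dist x p"
        using infdist_attains_inf[of "- W" x] W by auto
      have mx: "m x = dist x p" using 2 p by (simp add: m_def)
      define A where "A = (\<Sum>b\<in>Basis. \<bar>C0 b\<bar>)"
      have bound: "\<bar>frechet_derivative (iter_partial bs s) (at y) v\<bar> \<le>
          (2 ^ k * A * m x ^ N * schwartz_norm n s / (1 + norm x) ^ k) * norm v"
        if y: "y \<in> closed_segment p x" for y v
      proof -
        have yx: "dist x y \<le> dist x p"
          using segment_bound(2)[OF y] by (simp add: dist_norm norm_minus_commute)
        have my: "m y \<le> m x"
          using infdist_le[OF p(1), of y] segment_bound(1)[OF y] mx
          by (auto simp: m_def dist_norm norm_minus_commute)
        have "norm x \<le> norm y + dist x y"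
          by (metis dist_commute dist_norm norm_triangle_sub)
        then have "1 + norm x \<le> 2 * (1 + norm y)"
          using yx 2 p(2) norm_ge_zero[of y] by (smt (verit))
        then have w: "(1 + norm x) ^ k \<le> 2 ^ k * (1 + norm y) ^ k"
          by (metis add_nonneg_nonneg norm_ge_zero power_mono power_mult_distrib zero_le_one)
        have each: "(1 + norm x) ^ k * \<bar>partial_deriv b (iter_partial bs s) y\<bar>
            \<le> 2 ^ k * (\<bar>C0 b\<bar> * m x ^ N * schwartz_norm n s)" if b: "b \<in> Basis" for b
        proof -
          have "(1 + norm x) ^ k * \<bar>partial_deriv b (iter_partial bs s) y\<bar>
             \<le> 2 ^ k * ((1 + norm y) ^ k * \<bar>partial_deriv b (iter_partial bs s) y\<bar>)"
            using mult_right_mono[OF w, of "\<bar>partial_deriv b (iter_partial bs s) y\<bar>"] by (simp add: mult.assoc)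
          also have "\<dots> \<le> 2 ^ k * (C0 b * m y ^ N * schwartz_norm (n0 b) s)"
            using IH'[OF b s, of y] by (simp add: m_def)
          also have "\<dots> \<le> 2 ^ k * (\<bar>C0 b\<bar> * m x ^ N * schwartz_norm n s)"
            using m0 my nn schwartz_norm_mono[OF sS n0[OF b]]
            by (intro mult_left_mono mult_mono power_mono) auto
          finally show ?thesis .
        qed
        have "(1 + norm x) ^ k * (\<Sum>b\<in>Basis. \<bar>partial_deriv b (iter_partial bs s) y\<bar>)
            \<le> 2 ^ k * A * m x ^ N * schwartz_norm n s"
          unfolding sum_distrib_left A_def sum_distrib_right
          by (intro sum_mono) (use each in \<open>simp add: mult.assoc\<close>)
        then have "(\<Sum>b\<in>Basis. \<bar>partial_deriv b (iter_partial bs s) y\<bar>)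
            \<le> 2 ^ k * A * m x ^ N * schwartz_norm n s / (1 + norm x) ^ k"
          by (simp add: field_simps add_pos_nonneg)
        then have "norm v * (\<Sum>b\<in>Basis. \<bar>partial_deriv b (iter_partial bs s) y\<bar>)
            \<le> norm v * (2 ^ k * A * m x ^ N * schwartz_norm n s / (1 + norm x) ^ k)"
          by (rule mult_left_mono) simp
        then show ?thesis
          using frechet_derivative_le_partial_derivs[OF schwartz_differentiable[OF sS bs], of y v]
          by (simp add: mult.commute)
      qed
      have "norm (iter_partial bs s x - iter_partial bs s p) \<le>
          (2 ^ k * A * m x ^ N * schwartz_norm n s / (1 + norm x) ^ k) * norm (x - p)"
      proof (rule differentiable_bound[of "closed_segment p x"])
        fix y assume y: "y \<in> closed_segment p x"
        show "(iter_partial bs s has_derivative frechet_derivative (iter_partial bs s) (at y))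
            (at y within closed_segment p x)"
          using schwartz_differentiable[OF sS bs]
          by (meson frechet_derivative_works has_derivative_at_withinI)
        show "onorm (frechet_derivative (iter_partial bs s) (at y))
          \<le> 2 ^ k * A * m x ^ N * schwartz_norm n s / (1 + norm x) ^ k"
          by (rule onorm_le) (use bound[OF y] in auto)
      qed auto
      moreover have "iter_partial bs s p = 0"
        using s bs p by (auto intro: schwartz_space_onD)
      ultimately have "\<bar>iter_partial bs s x\<bar> \<le>
          m x * (2 ^ k * A * m x ^ N * schwartz_norm n s / (1 + norm x) ^ k)"
        by (simp add: mx dist_norm mult.commute)
      then have "(1 + norm x) ^ k * \<bar>iter_partial bs s x\<bar> \<le> 2 ^ k * A * m x ^ Suc N * schwartz_norm n s"
        by (simp add: field_simps add_pos_nonneg)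
      also have "\<dots> \<le> C * m x ^ Suc N * schwartz_norm n s"
        using m0 nn by (intro mult_right_mono) (auto simp: C_def A_def)
      finally show ?thesis by (simp add: m_def)
    qed
  qed
qed

lemma schwartz_flat:
  fixes W :: "'a::euclidean_space set"
  assumes W: "open W" "W \<noteq> UNIV" and "bs \<in> lists Basis"
  shows "\<exists>C n. \<forall>s\<in>schwartz_space_on W. \<forall>x.
    (1 + norm x) ^ k * \<bar>iter_partial bs s x\<bar>
      \<le> C * min 1 (infdist x (- W)) ^ N * schwartz_norm n s"
  using assms(3)
proof (induction N arbitrary: bs k)
  case 0
  have "(1 + norm x) ^ k * \<bar>iter_partial bs s x\<bar> \<le> schwartz_norm (k + length bs) s"
    if "s \<in> schwartz_space_on W" for s x
    using schwartz_space_onD(1)[OF that] 0 by (rule schwartz_norm_upper) auto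
  then show ?case by (intro exI[of _ 1] exI[of _ "k + length bs"]) auto
next
  case (Suc N)
  have "b # bs \<in> lists Basis" if "b \<in> Basis" for b using Suc.prems that by auto
  then show ?case by (intro flat_step[OF W Suc.IH]) (use Suc.prems in auto)
qed

text \<open>Dividing by \<open>1 + norm x\<close> treats infinity as one more boundary point: a high
  power of this single quantity expresses rapid decay and flatness at the complement at the same
  time.\<close>

definition boundary_gauge :: "'a::euclidean_space set \<Rightarrow> 'a \<Rightarrow> real" where
  "boundary_gauge W x = min 1 (infdist x (- W)) / (1 + norm x)"

lemma boundary_gauge_nonneg: "0 \<le> boundary_gauge W x"
  by (simp add: boundary_gauge_def infdist_nonneg)

lemma boundary_gauge_le_1: "boundary_gauge W x \<le> 1"
proof -
  have "min 1 (infdist x (- W)) \<le> 1 + norm x" by (simp add: min.coboundedI1)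
  then show ?thesis by (simp add: boundary_gauge_def divide_le_eq add_pos_nonneg)
qed

lemma boundary_gauge_pos:
  assumes "open W" "W \<noteq> UNIV" "x \<in> W"
  shows "0 < boundary_gauge W x"
proof -
  have "infdist x (- W) \<noteq> 0"
    using assms in_closed_iff_infdist_zero[of "- W" x] by auto
  then show ?thesis
    by (simp add: boundary_gauge_def infdist_nonneg order_less_le add_pos_nonneg
        add_nonneg_eq_0_iff)
qed

lemma boundary_gauge_le_inverse_norm: "boundary_gauge W x * (1 + norm x) \<le> 1"
  by (simp add: boundary_gauge_def add_pos_nonneg add_nonneg_eq_0_iff)

lemma boundary_gauge_le_dist:
  assumes "p \<notin> W" shows "boundary_gauge W x \<le> dist x p"
proof -
  have "boundary_gauge W x \<le> min 1 (infdist x (- W))"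
    unfolding boundary_gauge_def
    using divide_left_mono[of 1 "1 + norm x" "min 1 (infdist x (- W))"]
    by (simp add: infdist_nonneg add_pos_nonneg)
  also have "\<dots> \<le> dist x p" using infdist_le[of p "- W" x] assms by auto
  finally show ?thesis .
qed

text \<open>The flatness estimate with the exponent of the weight equal to the order of vanishing,
  so that both combine to a power of the gauge.\<close>

lemma schwartz_flat_gauge:
  fixes W :: "'a::euclidean_space set"
  assumes W: "open W" "W \<noteq> UNIV" and "bs \<in> lists Basis"
  obtains C n where "0 \<le> C" "\<And>s x. s \<in> schwartz_space_on W \<Longrightarrow>
    \<bar>iter_partial bs s x\<bar> \<le> C * boundary_gauge W x ^ N * schwartz_norm n s"
proof -
  obtain C n where *: "\<And>s x. s \<in> schwartz_space_on W \<Longrightarrow>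
    (1 + norm x) ^ N * \<bar>iter_partial bs s x\<bar> \<le> C * min 1 (infdist x (- W)) ^ N * schwartz_norm n s"
    using schwartz_flat[OF assms, of N N] by blast
  have "\<bar>iter_partial bs s x\<bar> \<le> \<bar>C\<bar> * boundary_gauge W x ^ N * schwartz_norm n s"
    if s: "s \<in> schwartz_space_on W" for s x
  proof -
    have pos: "0 < (1 + norm x) ^ N" by (simp add: add_pos_nonneg)
    have "(1 + norm x) ^ N * \<bar>iter_partial bs s x\<bar> \<le> \<bar>C\<bar> * min 1 (infdist x (- W)) ^ N * schwartz_norm n s"
      using *[OF s, of x] schwartz_norm_nonneg[OF schwartz_space_onD(1)[OF s], of n]
      by (elim order_trans) (intro mult_right_mono, auto simp: infdist_nonneg)
    then show ?thesis
      using pos by (simp add: boundary_gauge_def power_divide field_simps)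
  qed
  then show ?thesis using that[of "\<bar>C\<bar>" n] by auto
qed

section \<open>Linear operations on Schwartz spaces and a criterion for continuity\<close>

lemma iter_partial_lincomb:
  assumes "f \<in> schwartz_space" "g \<in> schwartz_space" "bs \<in> lists Basis"
  shows "iter_partial bs (\<lambda>x. a * f x + c * g x) = (\<lambda>x. a * iter_partial bs f x + c * iter_partial bs g x)"
  using assms(3)
proof (induction bs)
  case (Cons b bs)
  then have bs: "bs \<in> lists Basis" by auto
  have "partial_deriv b (\<lambda>x. a * iter_partial bs f x + c * iter_partial bs g x) x =
      a * partial_deriv b (iter_partial bs f) x + c * partial_deriv b (iter_partial bs g) x" for x
  proof -
    have "((\<lambda>x. a * iter_partial bs f x + c * iter_partial bs g x) has_derivative
       (\<lambda>v. a * frechet_derivative (iter_partial bs f) (at x) v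
          + c * frechet_derivative (iter_partial bs g) (at x) v)) (at x)"
      using schwartz_differentiable[OF assms(1) bs, of x] schwartz_differentiable[OF assms(2) bs, of x]
      by (intro derivative_eq_intros) (auto simp: frechet_derivative_works)
    then show ?thesis by (simp add: partial_deriv_eq) (simp add: partial_deriv_def)
  qed
  then show ?case using Cons bs by auto
qed auto

lemma schwartz_space_lincomb:
  assumes f: "f \<in> schwartz_space" and g: "g \<in> schwartz_space"
  shows "(\<lambda>x. a * f x + c * g x) \<in> schwartz_space"
  unfolding schwartz_space_def
proof (intro CollectI conjI allI ballI)
  show "smooth_on UNIV (\<lambda>x. a * f x + c * g x)"
    unfolding smooth_on_def
  proof (intro ballI)
    fix bs x assume bs: "bs \<in> lists (Basis :: 'a set)"
    show "iter_partial bs (\<lambda>x. a * f x + c * g x) differentiable at x"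
      unfolding iter_partial_lincomb[OF f g bs]
      by (intro derivative_intros schwartz_differentiable f g bs)
  qed
  fix k and bs :: "'a list" assume bs: "bs \<in> lists Basis"
  have "\<bar>(1 + norm x) ^ k * (a * iter_partial bs f x + c * iter_partial bs g x)\<bar>
     \<le> \<bar>a\<bar> * schwartz_seminorm k bs f + \<bar>c\<bar> * schwartz_seminorm k bs g" for x
  proof -
    have "\<bar>(1 + norm x) ^ k * (a * iter_partial bs f x + c * iter_partial bs g x)\<bar>
      \<le> \<bar>a\<bar> * ((1 + norm x) ^ k * \<bar>iter_partial bs f x\<bar>) + \<bar>c\<bar> * ((1 + norm x) ^ k * \<bar>iter_partial bs g x\<bar>)"
      using abs_triangle_ineq[of "(1 + norm x) ^ k * (a * iter_partial bs f x)"
          "(1 + norm x) ^ k * (c * iter_partial bs g x)"]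
      by (simp add: abs_mult algebra_simps)
    also have "\<dots> \<le> \<bar>a\<bar> * schwartz_seminorm k bs f + \<bar>c\<bar> * schwartz_seminorm k bs g"
      by (intro add_mono mult_left_mono schwartz_seminorm_upper f g bs) auto
    finally show ?thesis .
  qed
  then show "bounded (range (\<lambda>x. (1 + norm x) ^ k * iter_partial bs (\<lambda>x. a * f x + c * g x) x))"
    unfolding iter_partial_lincomb[OF f g bs] by (auto simp: bounded_iff)
qed

lemma schwartz_space_on_lincomb:
  assumes "f \<in> schwartz_space_on W" "g \<in> schwartz_space_on W"
  shows "(\<lambda>x. a * f x + c * g x) \<in> schwartz_space_on W"
  using assms schwartz_space_lincomb[of f g a c]
  by (auto simp: schwartz_space_on_def iter_partial_lincomb)

lemma schwartz_space_diff:
  assumes "f \<in> schwartz_space" "g \<in> schwartz_space"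
  shows "(\<lambda>x. f x - g x) \<in> schwartz_space"
  using schwartz_space_lincomb[OF assms, of 1 "-1"] by simp

lemma schwartz_space_on_diff:
  assumes "f \<in> schwartz_space_on W" "g \<in> schwartz_space_on W"
  shows "(\<lambda>x. f x - g x) \<in> schwartz_space_on W"
  using schwartz_space_on_lincomb[OF assms, of 1 "-1"] by simp

lemma schwartz_seminorm_triangle:
  assumes f: "f \<in> schwartz_space" and g: "g \<in> schwartz_space" and bs: "bs \<in> lists Basis"
  shows "schwartz_seminorm k bs (\<lambda>x. f x + g x) \<le> schwartz_seminorm k bs f + schwartz_seminorm k bs g"
proof (rule schwartz_seminorm_least)
  fix x
  have "(1 + norm x) ^ k * \<bar>iter_partial bs (\<lambda>x. f x + g x) x\<bar> \<le>
      (1 + norm x) ^ k * \<bar>iter_partial bs f x\<bar> + (1 + norm x) ^ k * \<bar>iter_partial bs g x\<bar>"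
    using iter_partial_lincomb[OF f g bs, of 1 1]
    by (simp add: abs_triangle_ineq mult_left_mono flip: distrib_left)
  also have "\<dots> \<le> schwartz_seminorm k bs f + schwartz_seminorm k bs g"
    by (intro add_mono schwartz_seminorm_upper assms)
  finally show "(1 + norm x) ^ k * \<bar>iter_partial bs (\<lambda>x. f x + g x) x\<bar>
    \<le> schwartz_seminorm k bs f + schwartz_seminorm k bs g" .
qed

text \<open>The usual criterion for linear maps between spaces topologized by seminorms. The
  subbasic sets are balls around arbitrary centres \<open>f\<close>, so for each \<open>h\<close>
  mapped into such a ball the room \<open>eps\<close> left between \<open>T h\<close> and the edge
  of the ball determines a neighbourhood of \<open>h\<close>.\<close>

lemma continuous_map_schwartz:
  fixes V :: "'a::euclidean_space set" and U :: "'b::euclidean_space set"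
  assumes into: "\<And>s. s \<in> schwartz_space_on V \<Longrightarrow> T s \<in> schwartz_space_on U"
    and diff: "\<And>f g. f \<in> schwartz_space_on V \<Longrightarrow> g \<in> schwartz_space_on V
        \<Longrightarrow> T (\<lambda>x. f x - g x) = (\<lambda>x. T f x - T g x)"
    and est: "\<And>k bs. bs \<in> lists Basis \<Longrightarrow>
        \<exists>C n. \<forall>s\<in>schwartz_space_on V. schwartz_seminorm k bs (T s) \<le> C * schwartz_norm n s"
  shows "continuous_map (schwartz_topology_on V) (schwartz_topology_on U) T"
  unfolding schwartz_topology_on_def[of U] schwartz_topology_def
proof (intro continuous_map_into_subtopology continuous_on_generated_topo)
  show "T \<in> topspace (schwartz_topology_on V) \<rightarrow> schwartz_space_on U"
    using into by (auto simp: topspace_schwartz_topology_on)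
  show "T ` topspace (schwartz_topology_on V)
      \<subseteq> \<Union> {{g \<in> schwartz_space. schwartz_seminorm k bs (\<lambda>x. g x - f x) < e} |f k bs e.
            f \<in> schwartz_space \<and> bs \<in> lists Basis \<and> e > 0}" (is "_ \<subseteq> \<Union> ?B")
  proof -
    have "\<Union> ?B = (schwartz_space :: ('b \<Rightarrow> real) set)"
      using topspace_schwartz_topology unfolding schwartz_topology_def topology_generated_by_topspace .
    then show ?thesis
      using into by (auto simp: topspace_schwartz_topology_on intro!: schwartz_space_onD(1))
  qed
next
  fix X assume "X \<in> {{g \<in> schwartz_space. schwartz_seminorm k bs (\<lambda>x. g x - f x) < e} |f k bs e.
            f \<in> (schwartz_space :: ('b \<Rightarrow> real) set) \<and> bs \<in> lists Basis \<and> e > 0}"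
  then obtain f k bs e where X: "X = {g \<in> schwartz_space. schwartz_seminorm k bs (\<lambda>x. g x - f x) < e}"
    and f: "f \<in> schwartz_space" and bs: "bs \<in> lists Basis" and e: "e > 0" by blast
  obtain C n where C: "\<And>s. s \<in> schwartz_space_on V \<Longrightarrow> schwartz_seminorm k bs (T s) \<le> C * schwartz_norm n s"
    using est[OF bs] by metis
  define F where "F = {..n} \<times> {bs. set bs \<subseteq> (Basis :: 'a set) \<and> length bs \<le> n}"
  have finF: "finite F" by (simp add: F_def finite_multiindices)
  show "openin (schwartz_topology_on V) (T -` X \<inter> topspace (schwartz_topology_on V))"
  proof (subst openin_subopen, intro ballI)
    fix h assume "h \<in> T -` X \<inter> topspace (schwartz_topology_on V)"
    then have h: "h \<in> schwartz_space_on V" and Th: "schwartz_seminorm k bs (\<lambda>x. T h x - f x) < e"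
      by (auto simp: X topspace_schwartz_topology_on)
    define eps where "eps = e - schwartz_seminorm k bs (\<lambda>x. T h x - f x)"
    \<comment> \<open>On the neighbourhood each of the \<open>card F\<close> seminorms making up
      \<open>schwartz_norm n\<close> is below \<open>d\<close>, so the image moves by at most |C|
      times \<open>card F * d\<close>; the added ones keep the denominator positive and the final
      inequality strict.\<close>
    define d where "d = eps / ((\<bar>C\<bar> + 1) * (real (card F) + 1))"
    have eps: "eps > 0" using Th by (simp add: eps_def)
    have d: "d > 0" unfolding d_def using eps by (intro divide_pos_pos mult_pos_pos) auto
    define B where "B = (\<lambda>(k :: nat, bs :: 'a list). {g \<in> schwartz_space. schwartz_seminorm k bs (\<lambda>x. g x - h x) < d})"
    define Op where "Op = schwartz_space_on V \<inter> ((\<Inter>i\<in>F. B i) \<inter> topspace schwartz_topology)"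
    have "openin schwartz_topology (B i)" if "i \<in> F" for i
    proof -
      obtain k' bs' where i: "i = (k', bs')" by (cases i)
      have "bs' \<in> lists Basis" using that by (auto simp: F_def i lists_eq_set)
      then show ?thesis
        unfolding schwartz_topology_def i B_def using d schwartz_space_onD(1)[OF h]
        by (intro topology_generated_by_Basis) auto
    qed
    then have "openin schwartz_topology ((\<Inter>i\<in>F. B i) \<inter> topspace schwartz_topology)"
      using finF by blast
    then have "openin (schwartz_topology_on V) Op"
      unfolding schwartz_topology_on_def Op_def by (rule openin_subtopology_Int2)
    moreover have "h \<in> Op"
    proof -
      have "schwartz_seminorm k' bs' (\<lambda>x. h x - h x) < d" if "bs' \<in> lists Basis" for k' and bs' :: "'a list"
      proof -
        have "iter_partial bs' (\<lambda>x. h x - h x) x = 0" for x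
          using fun_cong[OF iter_partial_lincomb[OF schwartz_space_onD(1)[OF h] schwartz_space_onD(1)[OF h] that, of 1 "-1"]]
          by simp
        then have "schwartz_seminorm k' bs' (\<lambda>x. h x - h x) \<le> 0" by (intro schwartz_seminorm_least) auto
        then show ?thesis using d by linarith
      qed
      then show ?thesis
        using h by (auto simp: Op_def B_def F_def topspace_schwartz_topology schwartz_space_onD lists_eq_set)
    qed
    moreover have "Op \<subseteq> T -` X \<inter> topspace (schwartz_topology_on V)"
    proof
      fix g assume g': "g \<in> Op"
      then have g: "g \<in> schwartz_space_on V" by (simp add: Op_def)
      have gh: "(\<lambda>x. g x - h x) \<in> schwartz_space_on V" by (rule schwartz_space_on_diff[OF g h])
      have "schwartz_norm n (\<lambda>x. g x - h x) \<le> (\<Sum>i\<in>F. d)"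
        unfolding schwartz_norm_def F_def[symmetric]
        by (intro sum_mono) (use g' in \<open>auto simp: Op_def B_def intro: less_imp_le\<close>)
      then have n: "schwartz_norm n (\<lambda>x. g x - h x) \<le> real (card F) * d" by simp
      have "schwartz_seminorm k bs (T (\<lambda>x. g x - h x)) \<le> C * schwartz_norm n (\<lambda>x. g x - h x)"
        by (rule C[OF gh])
      also have "\<dots> \<le> \<bar>C\<bar> * schwartz_norm n (\<lambda>x. g x - h x)"
        by (intro mult_right_mono schwartz_norm_nonneg schwartz_space_onD(1)[OF gh]) auto
      also have "\<dots> \<le> \<bar>C\<bar> * (real (card F) * d)" using n by (intro mult_left_mono) auto
      also have "\<dots> < (\<bar>C\<bar> + 1) * (real (card F) + 1) * d"
        using d by (simp add: algebra_simps add_strict_increasing add_pos_nonneg)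
      also have "\<dots> = eps" unfolding d_def using mult_pos_pos[of "\<bar>C\<bar> + 1" "real (card F) + 1"] by simp
      finally have "schwartz_seminorm k bs (\<lambda>x. T g x - T h x) < eps" by (simp add: diff[OF g h])
      moreover have "schwartz_seminorm k bs (\<lambda>x. T g x - f x) \<le>
         schwartz_seminorm k bs (\<lambda>x. T g x - T h x) + schwartz_seminorm k bs (\<lambda>x. T h x - f x)"
        using schwartz_seminorm_triangle[OF
            schwartz_space_onD(1)[OF schwartz_space_on_diff[OF into[OF g] into[OF h]]]
            schwartz_space_diff[OF schwartz_space_onD(1)[OF into[OF h]] f] bs, of k] by simp
      ultimately show "g \<in> T -` X \<inter> topspace (schwartz_topology_on V)"
        using g schwartz_space_onD(1)[OF into[OF g]]
        by (simp add: X eps_def topspace_schwartz_topology_on)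
    qed
    ultimately show "\<exists>Ta. openin (schwartz_topology_on V) Ta \<and> h \<in> Ta \<and>
        Ta \<subseteq> T -` X \<inter> topspace (schwartz_topology_on V)" by blast
  qed
qed

section \<open>Pullback along holomorphic maps of moderate growth\<close>

locale tempered_map =
  fixes U V :: "complex set" and \<phi> :: "complex \<Rightarrow> complex"
  assumes open_U: "open U" and U_ne: "U \<noteq> UNIV"
    and open_V: "open V" and V_ne: "V \<noteq> UNIV"
    and holo: "\<phi> holomorphic_on U"
    and into: "\<And>x. x \<in> U \<Longrightarrow> \<phi> x \<in> V"
    and deriv_bound: "\<And>k. \<exists>C N. \<forall>x\<in>U. norm ((deriv ^^ Suc k) \<phi> x) * boundary_gauge U x ^ N \<le> C"
    and gauge_bound: "\<exists>C N. \<forall>x\<in>U. boundary_gauge V (\<phi> x) ^ N \<le> C * boundary_gauge U x"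
begin

text \<open>The factors that the chain rule puts in front of derivatives of \<open>s\<close>: the
  real algebra generated by the real and imaginary parts of the derivatives of \<open>\<phi>\<close>
  of positive order. It is closed under partial differentiation and its members grow at most like a
  negative power of the gauge; this replaces an explicit formula for higher derivatives of a
  composition.\<close>

inductive_set coeffs :: "(complex \<Rightarrow> real) set" where
  const: "(\<lambda>x. c) \<in> coeffs"
| Re: "(\<lambda>x. Re ((deriv ^^ Suc k) \<phi> x)) \<in> coeffs"
| Im: "(\<lambda>x. Im ((deriv ^^ Suc k) \<phi> x)) \<in> coeffs"
| add: "c \<in> coeffs \<Longrightarrow> d \<in> coeffs \<Longrightarrow> (\<lambda>x. c x + d x) \<in> coeffs"
| mult: "c \<in> coeffs \<Longrightarrow> d \<in> coeffs \<Longrightarrow> (\<lambda>x. c x * d x) \<in> coeffs"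

lemma higher_deriv: "x \<in> U \<Longrightarrow> ((deriv ^^ k) \<phi> has_field_derivative (deriv ^^ Suc k) \<phi> x) (at x)"
  using holomorphic_derivI[OF holomorphic_higher_deriv[OF holo open_U] open_U, of x k] by simp

lemma coeffs_uminus: "c \<in> coeffs \<Longrightarrow> (\<lambda>x. - c x) \<in> coeffs"
  using coeffs.mult[OF coeffs.const[of "-1"]] by simp

text \<open>By the Cauchy-Riemann equations the partial derivatives of the real and imaginary parts
  of a holomorphic function are, up to sign, the real and imaginary parts of its complex derivative;
  sums and products follow by the usual rules.\<close>

lemma coeffs_derivative:
  assumes "c \<in> coeffs"
  shows "\<exists>c1\<in>coeffs. \<exists>c2\<in>coeffs. \<forall>x\<in>U. (c has_derivative (\<lambda>v. Re v * c1 x + Im v * c2 x)) (at x)"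
  using assms
proof induction
  case (const c)
  have "((\<lambda>x. c) has_derivative (\<lambda>v. Re v * 0 + Im v * 0)) (at x)" for x :: complex by simp
  then show ?case using coeffs.const[of 0] by (intro bexI[of _ "\<lambda>x. 0"]) simp_all
next
  case (Re k)
  have "((\<lambda>x. Re ((deriv ^^ Suc k) \<phi> x)) has_derivative
      (\<lambda>v. Re v * Re ((deriv ^^ Suc (Suc k)) \<phi> x) + Im v * - Im ((deriv ^^ Suc (Suc k)) \<phi> x))) (at x)"
    if "x \<in> U" for x
    using has_derivative_Re[OF higher_deriv[OF that, of "Suc k", unfolded has_field_derivative_def]]
    by (rule has_derivative_eq_rhs) (auto simp: algebra_simps)
  then show ?case
    by (intro bexI[OF _ coeffs.Re[of "Suc k"]] bexI[OF _ coeffs_uminus[OF coeffs.Im[of "Suc k"]]]) simp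
next
  case (Im k)
  have "((\<lambda>x. Im ((deriv ^^ Suc k) \<phi> x)) has_derivative
      (\<lambda>v. Re v * Im ((deriv ^^ Suc (Suc k)) \<phi> x) + Im v * Re ((deriv ^^ Suc (Suc k)) \<phi> x))) (at x)"
    if "x \<in> U" for x
    using has_derivative_Im[OF higher_deriv[OF that, of "Suc k", unfolded has_field_derivative_def]]
    by (rule has_derivative_eq_rhs) (auto simp: algebra_simps)
  then show ?case
    by (intro bexI[OF _ coeffs.Re[of "Suc k"]] bexI[OF _ coeffs.Im[of "Suc k"]]) simp
next
  case (add c d)
  then obtain c1 c2 d1 d2 where m: "c1 \<in> coeffs" "c2 \<in> coeffs" "d1 \<in> coeffs" "d2 \<in> coeffs"
    and c: "\<And>x. x \<in> U \<Longrightarrow> (c has_derivative (\<lambda>v. Re v * c1 x + Im v * c2 x)) (at x)"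
    and d: "\<And>x. x \<in> U \<Longrightarrow> (d has_derivative (\<lambda>v. Re v * d1 x + Im v * d2 x)) (at x)" by blast
  have "((\<lambda>x. c x + d x) has_derivative (\<lambda>v. Re v * (c1 x + d1 x) + Im v * (c2 x + d2 x))) (at x)"
    if "x \<in> U" for x
    using has_derivative_add[OF c[OF that] d[OF that]]
    by (rule has_derivative_eq_rhs) (auto simp: algebra_simps)
  then show ?case
    by (intro bexI[OF _ coeffs.add[OF m(1,3)]] bexI[OF _ coeffs.add[OF m(2,4)]]) simp
next
  case (mult c d)
  then obtain c1 c2 d1 d2 where m: "c1 \<in> coeffs" "c2 \<in> coeffs" "d1 \<in> coeffs" "d2 \<in> coeffs"
    and c: "\<And>x. x \<in> U \<Longrightarrow> (c has_derivative (\<lambda>v. Re v * c1 x + Im v * c2 x)) (at x)"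
    and d: "\<And>x. x \<in> U \<Longrightarrow> (d has_derivative (\<lambda>v. Re v * d1 x + Im v * d2 x)) (at x)" by blast
  have "((\<lambda>x. c x * d x) has_derivative
      (\<lambda>v. Re v * (c x * d1 x + c1 x * d x) + Im v * (c x * d2 x + c2 x * d x))) (at x)"
    if "x \<in> U" for x
    using has_derivative_mult[OF c[OF that] d[OF that]]
    by (rule has_derivative_eq_rhs) (auto simp: algebra_simps)
  then show ?case
    by (intro bexI[OF _ coeffs.add[OF coeffs.mult[OF mult.hyps(1) m(3)] coeffs.mult[OF m(1) mult.hyps(2)]]]
         bexI[OF _ coeffs.add[OF coeffs.mult[OF mult.hyps(1) m(4)] coeffs.mult[OF m(2) mult.hyps(2)]]]) simp
qed

lemma gauge_power_antimono: "N \<le> M \<Longrightarrow> boundary_gauge U x ^ M \<le> boundary_gauge U x ^ N"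
  by (rule power_decreasing) (auto simp: boundary_gauge_nonneg boundary_gauge_le_1)

lemma coeffs_bound:
  assumes "c \<in> coeffs"
  shows "\<exists>C N. \<forall>x\<in>U. \<bar>c x\<bar> * boundary_gauge U x ^ N \<le> C"
  using assms
proof induction
  case (const c)
  show ?case by (rule exI[of _ "\<bar>c\<bar>"], rule exI[of _ 0]) auto
next
  case (Re k)
  obtain C N where "\<And>x. x \<in> U \<Longrightarrow> norm ((deriv ^^ Suc k) \<phi> x) * boundary_gauge U x ^ N \<le> C"
    using deriv_bound[of k] by blast
  then show ?case
    by (intro exI[of _ C] exI[of _ N] ballI order_trans[OF mult_right_mono[OF abs_Re_le_cmod]])
       (auto simp: boundary_gauge_nonneg)
next
  case (Im k)
  obtain C N where "\<And>x. x \<in> U \<Longrightarrow> norm ((deriv ^^ Suc k) \<phi> x) * boundary_gauge U x ^ N \<le> C"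
    using deriv_bound[of k] by blast
  then show ?case
    by (intro exI[of _ C] exI[of _ N] ballI order_trans[OF mult_right_mono[OF abs_Im_le_cmod]])
       (auto simp: boundary_gauge_nonneg)
next
  case (add c d)
  then obtain C N D M where c: "\<And>x. x \<in> U \<Longrightarrow> \<bar>c x\<bar> * boundary_gauge U x ^ N \<le> C"
    and d: "\<And>x. x \<in> U \<Longrightarrow> \<bar>d x\<bar> * boundary_gauge U x ^ M \<le> D" by metis
  have "\<bar>c x + d x\<bar> * boundary_gauge U x ^ (N + M) \<le> C + D" if x: "x \<in> U" for x
  proof -
    have "\<bar>c x + d x\<bar> * boundary_gauge U x ^ (N + M)
        \<le> \<bar>c x\<bar> * boundary_gauge U x ^ (N + M) + \<bar>d x\<bar> * boundary_gauge U x ^ (N + M)"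
      by (simp add: boundary_gauge_nonneg abs_triangle_ineq mult_right_mono flip: distrib_right)
    also have "\<dots> \<le> \<bar>c x\<bar> * boundary_gauge U x ^ N + \<bar>d x\<bar> * boundary_gauge U x ^ M"
      by (intro add_mono mult_left_mono gauge_power_antimono) auto
    also have "\<dots> \<le> C + D" by (intro add_mono c d x)
    finally show ?thesis .
  qed
  then show ?case by blast
next
  case (mult c d)
  then obtain C N D M where c: "\<And>x. x \<in> U \<Longrightarrow> \<bar>c x\<bar> * boundary_gauge U x ^ N \<le> C"
    and d: "\<And>x. x \<in> U \<Longrightarrow> \<bar>d x\<bar> * boundary_gauge U x ^ M \<le> D" by metis
  have "\<bar>c x * d x\<bar> * boundary_gauge U x ^ (N + M) \<le> C * D" if x: "x \<in> U" for x
  proof -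
    have "\<bar>c x * d x\<bar> * boundary_gauge U x ^ (N + M) =
       (\<bar>c x\<bar> * boundary_gauge U x ^ N) * (\<bar>d x\<bar> * boundary_gauge U x ^ M)"
      by (simp add: abs_mult power_add)
    also have "\<dots> \<le> C * D"
      using c[OF x] by (intro mult_mono c d x order_trans[OF _ c[OF x]]) (auto simp: boundary_gauge_nonneg)
    finally show ?thesis .
  qed
  then show ?case by blast
qed

text \<open>The shape, on \<open>U\<close>, of every partial derivative of a pullback: sums of
  coefficients times derivatives of \<open>s\<close> evaluated at \<open>\<phi> x\<close>. The
  operators do not depend on \<open>s\<close>, and this uniformity is what turns pointwise bounds
  into continuity estimates.\<close>

inductive_set ops :: "((complex \<Rightarrow> real) \<Rightarrow> complex \<Rightarrow> real) set" where
  eval: "bs \<in> lists Basis \<Longrightarrow> (\<lambda>s x. iter_partial bs s (\<phi> x)) \<in> ops"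
| mult: "c \<in> coeffs \<Longrightarrow> L \<in> ops \<Longrightarrow> (\<lambda>s x. c x * L s x) \<in> ops"
| add: "L \<in> ops \<Longrightarrow> M \<in> ops \<Longrightarrow> (\<lambda>s x. L s x + M s x) \<in> ops"

lemma ops_derivative:
  assumes "L \<in> ops"
  shows "\<exists>L1\<in>ops. \<exists>L2\<in>ops. \<forall>s\<in>schwartz_space. \<forall>x\<in>U.
    (L s has_derivative (\<lambda>v. Re v * L1 s x + Im v * L2 s x)) (at x)"
  using assms
proof induction
  case (eval bs)
  define L where "L = (\<lambda>b s x. iter_partial (b # bs) s (\<phi> x) :: real)"
  have L: "L 1 \<in> ops" "L \<i> \<in> ops"
    unfolding L_def by (intro ops.eval; use eval in \<open>simp add: Basis_complex_def\<close>)+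
  define R where "R = (\<lambda>x. Re ((deriv ^^ Suc 0) \<phi> x))"
  define I where "I = (\<lambda>x. Im ((deriv ^^ Suc 0) \<phi> x))"
  have RI: "R \<in> coeffs" "I \<in> coeffs" unfolding R_def I_def by (rule coeffs.Re coeffs.Im)+
  have "((\<lambda>x. iter_partial bs s (\<phi> x)) has_derivative
     (\<lambda>v. Re v * (R x * L 1 s x + I x * L \<i> s x) + Im v * (- I x * L 1 s x + R x * L \<i> s x))) (at x)"
    if s: "s \<in> schwartz_space" and x: "x \<in> U" for s x
  proof -
    have d: "iter_partial bs s differentiable at (\<phi> x)"
      by (rule schwartz_differentiable[OF s eval])
    have "(\<phi> has_derivative (*) (deriv \<phi> x)) (at x)"
      using higher_deriv[OF x, of 0] by (simp add: has_field_derivative_def)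
    then have "((\<lambda>x. iter_partial bs s (\<phi> x)) has_derivative
       (\<lambda>v. frechet_derivative (iter_partial bs s) (at (\<phi> x)) (deriv \<phi> x * v))) (at x)"
      by (rule has_derivative_compose[where g = "iter_partial bs s"])
         (use d in \<open>simp add: frechet_derivative_works\<close>)
    then show ?thesis
      by (rule has_derivative_eq_rhs)
         (simp add: fun_eq_iff frechet_derivative_basis_expansion[OF d] Basis_complex_def
            L_def R_def I_def inner_complex_def algebra_simps)
  qed
  then show ?case
    by (intro bexI[OF _ ops.add[OF ops.mult[OF RI(1) L(1)] ops.mult[OF RI(2) L(2)]]]
          bexI[OF _ ops.add[OF ops.mult[OF coeffs_uminus[OF RI(2)] L(1)] ops.mult[OF RI(1) L(2)]]]) simp
next
  case (mult c L)
  then obtain c1 c2 L1 L2 where m: "c1 \<in> coeffs" "c2 \<in> coeffs" "L1 \<in> ops" "L2 \<in> ops"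
    and c: "\<And>x. x \<in> U \<Longrightarrow> (c has_derivative (\<lambda>v. Re v * c1 x + Im v * c2 x)) (at x)"
    and d: "\<And>s x. s \<in> schwartz_space \<Longrightarrow> x \<in> U \<Longrightarrow>
       (L s has_derivative (\<lambda>v. Re v * L1 s x + Im v * L2 s x)) (at x)"
    using coeffs_derivative[OF mult.hyps(1)] by blast
  have "((\<lambda>x. c x * L s x) has_derivative
      (\<lambda>v. Re v * (c x * L1 s x + c1 x * L s x) + Im v * (c x * L2 s x + c2 x * L s x))) (at x)"
    if "s \<in> schwartz_space" "x \<in> U" for s x
    using has_derivative_mult[OF c[OF that(2)] d[OF that]]
    by (rule has_derivative_eq_rhs) (auto simp: algebra_simps)
  then show ?case
    by (intro bexI[OF _ ops.add[OF ops.mult[OF mult.hyps(1) m(3)] ops.mult[OF m(1) mult.hyps(2)]]]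
         bexI[OF _ ops.add[OF ops.mult[OF mult.hyps(1) m(4)] ops.mult[OF m(2) mult.hyps(2)]]]) simp
next
  case (add L M)
  then obtain L1 L2 M1 M2 where m: "L1 \<in> ops" "L2 \<in> ops" "M1 \<in> ops" "M2 \<in> ops"
    and c: "\<And>s x. s \<in> schwartz_space \<Longrightarrow> x \<in> U \<Longrightarrow>
       (L s has_derivative (\<lambda>v. Re v * L1 s x + Im v * L2 s x)) (at x)"
    and d: "\<And>s x. s \<in> schwartz_space \<Longrightarrow> x \<in> U \<Longrightarrow>
       (M s has_derivative (\<lambda>v. Re v * M1 s x + Im v * M2 s x)) (at x)" by blast
  have "((\<lambda>x. L s x + M s x) has_derivative
      (\<lambda>v. Re v * (L1 s x + M1 s x) + Im v * (L2 s x + M2 s x))) (at x)"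
    if "s \<in> schwartz_space" "x \<in> U" for s x
    using has_derivative_add[OF c[OF that] d[OF that]]
    by (rule has_derivative_eq_rhs) (auto simp: algebra_simps)
  then show ?case
    by (intro bexI[OF _ ops.add[OF m(1,3)]] bexI[OF _ ops.add[OF m(2,4)]]) simp
qed

text \<open>The order \<open>N\<close> is arbitrary, and this is what absorbs the coefficients: for
  a coefficient that grows like the power -M of the gauge, the remaining operator is estimated to
  order \<open>M + N\<close>. For a plain derivative of \<open>s\<close>, flatness of order
  \<open>N0 * N\<close> at the complement of \<open>V\<close> becomes order \<open>N\<close> for
  \<open>U\<close> through \<open>gauge_bound\<close>.\<close>

lemma ops_bound:
  assumes "L \<in> ops"
  shows "\<exists>C n. 0 \<le> C \<and> (\<forall>s\<in>schwartz_space_on V. \<forall>x\<in>U.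
    \<bar>L s x\<bar> \<le> C * boundary_gauge U x ^ N * schwartz_norm n s)"
  using assms
proof (induction arbitrary: N)
  case (eval bs)
  obtain C0 N0 where g: "\<And>x. x \<in> U \<Longrightarrow> boundary_gauge V (\<phi> x) ^ N0 \<le> C0 * boundary_gauge U x"
    using gauge_bound by blast
  obtain C n where C: "0 \<le> C" and L: "\<And>s x. s \<in> schwartz_space_on V \<Longrightarrow>
    \<bar>iter_partial bs s x\<bar> \<le> C * boundary_gauge V x ^ (N0 * N) * schwartz_norm n s"
    using schwartz_flat_gauge[OF open_V V_ne eval(1)] by blast
  have "\<bar>iter_partial bs s (\<phi> x)\<bar> \<le> (C * \<bar>C0\<bar> ^ N) * boundary_gauge U x ^ N * schwartz_norm n s"
    if s: "s \<in> schwartz_space_on V" and x: "x \<in> U" for s x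
  proof -
    note nn = schwartz_norm_nonneg[OF schwartz_space_onD(1)[OF s]]
    have "boundary_gauge V (\<phi> x) ^ (N0 * N) = (boundary_gauge V (\<phi> x) ^ N0) ^ N"
      by (simp add: power_mult)
    also have "\<dots> \<le> (C0 * boundary_gauge U x) ^ N"
      by (intro power_mono g x) (simp add: boundary_gauge_nonneg)
    also have "\<dots> \<le> (\<bar>C0\<bar> * boundary_gauge U x) ^ N"
      using order_trans[OF _ g[OF x], of 0]
      by (intro power_mono mult_right_mono) (auto simp: boundary_gauge_nonneg)
    finally have "C * boundary_gauge V (\<phi> x) ^ (N0 * N) * schwartz_norm n s \<le>
       C * (\<bar>C0\<bar> * boundary_gauge U x) ^ N * schwartz_norm n s"
      using C nn by (intro mult_right_mono mult_left_mono)
    then show ?thesis using L[OF s, of "\<phi> x"] by (simp add: power_mult_distrib mult.assoc)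
  qed
  then show ?case using C by (intro exI[of _ "C * \<bar>C0\<bar> ^ N"] exI[of _ n]) auto
next
  case (mult c L)
  obtain D M where c: "\<And>x. x \<in> U \<Longrightarrow> \<bar>c x\<bar> * boundary_gauge U x ^ M \<le> D"
    using coeffs_bound[OF mult.hyps(1)] by blast
  obtain C n where C: "0 \<le> C" and L: "\<And>s x. s \<in> schwartz_space_on V \<Longrightarrow> x \<in> U \<Longrightarrow>
    \<bar>L s x\<bar> \<le> C * boundary_gauge U x ^ (M + N) * schwartz_norm n s" using mult.IH by blast
  have "\<bar>c x * L s x\<bar> \<le> (\<bar>D\<bar> * C) * boundary_gauge U x ^ N * schwartz_norm n s"
    if s: "s \<in> schwartz_space_on V" and x: "x \<in> U" for s x
  proof -
    note nn = schwartz_norm_nonneg[OF schwartz_space_onD(1)[OF s]]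
    have "\<bar>c x * L s x\<bar> \<le> \<bar>c x\<bar> * (C * boundary_gauge U x ^ (M + N) * schwartz_norm n s)"
      unfolding abs_mult by (intro mult_left_mono L s x) auto
    also have "\<dots> = (\<bar>c x\<bar> * boundary_gauge U x ^ M) * (C * boundary_gauge U x ^ N * schwartz_norm n s)"
      by (simp add: power_add)
    also have "\<dots> \<le> \<bar>D\<bar> * (C * boundary_gauge U x ^ N * schwartz_norm n s)"
      using c[OF x] C nn by (intro mult_right_mono) (auto simp: boundary_gauge_nonneg)
    finally show ?thesis by (simp add: mult.assoc)
  qed
  then show ?case using C by (intro exI[of _ "\<bar>D\<bar> * C"] exI[of _ n]) auto
next
  case (add L M)
  obtain C n where C: "0 \<le> C" and L: "\<And>s x. s \<in> schwartz_space_on V \<Longrightarrow> x \<in> U \<Longrightarrow>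
    \<bar>L s x\<bar> \<le> C * boundary_gauge U x ^ N * schwartz_norm n s" using add.IH(1) by blast
  obtain D m where D: "0 \<le> D" and M: "\<And>s x. s \<in> schwartz_space_on V \<Longrightarrow> x \<in> U \<Longrightarrow>
    \<bar>M s x\<bar> \<le> D * boundary_gauge U x ^ N * schwartz_norm m s" using add.IH(2) by blast
  have "\<bar>L s x + M s x\<bar> \<le> (C + D) * boundary_gauge U x ^ N * schwartz_norm (max n m) s"
    if s: "s \<in> schwartz_space_on V" and x: "x \<in> U" for s x
  proof -
    note sS = schwartz_space_onD(1)[OF s]
    have "\<bar>L s x + M s x\<bar> \<le> C * boundary_gauge U x ^ N * schwartz_norm n s
        + D * boundary_gauge U x ^ N * schwartz_norm m s"
      using L[OF s x] M[OF s x] by linarith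
    also have "\<dots> \<le> C * boundary_gauge U x ^ N * schwartz_norm (max n m) s
        + D * boundary_gauge U x ^ N * schwartz_norm (max n m) s"
      using C D by (intro add_mono mult_left_mono schwartz_norm_mono sS) (auto simp: boundary_gauge_nonneg)
    finally show ?thesis by (simp add: algebra_simps)
  qed
  then show ?case using C D by (intro exI[of _ "C + D"] exI[of _ "max n m"]) auto
qed

text \<open>At a point \<open>x\<close> outside \<open>U\<close> the bound of order 2 makes the
  function O(|y - x|^2), since the gauge at \<open>y\<close> is at most the distance to
  \<open>x\<close>. Hence the extension by zero has derivative 0 there, whatever the boundary looks
  like.\<close>

lemma ops_extension_derivative:
  assumes "L \<in> ops"
  shows "\<exists>L1\<in>ops. \<exists>L2\<in>ops. \<forall>s\<in>schwartz_space_on V. \<forall>x.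
    ((\<lambda>x. if x \<in> U then L s x else 0) has_derivative
      (\<lambda>v. if x \<in> U then Re v * L1 s x + Im v * L2 s x else 0)) (at x)"
proof -
  obtain L1 L2 where m: "L1 \<in> ops" "L2 \<in> ops"
    and d: "\<And>s x. s \<in> schwartz_space \<Longrightarrow> x \<in> U \<Longrightarrow>
       (L s has_derivative (\<lambda>v. Re v * L1 s x + Im v * L2 s x)) (at x)"
    using ops_derivative[OF assms] by blast
  obtain C n where C: "0 \<le> C" and L: "\<And>s x. s \<in> schwartz_space_on V \<Longrightarrow> x \<in> U \<Longrightarrow>
    \<bar>L s x\<bar> \<le> C * boundary_gauge U x ^ 2 * schwartz_norm n s" using ops_bound[OF assms] by blast
  have "((\<lambda>x. if x \<in> U then L s x else 0) has_derivative
      (\<lambda>v. if x \<in> U then Re v * L1 s x + Im v * L2 s x else 0)) (at x)"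
    if s: "s \<in> schwartz_space_on V" for s x
  proof (cases "x \<in> U")
    case True
    have "((\<lambda>x. if x \<in> U then L s x else 0) has_derivative (\<lambda>v. Re v * L1 s x + Im v * L2 s x)) (at x)"
      using d[OF schwartz_space_onD(1)[OF s] True]
      by (rule has_derivative_transform_within_open[OF _ open_U True]) auto
    then show ?thesis using True by simp
  next
    case False
    define D where "D = C * schwartz_norm n s"
    have D: "0 \<le> D" using C schwartz_norm_nonneg[OF schwartz_space_onD(1)[OF s]] by (simp add: D_def)
    have b: "\<bar>if y \<in> U then L s y else 0\<bar> \<le> D * norm (y - x) ^ 2" for y
    proof (cases "y \<in> U")
      case True
      have "boundary_gauge U y ^ 2 \<le> norm (y - x) ^ 2"
        using boundary_gauge_le_dist[OF False, of y]
        by (intro power_mono) (auto simp: boundary_gauge_nonneg dist_norm)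
      then have "D * boundary_gauge U y ^ 2 \<le> D * norm (y - x) ^ 2" using D by (rule mult_left_mono)
      then show ?thesis using L[OF s True] True by (simp add: D_def mult_ac)
    qed (use D in auto)
    have "((\<lambda>x. if x \<in> U then L s x else 0) has_derivative (\<lambda>v. 0)) (at x)"
      unfolding has_derivative_iff_norm
    proof (intro conjI bounded_linear_zero)
      have "((\<lambda>y. D * norm (y - x)) \<longlongrightarrow> D * norm (x - x)) (at x)"
        by (intro tendsto_intros)
      then have lim: "((\<lambda>y. D * norm (y - x)) \<longlongrightarrow> 0) (at x)" by simp
      show "((\<lambda>y. norm ((if y \<in> U then L s y else 0) - (if x \<in> U then L s x else 0) - 0) / norm (y - x))
         \<longlongrightarrow> 0) (at x)"
        by (rule Lim_null_comparison[OF always_eventually lim])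
           (use b False D in \<open>auto simp: divide_le_eq power2_eq_square mult.assoc\<close>)
    qed
    then show ?thesis using False by simp
  qed
  then show ?thesis using m by blast
qed

lemma iter_partial_pullback:
  assumes "bs \<in> lists Basis"
  shows "\<exists>L\<in>ops. \<forall>s\<in>schwartz_space_on V.
    iter_partial bs (schwartz_pullback U \<phi> s) = (\<lambda>x. if x \<in> U then L s x else 0)"
  using assms
proof (induction bs)
  case Nil
  have "(\<lambda>s x. iter_partial [] s (\<phi> x)) \<in> ops" by (rule ops.eval) simp
  then show ?case by (rule bexI[rotated]) (simp add: schwartz_pullback_def cong: if_cong)
next
  case (Cons b bs)
  then obtain L where L: "L \<in> ops" and eq: "\<And>s. s \<in> schwartz_space_on V \<Longrightarrow>
     iter_partial bs (schwartz_pullback U \<phi> s) = (\<lambda>x. if x \<in> U then L s x else 0)" by auto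
  obtain L1 L2 where m: "L1 \<in> ops" "L2 \<in> ops" and d: "\<And>s x. s \<in> schwartz_space_on V \<Longrightarrow>
    ((\<lambda>x. if x \<in> U then L s x else 0) has_derivative
      (\<lambda>v. if x \<in> U then Re v * L1 s x + Im v * L2 s x else 0)) (at x)"
    using ops_extension_derivative[OF L] by blast
  have "b \<in> Basis" using Cons by simp
  then have "b = 1 \<or> b = \<i>" by (auto simp: Basis_complex_def)
  then show ?case
  proof
    assume "b = 1"
    then show ?thesis using m(1) by (intro bexI[of _ L1]) (auto simp: eq partial_deriv_eq[OF d])
  next
    assume "b = \<i>"
    then show ?thesis using m(2) by (intro bexI[of _ L2]) (auto simp: eq partial_deriv_eq[OF d])
  qed
qed

lemma pullback_differentiable:
  assumes "s \<in> schwartz_space_on V" "bs \<in> lists Basis"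
  shows "iter_partial bs (schwartz_pullback U \<phi> s) differentiable at x"
  using iter_partial_pullback[OF assms(2)] ops_extension_derivative assms(1)
  unfolding differentiable_def by (metis (no_types, lifting))

lemma pullback_estimate:
  assumes "bs \<in> lists Basis"
  shows "\<exists>C n. \<forall>s\<in>schwartz_space_on V. \<forall>x.
    (1 + norm x) ^ k * \<bar>iter_partial bs (schwartz_pullback U \<phi> s) x\<bar> \<le> C * schwartz_norm n s"
proof -
  obtain L where L: "L \<in> ops" and eq: "\<And>s. s \<in> schwartz_space_on V \<Longrightarrow>
     iter_partial bs (schwartz_pullback U \<phi> s) = (\<lambda>x. if x \<in> U then L s x else 0)"
    using iter_partial_pullback[OF assms] by blast
  obtain C n where C: "0 \<le> C" and b: "\<And>s x. s \<in> schwartz_space_on V \<Longrightarrow> x \<in> U \<Longrightarrow>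
    \<bar>L s x\<bar> \<le> C * boundary_gauge U x ^ k * schwartz_norm n s" using ops_bound[OF L] by blast
  have "(1 + norm x) ^ k * \<bar>iter_partial bs (schwartz_pullback U \<phi> s) x\<bar> \<le> C * schwartz_norm n s"
    if s: "s \<in> schwartz_space_on V" for s x
  proof (cases "x \<in> U")
    case True
    note nn = schwartz_norm_nonneg[OF schwartz_space_onD(1)[OF s], of n]
    have "(1 + norm x) ^ k * \<bar>L s x\<bar> \<le> (1 + norm x) ^ k * (C * boundary_gauge U x ^ k * schwartz_norm n s)"
      by (intro mult_left_mono b s True) simp
    also have "\<dots> = (boundary_gauge U x * (1 + norm x)) ^ k * (C * schwartz_norm n s)"
      by (simp add: power_mult_distrib mult_ac)
    also have "\<dots> \<le> 1 * (C * schwartz_norm n s)"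
      using C nn boundary_gauge_le_inverse_norm[of U x]
      by (intro mult_right_mono power_le_one) (auto simp: boundary_gauge_nonneg)
    finally show ?thesis using True by (simp add: eq[OF s])
  next
    case False
    then show ?thesis
      using C schwartz_norm_nonneg[OF schwartz_space_onD(1)[OF s], of n] by (simp add: eq[OF s])
  qed
  then show ?thesis by blast
qed

lemma pullback_in_schwartz_space_on:
  assumes s: "s \<in> schwartz_space_on V"
  shows "schwartz_pullback U \<phi> s \<in> schwartz_space_on U"
  unfolding schwartz_space_on_def schwartz_space_def smooth_on_def
proof (intro CollectI conjI ballI allI impI)
  fix bs x assume bs: "bs \<in> lists (Basis :: complex set)"
  show "iter_partial bs (schwartz_pullback U \<phi> s) differentiable at x"
    by (rule pullback_differentiable[OF s bs])
  show "iter_partial bs (schwartz_pullback U \<phi> s) x = 0" if "x \<notin> U"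
    using iter_partial_pullback[OF bs] s that by auto
next
  fix k and bs :: "complex list" assume bs: "bs \<in> lists Basis"
  obtain C n where "\<And>x. (1 + norm x) ^ k * \<bar>iter_partial bs (schwartz_pullback U \<phi> s) x\<bar> \<le> C * schwartz_norm n s"
    using pullback_estimate[OF bs, of k] s by metis
  then show "bounded (range (\<lambda>x. (1 + norm x) ^ k * iter_partial bs (schwartz_pullback U \<phi> s) x))"
    by (auto simp: bounded_iff abs_mult)
qed

lemma continuous_map_pullback:
  "continuous_map (schwartz_topology_on V) (schwartz_topology_on U) (schwartz_pullback U \<phi>)"
proof (rule continuous_map_schwartz[OF pullback_in_schwartz_space_on])
  fix k and bs :: "complex list" assume "bs \<in> lists Basis"
  from pullback_estimate[OF this, of k]
  show "\<exists>C n. \<forall>s\<in>schwartz_space_on V.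
      schwartz_seminorm k bs (schwartz_pullback U \<phi> s) \<le> C * schwartz_norm n s"
    by (meson schwartz_seminorm_least)
qed (auto simp: schwartz_pullback_def)

text \<open>The partial derivative of a holomorphic function in direction \<open>b\<close> is
  \<open>b\<close> times its complex derivative, so iterated partial derivatives are constant
  multiples of higher complex derivatives.\<close>

lemma smooth: "smooth_on U \<phi>"
proof -
  have "\<exists>c. \<forall>x\<in>U. iter_partial bs \<phi> x = c * (deriv ^^ length bs) \<phi> x"
    if "bs \<in> lists Basis" for bs :: "complex list"
    using that
  proof (induction bs)
    case Nil
    show ?case by (rule exI[of _ 1]) simp
  next
    case (Cons b bs)
    then obtain c where c: "\<And>x. x \<in> U \<Longrightarrow> iter_partial bs \<phi> x = c * (deriv ^^ length bs) \<phi> x" by auto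
    have "iter_partial (b # bs) \<phi> x = b * c * (deriv ^^ length (b # bs)) \<phi> x" if x: "x \<in> U" for x
    proof -
      have "((\<lambda>x. c * (deriv ^^ length bs) \<phi> x) has_field_derivative
          c * (deriv ^^ Suc (length bs)) \<phi> x) (at x)"
        by (rule DERIV_cmult[OF higher_deriv[OF x]])
      then have "(iter_partial bs \<phi> has_derivative (*) (c * (deriv ^^ Suc (length bs)) \<phi> x)) (at x)"
        unfolding has_field_derivative_def
        by (rule has_derivative_transform_within_open[OF _ open_U x]) (simp add: c)
      then show ?thesis by (simp add: partial_deriv_eq)
    qed
    then show ?case by blast
  qed
  then show ?thesis
    unfolding smooth_on_def
  proof (intro ballI)
    fix bs x assume bs: "bs \<in> lists (Basis :: complex set)" and x: "x \<in> U"
    assume *: "\<And>bs. bs \<in> lists Basis \<Longrightarrow> \<exists>c. \<forall>x\<in>U. iter_partial bs \<phi> x = c * (deriv ^^ length bs) \<phi> x"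
    then obtain c where c: "\<And>x. x \<in> U \<Longrightarrow> iter_partial bs \<phi> x = c * (deriv ^^ length bs) \<phi> x"
      using bs by blast
    have "((\<lambda>x. c * (deriv ^^ length bs) \<phi> x) has_field_derivative
          c * (deriv ^^ Suc (length bs)) \<phi> x) (at x)"
      by (rule DERIV_cmult[OF higher_deriv[OF x]])
    then have "(iter_partial bs \<phi> has_derivative (*) (c * (deriv ^^ Suc (length bs)) \<phi> x)) (at x)"
      unfolding has_field_derivative_def
      by (rule has_derivative_transform_within_open[OF _ open_U x]) (simp add: c)
    then show "iter_partial bs \<phi> differentiable at x" unfolding differentiable_def by blast
  qed
qed

end

lemma schwartz_equivalentI:
  assumes f: "tempered_map U V f" and g: "tempered_map V U g"
    and gf: "\<And>x. x \<in> U \<Longrightarrow> g (f x) = x" and fg: "\<And>y. y \<in> V \<Longrightarrow> f (g y) = y"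
  shows "schwartz_equivalent U V"
proof -
  interpret f: tempered_map U V f by fact
  interpret g: tempered_map V U g by fact
  have bij: "bij_betw f U V"
    by (rule bij_betwI[where g = g]) (use f.into g.into gf fg in auto)
  have inv: "inv_into U f y = g y" if "y \<in> V" for y
    using that gf fg g.into bij by (metis bij_betw_imp_inj_on inv_into_f_f)
  \<comment> \<open>\<open>inv_into U f\<close> is unspecified outside \<open>V\<close>, but
    iterated derivatives at points of the open set \<open>V\<close> see only the values on
    \<open>V\<close>, where it equals \<open>g\<close>.\<close>
  have "iter_partial bs (inv_into U f) y = iter_partial bs g y" if "y \<in> V" for bs y
    using that
  proof (induction bs arbitrary: y)
    case (Cons b bs)
    have "(iter_partial bs (inv_into U f) has_derivative D) (at y) \<longleftrightarrow>
          (iter_partial bs g has_derivative D) (at y)" for D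
      using has_derivative_transform_within_open[OF _ f.open_V Cons.prems]
        Cons.IH by metis
    then show ?case by (simp add: partial_deriv_def frechet_derivative_def)
  qed (simp add: inv)
  note eq = this
  have "smooth_on V (inv_into U f)"
    unfolding smooth_on_def
  proof (intro ballI)
    fix bs y assume bs: "bs \<in> lists (Basis :: complex set)" and y: "y \<in> V"
    obtain D where "(iter_partial bs g has_derivative D) (at y)"
      using g.smooth bs y unfolding smooth_on_def differentiable_def by blast
    then have "(iter_partial bs (inv_into U f) has_derivative D) (at y)"
      by (rule has_derivative_transform_within_open[OF _ f.open_V y]) (simp add: eq)
    then show "iter_partial bs (inv_into U f) differentiable at y"
      by (auto simp: differentiable_def)
  qed
  then have "smooth_diffeomorphism U V f"
    by (simp add: smooth_diffeomorphism_def bij f.smooth)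
  moreover have "schwartz_isomorphism V U (schwartz_pullback U f)"
    unfolding schwartz_isomorphism_def
  proof (intro conjI ballI allI)
    \<comment> \<open>Elements of the spaces vanish off the open set (the empty multi-index), so the
      two pullbacks, both extended by zero, are inverse to each other.\<close>
    have z: "s x = 0" if "s \<in> schwartz_space_on W" "x \<notin> W" for s W and x :: complex
      using that by (auto simp: schwartz_space_on_def dest: bspec[of _ _ "[]"])
    have "homeomorphic_maps (schwartz_topology_on V) (schwartz_topology_on U)
        (schwartz_pullback U f) (schwartz_pullback V g)"
      unfolding homeomorphic_maps_def
      using f.continuous_map_pullback g.continuous_map_pullback
      by (auto simp: topspace_schwartz_topology_on schwartz_pullback_def fun_eq_iff gf fg f.into g.into z)
    then show "homeomorphic_map (schwartz_topology_on V) (schwartz_topology_on U) (schwartz_pullback U f)"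
      using homeomorphic_maps_map by blast
  qed (auto simp: schwartz_pullback_def)
  ultimately show ?thesis
    unfolding schwartz_equivalent_def using f.open_U f.open_V by blast
qed

section \<open>Growth of univalent functions\<close>

text \<open>Otherwise Bloch's theorem puts a disc of radius 7 into the image of the logarithm
  \<open>h\<close>. As 7 > 2 pi, this disc contains two points that differ by 2 pi i, at which the
  exponential agrees, against injectivity of \<open>f\<close>. The constant 84 is 7 times the
  denominator 12 in Bloch's theorem.\<close>

lemma univalent_log_deriv_bound:
  assumes inj: "inj_on f (ball 0 1)"
    and h: "h holomorphic_on ball 0 1" "\<And>z. z \<in> ball 0 1 \<Longrightarrow> f z - a = exp (h z)"
    and z: "z \<in> ball (0::complex) 1"
  shows "norm (deriv h z) * (1 - norm z) \<le> 84"
proof (rule ccontr)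
  assume "\<not> ?thesis"
  then have big: "7 \<le> (1 - norm z) * norm (deriv h z) / 12" by (simp add: mult.commute)
  have sub: "ball z (1 - norm z) \<subseteq> ball 0 1"
    by (auto simp: dist_norm) (metis add.commute diff_add_cancel less_diff_eq norm_minus_commute norm_triangle_sub order_le_less_trans)
  obtain b where b: "ball b 7 \<subseteq> h ` ball z (1 - norm z)"
    using Bloch[OF holomorphic_on_subset[OF h(1) sub] _ big] z by auto
  have "b \<in> ball b 7" by simp
  moreover have "b + 2 * of_real pi * \<i> \<in> ball b 7"
    using pi_approx by (simp add: dist_norm norm_mult)
  ultimately obtain x y where x: "x \<in> ball 0 1" "h x = b" and y: "y \<in> ball 0 1" "h y = b + 2 * of_real pi * \<i>"
    using b sub by (smt (verit) imageE subsetD)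
  have "f x - a = f y - a"
    unfolding h(2)[OF x(1)] h(2)[OF y(1)] x(2) y(2) by (simp add: exp_add mult.commute)
  then have "x = y" using inj x(1) y(1) by (auto dest: inj_onD)
  then show False using x y by simp
qed

text \<open>The bound for the logarithmic derivative is integrated along the radius to
  \<open>z\<close>: comparison with \<open>84 * ln (1 - t * r)\<close> shows that log |f - a|
  changes by at most 84 log (1 / (1 - r)). The exponent 84 is a crude substitute for a sharp one of
  Koebe type.\<close>

theorem univalent_growth:
  assumes holf: "f holomorphic_on ball 0 1" and inj: "inj_on f (ball 0 1)"
    and a: "a \<notin> f ` ball 0 1" and z: "z \<in> ball (0::complex) 1"
  shows "norm (f 0 - a) * (1 - norm z) ^ 84 \<le> norm (f z - a)"
    and "norm (f z - a) * (1 - norm z) ^ 84 \<le> norm (f 0 - a)"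
proof -
  have "(\<lambda>z. f z - a) holomorphic_on ball 0 1" by (intro holomorphic_intros holf)
  moreover have "\<And>z. z \<in> ball 0 1 \<Longrightarrow> f z - a \<noteq> 0" using a by auto
  ultimately obtain h where h: "h holomorphic_on ball 0 1"
    "\<And>z. z \<in> ball 0 1 \<Longrightarrow> f z - a = exp (h z)"
    using contractible_imp_holomorphic_log[of "\<lambda>z. f z - a" "ball 0 1"] convex_imp_contractible[OF convex_ball]
    by (smt (verit, best))
  define r where "r = norm z"
  have r: "0 \<le> r" "r < 1" using z by (auto simp: r_def)
  have tr: "t * r < 1" if "0 \<le> t" "t \<le> 1" for t
    using mult_left_le_one_le[OF r(1) that] r by linarith
  have D: "((\<lambda>t. Re (h (of_real t * z))) has_field_derivative Re (deriv h (of_real t * z) * z)) (at t)"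
    and B: "\<bar>Re (deriv h (of_real t * z) * z)\<bar> \<le> 84 * r / (1 - t * r)" if t: "0 \<le> t" "t \<le> 1" for t
  proof -
    have tz: "of_real t * z \<in> ball 0 1" using tr[OF t] t by (simp add: norm_mult r_def)
    have "(h has_field_derivative deriv h (of_real t * z)) (at (of_real t * z))"
      by (rule holomorphic_derivI[OF h(1) open_ball tz])
    then have "((\<lambda>t. h (of_real t * z)) has_vector_derivative z * deriv h (of_real t * z)) (at t)"
      by (intro field_vector_diff_chain_at[where g = h, unfolded o_def])
         (auto intro!: derivative_eq_intros)
    then have "((\<lambda>t. Re (h (of_real t * z))) has_vector_derivative Re (z * deriv h (of_real t * z))) (at t)"
      by (rule bounded_linear.has_vector_derivative[OF bounded_linear_Re])
    then show "((\<lambda>t. Re (h (of_real t * z))) has_field_derivative Re (deriv h (of_real t * z) * z)) (at t)"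
      by (simp add: has_real_derivative_iff_has_vector_derivative mult.commute)
    have "\<bar>Re (deriv h (of_real t * z) * z)\<bar> \<le> norm (deriv h (of_real t * z)) * r"
      using abs_Re_le_cmod[of "deriv h (of_real t * z) * z"] by (simp only: norm_mult r_def)
    also have "\<dots> \<le> 84 / (1 - t * r) * r"
      using univalent_log_deriv_bound[OF inj h tz] tr[OF t] r t
      by (intro mult_right_mono) (auto simp: field_simps norm_mult r_def)
    finally show "\<bar>Re (deriv h (of_real t * z) * z)\<bar> \<le> 84 * r / (1 - t * r)"
      by (simp only: times_divide_eq_left)
  qed
  have L: "((\<lambda>t. 84 * ln (1 - t * r)) has_field_derivative - (84 * r / (1 - t * r))) (at t)"
    if t: "0 \<le> t" "t \<le> 1" for t
    using tr[OF t] by (auto intro!: derivative_eq_intros simp: field_simps)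
  have "Re (h (of_real 1 * z)) + 84 * ln (1 - 1 * r) \<le> Re (h (of_real 0 * z)) + 84 * ln (1 - 0 * r)"
  proof (rule DERIV_nonpos_imp_nonincreasing[of 0 1 "\<lambda>t. Re (h (of_real t * z)) + 84 * ln (1 - t * r)"])
    fix t :: real assume t: "0 \<le> t" "t \<le> 1"
    show "\<exists>y. ((\<lambda>t. Re (h (of_real t * z)) + 84 * ln (1 - t * r)) has_real_derivative y) (at t) \<and> y \<le> 0"
      using DERIV_add[OF D[OF t] L[OF t]] B[OF t] by (intro exI conjI) auto
  qed simp
  then have 1: "Re (h z) + 84 * ln (1 - r) \<le> Re (h 0)" by simp
  have "Re (h (of_real 0 * z)) - 84 * ln (1 - 0 * r) \<le> Re (h (of_real 1 * z)) - 84 * ln (1 - 1 * r)"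
  proof (rule DERIV_nonneg_imp_nondecreasing[of 0 1 "\<lambda>t. Re (h (of_real t * z)) - 84 * ln (1 - t * r)"])
    fix t :: real assume t: "0 \<le> t" "t \<le> 1"
    show "\<exists>y. ((\<lambda>t. Re (h (of_real t * z)) - 84 * ln (1 - t * r)) has_real_derivative y) (at t) \<and> 0 \<le> y"
      using DERIV_diff[OF D[OF t] L[OF t]] B[OF t] by (intro exI conjI) auto
  qed simp
  then have 2: "Re (h 0) + 84 * ln (1 - r) \<le> Re (h z)" by simp
  have pw: "(1 - norm z) ^ 84 = exp (84 * ln (1 - r))"
    using r by (simp add: exp_of_nat_mult[of 84, simplified] r_def)
  have n: "norm (f w - a) = exp (Re (h w))" if "w \<in> ball 0 1" for w
    unfolding h(2)[OF that] by simp
  show "norm (f 0 - a) * (1 - norm z) ^ 84 \<le> norm (f z - a)"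
    and "norm (f z - a) * (1 - norm z) ^ 84 \<le> norm (f 0 - a)"
    unfolding pw using n[OF z] n[of 0] 1 2 by (simp_all flip: exp_add)
qed

section \<open>Conformal maps of the disc: estimates valid for every simply connected domain\<close>

lemma infdist_complement_ball:
  assumes "z \<in> ball (0::complex) 1"
  shows "infdist z (- ball 0 1) = 1 - norm z"
proof (rule antisym)
  obtain u where u: "norm u = 1" "norm (z - u) = 1 - norm z"
  proof (cases "z = 0")
    case True
    then show ?thesis by (intro that[of 1]) auto
  next
    case False
    have "z - sgn z = (norm z - 1) *\<^sub>R sgn z"
      using False by (simp add: sgn_div_norm algebra_simps)
    then have "norm (z - sgn z) = \<bar>norm z - 1\<bar>" using False by (simp add: norm_sgn)
    then show ?thesis using False assms by (intro that[of "sgn z"]) (auto simp: norm_sgn)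
  qed
  then show "infdist z (- ball 0 1) \<le> 1 - norm z"
    using infdist_le[of u "- ball 0 1" z] by (simp add: dist_norm)
  have ne: "- ball (0::complex) 1 \<noteq> {}" using not_bounded_UNIV bounded_ball by (metis Compl_empty_eq double_complement)
  obtain p where "p \<in> - ball 0 1" "infdist z (- ball 0 1) = dist z p"
    using infdist_attains_inf[OF _ ne, of z] by auto
  then show "1 - norm z \<le> infdist z (- ball 0 1)"
    using norm_triangle_sub[of p z] by (auto simp: dist_norm norm_minus_commute)
qed

lemma boundary_gauge_disc:
  assumes z: "z \<in> ball (0::complex) 1"
  shows "boundary_gauge (ball 0 1) z \<le> 1 - norm z" "1 - norm z \<le> 2 * boundary_gauge (ball 0 1) z"
proof -
  have eq: "boundary_gauge (ball 0 1) z = (1 - norm z) / (1 + norm z)"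
    using z by (simp add: boundary_gauge_def infdist_complement_ball)
  show "boundary_gauge (ball 0 1) z \<le> 1 - norm z"
    unfolding eq using divide_left_mono[of 1 "1 + norm z" "1 - norm z"] z by (simp add: add_pos_nonneg)
  show "1 - norm z \<le> 2 * boundary_gauge (ball 0 1) z"
  proof -
    have "(1 - norm z) / 2 \<le> (1 - norm z) / (1 + norm z)"
      using z by (intro divide_left_mono) (auto simp: add_pos_nonneg)
    then show ?thesis unfolding eq by (simp add: mult.commute)
  qed
qed

locale disc_conformal =
  fixes U :: "complex set" and f g :: "complex \<Rightarrow> complex"
  assumes open_U: "open U" and U_ne: "U \<noteq> UNIV"
    and holf: "f holomorphic_on ball 0 1" and holg: "g holomorphic_on U"
    and f_in: "\<And>z. z \<in> ball 0 1 \<Longrightarrow> f z \<in> U" and g_in: "\<And>w. w \<in> U \<Longrightarrow> g w \<in> ball 0 1"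
    and gf: "\<And>z. z \<in> ball 0 1 \<Longrightarrow> g (f z) = z" and fg: "\<And>w. w \<in> U \<Longrightarrow> f (g w) = w"
begin

lemma inj_f: "inj_on f (ball 0 1)"
  by (rule inj_on_inverseI[where g = g]) (rule gf)

lemma omits: "a \<notin> U \<Longrightarrow> a \<notin> f ` ball 0 1"
  using f_in by auto

lemma disc_growth: "\<exists>B>0. \<forall>z\<in>ball 0 1. norm (f z) * (1 - norm z) ^ 84 \<le> B"
proof -
  obtain a where a: "a \<notin> U" using U_ne by auto
  have "norm (f z) * (1 - norm z) ^ 84 \<le> norm (f 0 - a) + norm a" if z: "z \<in> ball 0 1" for z
  proof -
    have p: "0 \<le> (1 - norm z) ^ 84" "(1 - norm z) ^ 84 \<le> 1"
      using z by (auto intro!: power_le_one)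
    have "norm (f z) * (1 - norm z) ^ 84 \<le> (norm (f z - a) + norm a) * (1 - norm z) ^ 84"
      using p by (intro mult_right_mono) (auto simp: norm_triangle_sub add.commute)
    also have "\<dots> \<le> norm (f 0 - a) + norm a"
      using univalent_growth(2)[OF holf inj_f omits[OF a] z] p mult_left_mono[OF p(2), of "norm a"]
      by (simp add: distrib_right)
    finally show ?thesis .
  qed
  moreover have "norm (f 0 - a) > 0" using f_in[of 0] a by auto
  ultimately show ?thesis by (intro exI[of _ "norm (f 0 - a) + norm a"]) (auto simp: add_pos_nonneg)
qed

text \<open>One factor \<open>(1 - norm z) ^ 84\<close> comes from the distance to the nearest
  omitted point, the other from the size of \<open>f z\<close> in the denominator of the gauge;
  hence the exponent 168.\<close>

lemma gauge_image_lower: "\<exists>c>0. \<forall>z\<in>ball 0 1. c * (1 - norm z) ^ 168 \<le> boundary_gauge U (f z)"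
proof -
  obtain B where B: "B > 0" and fB: "\<And>z. z \<in> ball 0 1 \<Longrightarrow> norm (f z) * (1 - norm z) ^ 84 \<le> B"
    using disc_growth by blast
  have cl: "closed (- U)" and ne: "- U \<noteq> {}" using open_U U_ne by auto
  define d where "d = infdist (f 0) (- U)"
  have d: "d > 0"
    using in_closed_iff_infdist_zero[OF cl ne, of "f 0"] f_in[of 0] infdist_nonneg[of "f 0" "- U"]
    by (auto simp: d_def)
  have "min 1 d / (1 + B) * (1 - norm z) ^ 168 \<le> boundary_gauge U (f z)" if z: "z \<in> ball 0 1" for z
  proof -
    define t where "t = (1 - norm z) ^ 84"
    have t: "0 < t" "t \<le> 1" using z by (auto simp: t_def intro!: power_le_one)
    obtain a where a: "a \<in> - U" "infdist (f z) (- U) = dist (f z) a"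
      using infdist_attains_inf[OF cl ne] by blast
    have "d * t \<le> norm (f 0 - a) * t"
      using infdist_le[OF a(1), of "f 0"] t by (intro mult_right_mono) (auto simp: d_def dist_norm)
    also have "\<dots> \<le> infdist (f z) (- U)"
      using univalent_growth(1)[OF holf inj_f omits z, of a] a by (simp add: t_def dist_norm)
    finally have dt: "d * t \<le> infdist (f z) (- U)" .
    have "t * min 1 d \<le> min 1 (infdist (f z) (- U))"
    proof (intro min.boundedI)
      show "t * min 1 d \<le> 1" using t d mult_mono[of t 1 "min 1 d" 1] by simp
      have "t * min 1 d \<le> t * d" using t by simp
      then show "t * min 1 d \<le> infdist (f z) (- U)"
        using dt by (simp add: mult.commute)
    qed
    moreover have "1 + norm (f z) \<le> (1 + B) / t"
      using fB[OF z] t by (simp add: field_simps t_def[symmetric])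
    ultimately have "t * min 1 d / ((1 + B) / t) \<le> boundary_gauge U (f z)"
      unfolding boundary_gauge_def using t d by (intro frac_le) (auto simp: add_pos_nonneg infdist_nonneg)
    moreover have "(1 - norm z) ^ 168 = t * t" by (simp add: t_def flip: power_add)
    ultimately show ?thesis by (simp add: mult_ac)
  qed
  moreover have "min 1 d / (1 + B) > 0" using d B by simp
  ultimately show ?thesis by blast
qed

text \<open>\<open>g\<close> maps into the unit disc, so Cauchy's inequality on a disc whose radius
  is half the gauge, and which therefore lies in \<open>U\<close>, bounds its derivatives by
  negative powers of the gauge. The comparison of gauges is the lower bound for the gauge at
  \<open>f z\<close>.\<close>

lemma tempered_inverse: "tempered_map U (ball 0 1) g"
proof
  show "ball (0::complex) 1 \<noteq> UNIV" using not_bounded_UNIV bounded_ball by metis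
  show "\<exists>C N. \<forall>w\<in>U. norm ((deriv ^^ Suc k) g w) * boundary_gauge U w ^ N \<le> C" for k
  proof (intro exI ballI)
    fix w assume w: "w \<in> U"
    define r where "r = boundary_gauge U w / 2"
    have r: "r > 0" using boundary_gauge_pos[OF open_U U_ne w] by (simp add: r_def)
    have sub: "cball w r \<subseteq> U"
    proof
      fix p assume "p \<in> cball w r"
      then have "dist w p < boundary_gauge U w" using r by (simp add: r_def)
      then show "p \<in> U" using boundary_gauge_le_dist[of p U w] by force
    qed
    have "norm ((deriv ^^ Suc k) g w) \<le> fact (Suc k) * 1 / r ^ Suc k"
    proof (rule Cauchy_inequality[OF _ _ r])
      show "g holomorphic_on ball w r" "continuous_on (cball w r) g"
        using holomorphic_on_subset[OF holg, of "ball w r"] holomorphic_on_subset[OF holg sub] sub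
          ball_subset_cball[of w r] holomorphic_on_imp_continuous_on by blast+
      fix x assume "norm (w - x) = r"
      then have "x \<in> U" using sub by (auto simp: dist_norm)
      then show "norm (g x) \<le> 1" using g_in[of x] by simp
    qed
    then show "norm ((deriv ^^ Suc k) g w) * boundary_gauge U w ^ Suc k \<le> fact (Suc k) * 2 ^ Suc k"
      using r by (simp add: r_def power_divide field_simps del: fact_Suc funpow.simps power_Suc)
  qed
  obtain c where c: "c > 0" "\<And>z. z \<in> ball 0 1 \<Longrightarrow> c * (1 - norm z) ^ 168 \<le> boundary_gauge U (f z)"
    using gauge_image_lower by blast
  have "boundary_gauge (ball 0 1) (g w) ^ 168 \<le> 1 / c * boundary_gauge U w" if w: "w \<in> U" for w
  proof -
    have "boundary_gauge (ball 0 1) (g w) ^ 168 \<le> (1 - norm (g w)) ^ 168"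
      by (intro power_mono boundary_gauge_disc g_in w boundary_gauge_nonneg)
    also have "\<dots> \<le> 1 / c * boundary_gauge U w"
      using c(2)[OF g_in[OF w]] c(1) fg[OF w] by (simp add: field_simps)
    finally show ?thesis .
  qed
  then show "\<exists>C N. \<forall>x\<in>U. boundary_gauge (ball 0 1) (g x) ^ N \<le> C * boundary_gauge U x" by blast
qed (use open_U U_ne holg g_in in auto)

text \<open>Cauchy's inequality on a disc of radius half the distance to the unit circle, on which
  \<open>f\<close> is bounded by \<open>B / r ^ 84\<close>. The assumption supplies the comparison
  of gauges.\<close>

lemma tempered:
  assumes "\<exists>C N. \<forall>z\<in>ball 0 1. boundary_gauge U (f z) ^ N \<le> C * (1 - norm z)"
  shows "tempered_map (ball 0 1) U f"
proof
  show "ball (0::complex) 1 \<noteq> UNIV" using not_bounded_UNIV bounded_ball by metis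
  show "\<exists>C N. \<forall>z\<in>ball 0 1. norm ((deriv ^^ Suc k) f z) * boundary_gauge (ball 0 1) z ^ N \<le> C" for k
  proof -
    obtain B where B: "B > 0" and fB: "\<And>z. z \<in> ball 0 1 \<Longrightarrow> norm (f z) * (1 - norm z) ^ 84 \<le> B"
      using disc_growth by blast
    have "norm ((deriv ^^ Suc k) f z) * boundary_gauge (ball 0 1) z ^ (84 + Suc k)
        \<le> fact (Suc k) * B * 2 ^ (84 + Suc k)" if z: "z \<in> ball 0 1" for z
    proof -
      define r where "r = (1 - norm z) / 2"
      have r: "r > 0" using z by (simp add: r_def)
      have x: "norm x \<le> 1 - r" if "norm (z - x) \<le> r" for x
        using norm_triangle_sub[of x z] that by (simp add: r_def norm_minus_commute field_simps)
      have sub: "cball z r \<subseteq> ball 0 1" using x r by (force simp: dist_norm)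
      have "norm ((deriv ^^ Suc k) f z) \<le> fact (Suc k) * (B / r ^ 84) / r ^ Suc k"
      proof (rule Cauchy_inequality[OF _ _ r])
        show "f holomorphic_on ball z r" "continuous_on (cball z r) f"
          using holomorphic_on_subset[OF holf, of "ball z r"] holomorphic_on_subset[OF holf sub] sub
            ball_subset_cball[of z r] holomorphic_on_imp_continuous_on by blast+
        fix y assume y: "norm (z - y) = r"
        then have "r ^ 84 \<le> (1 - norm y) ^ 84" using x[of y] r by (intro power_mono) auto
        then have "norm (f y) * r ^ 84 \<le> norm (f y) * (1 - norm y) ^ 84" by (rule mult_left_mono) simp
        also have "\<dots> \<le> B" using y sub by (intro fB) (auto simp: dist_norm)
        finally show "norm (f y) \<le> B / r ^ 84" using r by (simp add: field_simps)
      qed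
      then have "norm ((deriv ^^ Suc k) f z) \<le> fact (Suc k) * B / (r ^ 84 * r ^ Suc k)"
        by (simp only: divide_divide_eq_left times_divide_eq_right)
      moreover have "0 < r ^ 84 * r ^ Suc k" using r by simp
      ultimately have 1: "norm ((deriv ^^ Suc k) f z) * r ^ (84 + Suc k) \<le> fact (Suc k) * B"
        unfolding power_add by (simp only: pos_le_divide_eq)
      have "boundary_gauge (ball 0 1) z ^ (84 + Suc k) \<le> (2 * r) ^ (84 + Suc k)"
        using boundary_gauge_disc(1)[OF z] by (intro power_mono) (auto simp: r_def boundary_gauge_nonneg)
      then have "norm ((deriv ^^ Suc k) f z) * boundary_gauge (ball 0 1) z ^ (84 + Suc k)
        \<le> norm ((deriv ^^ Suc k) f z) * (2 * r) ^ (84 + Suc k)" by (rule mult_left_mono) simp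
      also have "\<dots> = norm ((deriv ^^ Suc k) f z) * r ^ (84 + Suc k) * 2 ^ (84 + Suc k)"
        by (simp only: power_mult_distrib mult_ac)
      also have "\<dots> \<le> fact (Suc k) * B * 2 ^ (84 + Suc k)"
        using 1 by (rule mult_right_mono) simp
      finally show ?thesis .
    qed
    then show ?thesis by blast
  qed
  obtain C N where C: "\<And>z. z \<in> ball 0 1 \<Longrightarrow> boundary_gauge U (f z) ^ N \<le> C * (1 - norm z)"
    using assms by blast
  have "boundary_gauge U (f z) ^ N \<le> \<bar>C\<bar> * 2 * boundary_gauge (ball 0 1) z" if z: "z \<in> ball 0 1" for z
  proof -
    have "C * (1 - norm z) \<le> \<bar>C\<bar> * (1 - norm z)" using z by (intro mult_right_mono) auto
    also have "\<dots> \<le> \<bar>C\<bar> * (2 * boundary_gauge (ball 0 1) z)"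
      by (intro mult_left_mono boundary_gauge_disc z) auto
    finally show ?thesis using C[OF z] by simp
  qed
  then show "\<exists>C N. \<forall>x\<in>ball 0 1. boundary_gauge U (f x) ^ N \<le> C * boundary_gauge (ball 0 1) x" by blast
qed (use open_U U_ne holf f_in in auto)

lemma equivalent_disc:
  assumes "\<exists>C N. \<forall>z\<in>ball 0 1. boundary_gauge U (f z) ^ N \<le> C * (1 - norm z)"
  shows "schwartz_equivalent U (ball 0 1)"
  by (rule schwartz_equivalentI[OF tempered_inverse tempered[OF assms] fg gf])

end

section \<open>The length-area argument\<close>

lemma measure_open_fmeasurable:
  fixes S :: "'a::euclidean_space set"
  assumes "open S" "bounded S" shows "S \<in> fmeasurable lborel"
  using assms emeasure_bounded_finite[of S] by (intro fmeasurableI) auto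

lemma content_cball_complex: "0 \<le> r \<Longrightarrow> measure lborel (cball (c::complex) r) = pi * r\<^sup>2"
  by (simp add: content_cball unit_ball_vol_2)

lemma content_ball_complex: "0 \<le> r \<Longrightarrow> measure lborel (ball (c::complex) r) = pi * r\<^sup>2"
  by (simp add: content_ball unit_ball_vol_2)

lemma open_univalent_image:
  assumes "f holomorphic_on S" "inj_on f S" "open T" "T \<subseteq> S"
  shows "open (f ` T)"
  using assms by (meson holomorphic_on_subset inj_on_subset open_mapping_thm3)

lemma chain_dist_le:
  fixes F :: "real \<Rightarrow> 'a::metric_space" and \<tau> a :: real
  assumes "0 \<le> \<tau>"
    and "\<And>k y. k < n \<Longrightarrow> a + real k * \<tau> \<le> y \<Longrightarrow> y \<le> a + real (Suc k) * \<tau> \<Longrightarrow>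
      dist (F y) (F (a + real k * \<tau>)) \<le> D k"
    and "a \<le> y" "y \<le> a + real n * \<tau>"
  shows "dist (F y) (F a) \<le> (\<Sum>k<n. D k)"
  using assms(2-)
proof (induction n arbitrary: y)
  case 0
  then show ?case by simp
next
  case (Suc n)
  have D: "0 \<le> D n"
    using order_trans[OF zero_le_dist Suc.prems(1)[of n "a + n * \<tau>"]] assms(1) by (simp add: algebra_simps)
  have IH: "dist (F y) (F a) \<le> (\<Sum>k<n. D k)" if "a \<le> y" "y \<le> a + n * \<tau>" for y
    using Suc.IH[of y] Suc.prems(1) that by simp
  show ?case
  proof (cases "y \<le> a + n * \<tau>")
    case True
    then show ?thesis using IH[OF Suc.prems(2) True] D by simp
  next
    case False
    have "dist (F y) (F a) \<le> dist (F y) (F (a + n * \<tau>)) + dist (F (a + n * \<tau>)) (F a)"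
      by (rule dist_triangle)
    also have "\<dots> \<le> D n + (\<Sum>k<n. D k)"
      using Suc.prems False assms(1) by (intro add_mono IH) auto
    finally show ?thesis by simp
  qed
qed

lemma exists_le_average:
  fixes S :: "nat \<Rightarrow> real"
  assumes "0 < N" "(\<Sum>j<N. S j) \<le> T"
  shows "\<exists>j<N. S j \<le> T / N"
proof (rule ccontr)
  assume "\<not> ?thesis"
  then have "(\<Sum>j<N. T / N) < (\<Sum>j<N. S j)"
    using assms(1) by (intro sum_strict_mono) auto
  then show False using assms by simp
qed

text \<open>The measure of the image controls the sum of the squared radii of the Bloch discs of a fine
  grid, hence one of the columns of the grid has a short image.\<close>

lemma univalent_short_crosscut:
  fixes \<Phi> :: "complex \<Rightarrow> complex"
  assumes S: "open S" "\<Phi> holomorphic_on S" "inj_on \<Phi> S"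
    and sub: "cbox (Complex x0 (-h)) (Complex (x0 + 1) h) \<subseteq> S"
    and h: "1 \<le> h" "h \<le> 2"
  shows "\<exists>s\<in>{x0..x0+1}. \<forall>y\<in>{-h..h}. \<forall>y'\<in>{-h..h}. dist (\<Phi> (Complex s y)) (\<Phi> (Complex s y'))
      \<le> 192 * sqrt (measure lborel (\<Phi> ` box (Complex x0 (-h)) (Complex (x0 + 1) h)))"
proof -
  define Q where "Q = cbox (Complex x0 (-h)) (Complex (x0 + 1) h)"
  define B where "B = box (Complex x0 (-h)) (Complex (x0 + 1) h)"
  have Q: "z \<in> Q \<longleftrightarrow> x0 \<le> Re z \<and> Re z \<le> x0 + 1 \<and> - h \<le> Im z \<and> Im z \<le> h" for z
    by (auto simp: Q_def in_cbox_complex_iff)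
  have B: "z \<in> B \<longleftrightarrow> x0 < Re z \<and> Re z < x0 + 1 \<and> - h < Im z \<and> Im z < h" for z
    by (auto simp: B_def in_box_complex_iff)
  have compQ: "compact Q" and convQ: "convex Q" by (simp_all add: Q_def)
  have BQ: "B \<subseteq> Q" by (auto simp: Q B)
  have QO: "Q \<subseteq> S" using sub by (simp add: Q_def)
  have holQ: "\<Phi> holomorphic_on Q" using S(2) QO by (rule holomorphic_on_subset)
  have "open B" by (simp add: B_def open_box)
  moreover have "B \<subseteq> S" using BQ QO by blast
  ultimately have openW: "open (\<Phi> ` B)" by (rule open_univalent_image[OF S(2,3)])
  have "compact (\<Phi> ` Q)"
    by (rule compact_continuous_image[OF holomorphic_on_imp_continuous_on[OF holQ] compQ])
  then have "bounded (\<Phi> ` B)" using BQ by (meson bounded_subset compact_imp_bounded image_mono)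
  with openW have W: "\<Phi> ` B \<in> fmeasurable lborel" by (rule measure_open_fmeasurable)
  have holD: "deriv \<Phi> holomorphic_on S" using S by (intro holomorphic_deriv) auto
  have contD: "continuous_on Q (deriv \<Phi>)"
    using holD QO by (meson holomorphic_on_imp_continuous_on holomorphic_on_subset)
  have nz: "deriv \<Phi> z \<noteq> 0" if "z \<in> Q" for z
    using holomorphic_injective_imp_regular[OF S(2,1,3)] that QO by blast
  have Qne: "Q \<noteq> {}" using h Q[of "Complex x0 0"] by auto
  obtain zm where zm: "zm \<in> Q" "\<And>z. z \<in> Q \<Longrightarrow> norm (deriv \<Phi> zm) \<le> norm (deriv \<Phi> z)"
    using continuous_attains_inf[OF compQ Qne, of "\<lambda>z. norm (deriv \<Phi> z)"] contD
    by (auto intro: continuous_on_norm)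
  define m where "m = norm (deriv \<Phi> zm)"
  have m: "m > 0" using nz[OF zm(1)] by (simp add: m_def)
  obtain d where d: "d > 0" "\<And>z w. z \<in> Q \<Longrightarrow> w \<in> Q \<Longrightarrow> dist z w < d \<Longrightarrow> dist (deriv \<Phi> z) (deriv \<Phi> w) < m"
    using compact_uniformly_continuous[OF contD compQ] m unfolding uniformly_continuous_on_def by metis
  have dbl: "norm (deriv \<Phi> z) \<le> 2 * norm (deriv \<Phi> c)" if "z \<in> Q" "c \<in> Q" "dist c z < d" for z c
    using d(2)[OF that(2,1,3)] zm(2)[OF that(2)] norm_triangle_sub[of "deriv \<Phi> z" "deriv \<Phi> c"]
    by (simp add: dist_norm norm_minus_commute m_def)
  obtain N :: nat where N: "N > 0" "1 / N < d" using d(1)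
    by (metis reals_Archimedean inverse_eq_divide zero_less_Suc)
  \<comment> \<open>Centres of a grid with N columns of width 1/N and 4N rows of height h/(2N). As h
    >= 1, both sizes are at least 2r for r = 1/(4N), so the open discs of radius \<open>r\<close>
    around the centres are disjoint and lie in the rectangle.\<close>
  define c where "c = (\<lambda>j k. Complex (x0 + (2 * real j + 1) / (2 * N)) (- h + h * (2 * real k + 1) / (4 * N)))"
  define r where "r = 1 / (4 * real N)"
  have r: "r > 0" using N by (simp add: r_def)
  have cx: "x0 + r < Re (c j k)" "Re (c j k) < x0 + 1 - r" if "j < N" for j k
  proof -
    have eq: "(2 * real j + 1) / (2 * N) = (4 * real j + 2) * r" "1 = 4 * real N * r"
      using N by (simp_all add: r_def field_simps)
    have "1 * r < (4 * real j + 2) * r" using r by (intro mult_strict_right_mono) auto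
    then show "x0 + r < Re (c j k)" unfolding c_def complex.sel eq(1) by simp
    have "(4 * real j + 3) * r < 4 * real N * r" using r that by (intro mult_strict_right_mono) auto
    then show "Re (c j k) < x0 + 1 - r" unfolding c_def complex.sel eq(1) by (subst eq(2)) (simp add: algebra_simps)
  qed
  have cy: "- h + r \<le> Im (c j k)" "Im (c j k) \<le> h - r" if "k < 4 * N" for j k
  proof -
    have "1 / (4 * N) \<le> h * (2 * real k + 1) / (4 * N)"
      using h mult_mono[of 1 h 1 "2 * real k + 1"] by (intro divide_right_mono) auto
    then show "- h + r \<le> Im (c j k)" by (simp add: c_def r_def)
    have "h * (2 * real k + 1) \<le> h * (8 * real N - 1)" using h that by (intro mult_left_mono) linarith+
    also have "\<dots> \<le> h * (8 * real N) - 1" using h by (simp add: algebra_simps)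
    finally have "h * (2 * real k + 1) / (4 * N) \<le> (h * (8 * real N) - 1) / (4 * N)"
      by (rule divide_right_mono) simp
    also have "\<dots> = 2 * h - r" using N by (simp add: r_def field_simps)
    finally show "Im (c j k) \<le> h - r" by (simp add: c_def)
  qed
  have ballB: "ball (c j k) r \<subseteq> B" if "j < N" "k < 4 * N" for j k
  proof
    fix z assume "z \<in> ball (c j k) r"
    then have "norm (z - c j k) < r" by (simp add: dist_norm norm_minus_commute)
    then have "\<bar>Re z - Re (c j k)\<bar> < r" "\<bar>Im z - Im (c j k)\<bar> < r"
      using abs_Re_le_cmod[of "z - c j k"] abs_Im_le_cmod[of "z - c j k"] by auto
    then show "z \<in> B" using cx[OF that(1), of k] cy[OF that(2), of j] by (auto simp: B)
  qed
  have ballS: "ball (c j k) r \<subseteq> S" if "j < N" "k < 4 * N" for j k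
    using ballB[OF that] BQ QO by blast
  have cballQ: "cball (c j k) r \<subseteq> Q" if "j < N" "k < 4 * N" for j k
  proof
    fix z assume "z \<in> cball (c j k) r"
    then have "norm (z - c j k) \<le> r" by (simp add: dist_norm norm_minus_commute)
    then have "\<bar>Re z - Re (c j k)\<bar> \<le> r" "\<bar>Im z - Im (c j k)\<bar> \<le> r"
      using abs_Re_le_cmod[of "z - c j k"] abs_Im_le_cmod[of "z - c j k"] by auto
    then show "z \<in> Q" using cx[OF that(1), of k] cy[OF that(2), of j] by (auto simp: Q)
  qed
  have cQ: "c j k \<in> Q" if "j < N" "k < 4 * N" for j k
    using cballQ[OF that] r by force
  have disj: "dist (c j k) (c j' k') \<ge> r + r" if "(j, k) \<noteq> (j', k')" for j k j' k'
  proof (cases "j = j'")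
    case False
    then have "1 \<le> \<bar>real j - real j'\<bar>" by linarith
    then have "2 / (2 * N) \<le> \<bar>2 * real j - 2 * real j'\<bar> / (2 * N)" by (intro divide_right_mono) linarith+
    also have "\<dots> = \<bar>Re (c j k - c j' k')\<bar>"
      by (simp add: c_def abs_divide flip: diff_divide_distrib)
    also have "\<dots> \<le> dist (c j k) (c j' k')" unfolding dist_norm by (rule abs_Re_le_cmod)
    finally show ?thesis using N by (simp add: r_def field_simps)
  next
    case True
    then have "k \<noteq> k'" using that by simp
    then have "1 \<le> \<bar>real k - real k'\<bar>" by linarith
    then have "2 \<le> h * \<bar>2 * real k - 2 * real k'\<bar>" using h mult_mono[of 1 h 2 "\<bar>2 * real k - 2 * real k'\<bar>"] by linarith
    then have "2 / (4 * N) \<le> h * \<bar>2 * real k - 2 * real k'\<bar> / (4 * N)" by (rule divide_right_mono) simp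
    also have "h * \<bar>2 * real k - 2 * real k'\<bar> = \<bar>h * (2 * real k + 1) - h * (2 * real k' + 1)\<bar>"
      using h abs_mult[of h "2 * real k - 2 * real k'"] by (simp add: algebra_simps)
    also have "\<dots> / (4 * N) = \<bar>Im (c j k - c j' k')\<bar>"
      by (simp add: c_def abs_divide flip: diff_divide_distrib)
    also have "\<dots> \<le> dist (c j k) (c j' k')" unfolding dist_norm by (rule abs_Im_le_cmod)
    finally show ?thesis using N by (simp add: r_def field_simps)
  qed
  define D where "D = (\<lambda>j k. norm (deriv \<Phi> (c j k)))"
  define a where "a = measure lborel (\<Phi> ` B)"
  \<comment> \<open>Bloch's lemma gives a disc of radius at least \<open>r * D j k / 6\<close>
    inside the image of a grid disc, since 1/6 <= 3 - 2 sqrt 2. As pi >= 1, its area is at least the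
    square of D / (24 N), and 576 is the square of 24.\<close>
  have cell: "(D j k)\<^sup>2 \<le> 576 * (real N)\<^sup>2 * measure lborel (\<Phi> ` ball (c j k) r)"
    and cell_sets: "\<Phi> ` ball (c j k) r \<in> fmeasurable lborel" if jk: "j < N" "k < 4 * N" for j k
  proof -
    show fm: "\<Phi> ` ball (c j k) r \<in> fmeasurable lborel"
    proof (rule fmeasurableI2[OF W])
      show "\<Phi> ` ball (c j k) r \<subseteq> \<Phi> ` B" using ballB[OF jk] by auto
      have "open (\<Phi> ` ball (c j k) r)"
        by (rule open_univalent_image[OF S(2,3) open_ball]) (use ballB[OF jk] BQ QO in blast)
      then show "\<Phi> ` ball (c j k) r \<in> sets lborel" by simp
    qed
    have "ball (\<Phi> (c j k)) ((3 - 2 * sqrt 2) * r * norm (deriv \<Phi> (c j k))) \<subseteq> \<Phi> ` ball (c j k) r"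
    proof (rule Bloch_lemma[OF _ r])
      show "\<Phi> holomorphic_on cball (c j k) r"
        using cballQ[OF jk] holQ holomorphic_on_subset by blast
      fix z assume "z \<in> ball (c j k) r"
      moreover have "r < d" using N r by (simp add: r_def field_simps)
      ultimately show "norm (deriv \<Phi> z) \<le> 2 * norm (deriv \<Phi> (c j k))"
        using ballB[OF jk] BQ by (intro dbl cQ jk) auto
    qed
    moreover have "1 / 6 \<le> 3 - 2 * sqrt 2"
    proof -
      have "sqrt 2 \<le> 17 / 12" by (rule real_le_lsqrt) (auto simp: power2_eq_square)
      then show ?thesis by simp
    qed
    then have "1 / 6 * r * D j k \<le> (3 - 2 * sqrt 2) * r * norm (deriv \<Phi> (c j k))"
      using r unfolding D_def by (intro mult_right_mono) auto
    ultimately have "ball (\<Phi> (c j k)) (1 / 6 * r * D j k) \<subseteq> \<Phi> ` ball (c j k) r"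
      using subset_ball by blast
    then have "measure lborel (ball (\<Phi> (c j k)) (1 / 6 * r * D j k)) \<le> measure lborel (\<Phi> ` ball (c j k) r)"
      by (intro measure_mono_fmeasurable fm) auto
    then have "pi * (1 / 6 * r * D j k)\<^sup>2 \<le> measure lborel (\<Phi> ` ball (c j k) r)"
      using r by (subst (asm) content_ball_complex) (auto simp: D_def)
    moreover have "1 * (1 / 6 * r * D j k)\<^sup>2 \<le> pi * (1 / 6 * r * D j k)\<^sup>2"
      using pi_gt3 by (intro mult_right_mono) auto
    ultimately have "(1 / 6 * r * D j k)\<^sup>2 \<le> measure lborel (\<Phi> ` ball (c j k) r)" by simp
    then show "(D j k)\<^sup>2 \<le> 576 * (real N)\<^sup>2 * measure lborel (\<Phi> ` ball (c j k) r)"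
      using N by (simp add: r_def field_simps power2_eq_square)
  qed
  have "(\<Sum>j<N. \<Sum>k<4*N. (D j k)\<^sup>2) \<le> (\<Sum>j<N. \<Sum>k<4*N. 576 * (real N)\<^sup>2 * measure lborel (\<Phi> ` ball (c j k) r))"
    by (intro sum_mono cell) auto
  also have "\<dots> = 576 * (real N)\<^sup>2 * (\<Sum>(j,k)\<in>{..<N}\<times>{..<4*N}. measure lborel (\<Phi> ` ball (c j k) r))"
    by (simp add: sum_distrib_left sum.cartesian_product case_prod_beta)
  finally have tot1: "(\<Sum>j<N. \<Sum>k<4*N. (D j k)\<^sup>2) \<le>
    576 * (real N)\<^sup>2 * (\<Sum>(j,k)\<in>{..<N}\<times>{..<4*N}. measure lborel (\<Phi> ` ball (c j k) r))" .
  have "(\<Sum>(j,k)\<in>{..<N}\<times>{..<4*N}. measure lborel (\<Phi> ` ball (c j k) r)) =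
      (\<Sum>i\<in>{..<N}\<times>{..<4*N}. measure lborel (\<Phi> ` ball (c (fst i) (snd i)) r))"
    by (simp add: case_prod_beta)
  also have "\<dots> = measure lborel (\<Union>i\<in>{..<N}\<times>{..<4*N}. \<Phi> ` ball (c (fst i) (snd i)) r)"
  proof (rule measure_finite_Union[symmetric])
    show "(\<lambda>i. \<Phi> ` ball (c (fst i) (snd i)) r) ` ({..<N} \<times> {..<4*N}) \<subseteq> sets lborel"
      using fmeasurableD[OF cell_sets] by auto
    show "emeasure lborel (\<Phi> ` ball (c (fst i) (snd i)) r) \<noteq> \<infinity>" if "i \<in> {..<N} \<times> {..<4*N}" for i
      using fmeasurableD2[OF cell_sets[of "fst i" "snd i"]] that by auto
    show "disjoint_family_on (\<lambda>i. \<Phi> ` ball (c (fst i) (snd i)) r) ({..<N} \<times> {..<4*N})"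
      unfolding disjoint_family_on_def
    proof (intro ballI impI)
      fix i i' assume i: "i \<in> {..<N} \<times> {..<4*N}" "i' \<in> {..<N} \<times> {..<4*N}" "i \<noteq> i'"
      have "ball (c (fst i) (snd i)) r \<inter> ball (c (fst i') (snd i')) r = {}"
        using i(3) by (intro disjoint_ballI disj) (auto simp: prod_eq_iff)
      moreover have "ball (c (fst i) (snd i)) r \<subseteq> S" "ball (c (fst i') (snd i')) r \<subseteq> S"
        using ballS[of "fst i" "snd i"] ballS[of "fst i'" "snd i'"] i(1,2) by (auto simp: mem_Times_iff)
      ultimately show "\<Phi> ` ball (c (fst i) (snd i)) r \<inter> \<Phi> ` ball (c (fst i') (snd i')) r = {}"
        by (metis S(3) image_empty inj_on_image_Int)
    qed
  qed auto
  also have "\<dots> \<le> a"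
    unfolding a_def
  proof (rule measure_mono_fmeasurable[OF _ _ W])
    show "(\<Union>i\<in>{..<N}\<times>{..<4*N}. \<Phi> ` ball (c (fst i) (snd i)) r) \<subseteq> \<Phi> ` B"
      using ballB by fastforce
    show "(\<Union>i\<in>{..<N}\<times>{..<4*N}. \<Phi> ` ball (c (fst i) (snd i)) r) \<in> sets lborel"
      using fmeasurableD[OF cell_sets] by (intro sets.finite_UN) auto
  qed
  finally have "576 * (real N)\<^sup>2 * (\<Sum>(j,k)\<in>{..<N}\<times>{..<4*N}. measure lborel (\<Phi> ` ball (c j k) r))
      \<le> 576 * (real N)\<^sup>2 * a" by (intro mult_left_mono) auto
  with tot1 have tot: "(\<Sum>j<N. \<Sum>k<4*N. (D j k)\<^sup>2) \<le> 576 * (real N)\<^sup>2 * a" by (rule order_trans)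
  \<comment> \<open>The best column costs at most the average, 576 N a. Cauchy-Schwarz over its 4N
    rows then gives 2304 N^2 a, the square of \<open>48 * N * sqrt a\<close>.\<close>
  obtain j where j: "j < N" "(\<Sum>k<4*N. (D j k)\<^sup>2) \<le> 576 * (real N)\<^sup>2 * a / N"
    using exists_le_average[OF N(1) tot] by blast
  have a0: "0 \<le> a" by (simp add: a_def)
  have "(\<Sum>k<4*N. D j k)\<^sup>2 \<le> (\<Sum>k<4*N. (D j k)\<^sup>2) * card {..<4*N}"
    by (rule sum_squared_le_sum_of_squares)
  also have "\<dots> \<le> 576 * (real N)\<^sup>2 * a / N * (4 * N)"
    unfolding card_lessThan by (rule mult_right_mono[OF j(2)]) simp
  also have "\<dots> = 2304 * (real N)\<^sup>2 * a" using N by simp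
  also have "\<dots> = (48 * N * sqrt a)\<^sup>2" using a0 by (simp only: power_mult_distrib real_sqrt_pow2) simp
  finally have sumD: "(\<Sum>k<4*N. D j k) \<le> 48 * N * sqrt a"
    by (rule power2_le_imp_le) (simp add: a0)
  define s where "s = x0 + (2 * real j + 1) / (2 * N)"
  have s: "s \<in> {x0..x0+1}" using cx[OF j(1), of 0] r by (auto simp: s_def c_def)
  define \<tau> where "\<tau> = h / (2 * N)"
  have \<tau>: "0 \<le> \<tau>" "\<tau> \<le> 1 / N" using h N by (auto simp: \<tau>_def field_simps)
  \<comment> \<open>On each piece of the vertical segment the derivative is at most twice its value
    at the centre of the cell, and the piece has length h/(2N) <= 1/N because h <= 2.\<close>
  have step: "dist (\<Phi> (Complex s y)) (\<Phi> (Complex s (- h + k * \<tau>))) \<le> 2 * D j k * (1 / N)"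
    if k: "k < 4 * N" and y: "- h + k * \<tau> \<le> y" "y \<le> - h + Suc k * \<tau>" for k y
  proof -
    define K where "K = cbox (Complex s (- h + k * \<tau>)) (Complex s (- h + Suc k * \<tau>))"
    have K: "z \<in> K \<longleftrightarrow> Re z = s \<and> - h + k * \<tau> \<le> Im z \<and> Im z \<le> - h + Suc k * \<tau>" for z
      by (auto simp: K_def in_cbox_complex_iff)
    have k4: "real (Suc k) * \<tau> \<le> 2 * h"
    proof -
      have "real (Suc k) * \<tau> \<le> real (4 * N) * \<tau>" using k \<tau> by (intro mult_right_mono) auto
      then show ?thesis using N by (simp add: \<tau>_def)
    qed
    have KQ: "z \<in> Q" if "z \<in> K" for z
    proof -
      have "0 \<le> real k * \<tau>" using \<tau> by simp
      then have "- h \<le> Im z" "Im z \<le> h" using that[unfolded K] k4 by linarith+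
      then show ?thesis using that[unfolded K] s by (simp add: Q)
    qed
    have Ic: "Im (c j k) = - h + k * \<tau> + \<tau> / 2"
      using N by (simp add: c_def \<tau>_def field_simps)
    have near: "dist (c j k) z < d" if "z \<in> K" for z
    proof -
      have "c j k - z = Complex 0 (Im (c j k) - Im z)"
        using that[unfolded K] by (simp add: c_def s_def complex_eq_iff)
      then have "dist (c j k) z = \<bar>Im (c j k) - Im z\<bar>" by (simp add: dist_norm complex_norm)
      also have "\<dots> \<le> \<tau>" using that[unfolded K] Ic \<tau> by (simp add: algebra_simps abs_le_iff)
      finally show ?thesis using \<tau> N by linarith
    qed
    have "norm (\<Phi> (Complex s y) - \<Phi> (Complex s (- h + k * \<tau>))) \<le> 2 * D j k * norm (Complex s y - Complex s (- h + k * \<tau>))"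
    proof (rule field_differentiable_bound[of K \<Phi> "deriv \<Phi>"])
      show "convex K" by (simp add: K_def)
      fix z assume z: "z \<in> K"
      show "(\<Phi> has_field_derivative deriv \<Phi> z) (at z within K)"
        using holomorphic_derivI[OF S(2,1), of z] KQ[OF z] QO has_field_derivative_at_within by blast
      show "norm (deriv \<Phi> z) \<le> 2 * D j k"
        unfolding D_def by (rule dbl[OF KQ[OF z] cQ[OF j(1) k] near[OF z]])
    qed (use y \<tau> in \<open>auto simp: K algebra_simps\<close>)
    also have "norm (Complex s y - Complex s (- h + k * \<tau>)) = y - (- h + k * \<tau>)"
    proof -
      have "Complex s y - Complex s (- h + k * \<tau>) = Complex 0 (y - (- h + k * \<tau>))"
        by (simp add: complex_eq_iff)
      then show ?thesis using y by (simp add: complex_norm)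
    qed
    also have "2 * D j k * (y - (- h + k * \<tau>)) \<le> 2 * D j k * (1 / N)"
      using y \<tau> by (intro mult_left_mono) (auto simp: D_def algebra_simps)
    finally show ?thesis by (simp add: dist_norm)
  qed
  have half: "dist (\<Phi> (Complex s y)) (\<Phi> (Complex s (- h))) \<le> 96 * sqrt a" if "y \<in> {-h..h}" for y
  proof -
    have "dist (\<Phi> (Complex s y)) (\<Phi> (Complex s (- h))) \<le> (\<Sum>k<4*N. 2 * D j k * (1 / N))"
      using that N by (intro chain_dist_le[OF \<tau>(1), of "4 * N" "- h" "\<lambda>y. \<Phi> (Complex s y)"] step)
        (auto simp: \<tau>_def)
    also have "\<dots> = 2 / N * (\<Sum>k<4*N. D j k)" by (simp add: sum_distrib_left)
    also have "\<dots> \<le> 2 / N * (48 * N * sqrt a)" by (intro mult_left_mono sumD) auto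
    also have "\<dots> = 96 * sqrt a" using N by simp
    finally show ?thesis .
  qed
  have "dist (\<Phi> (Complex s y)) (\<Phi> (Complex s y')) \<le> 192 * sqrt a" if "y \<in> {-h..h}" "y' \<in> {-h..h}" for y y'
    using dist_triangle2[of "\<Phi> (Complex s y)" "\<Phi> (Complex s y')" "\<Phi> (Complex s (- h))"]
      half[OF that(1)] half[OF that(2)] by simp
  then show ?thesis using s unfolding a_def B_def by blast
qed

lemma measure_le_cball:
  assumes "S \<in> fmeasurable lborel" "S \<subseteq> cball (c::complex) r" "0 \<le> r"
  shows "measure lborel S \<le> 4 * r\<^sup>2"
proof -
  have "cball c r \<in> fmeasurable lborel"
    using emeasure_bounded_finite[of "cball c r"] by (intro fmeasurableI) auto
  then have "measure lborel S \<le> measure lborel (cball c r)"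
    by (rule measure_mono_fmeasurable[OF assms(2) fmeasurableD[OF assms(1)]])
  also have "\<dots> = pi * r\<^sup>2" using assms by (intro content_cball_complex)
  also have "\<dots> \<le> 4 * r\<^sup>2" using pi_less_4 by (intro mult_right_mono) auto
  finally show ?thesis .
qed

section \<open>Short crosscuts of a half strip and decay of the area\<close>

definition half_strip :: "real \<Rightarrow> complex set" where
  "half_strip b = {z. Re z < b \<and> \<bar>Im z\<bar> < pi / 2}"

lemma open_half_strip: "open (half_strip b)"
  unfolding half_strip_def
  by (intro open_Collect_conj open_Collect_less continuous_intros)

lemma half_strip_mono: "a \<le> b \<Longrightarrow> half_strip a \<subseteq> half_strip b"
  by (auto simp: half_strip_def)

text \<open>The estimate for closed rectangles passes to the open strip without boundary values of
  \<open>\<Phi>\<close>: the half heights \<open>h n\<close> increase to pi/2, the abscissas of the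
  short segments accumulate at some \<open>l\<close> by compactness, and the bound survives at
  \<open>l\<close> by continuity of \<open>\<Phi>\<close> inside the strip.\<close>

lemma univalent_short_crosscut_strip:
  assumes hol: "\<Phi> holomorphic_on half_strip b" and inj: "inj_on \<Phi> (half_strip b)"
    and x0: "x0 + 1 < b"
  defines "W \<equiv> \<Phi> ` (half_strip (x0 + 1) - {z. Re z \<le> x0})"
  assumes bdd: "bounded W"
  shows "\<exists>s\<in>{x0..x0+1}. \<forall>y y'. \<bar>y\<bar> < pi / 2 \<longrightarrow> \<bar>y'\<bar> < pi / 2 \<longrightarrow>
    dist (\<Phi> (Complex s y)) (\<Phi> (Complex s y')) \<le> 192 * sqrt (measure lborel W)"
proof -
  \<comment> \<open>Since 3 < pi < 4, these half heights lie between 1 and 2.\<close>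
  define h where "h = (\<lambda>n. pi / 2 - 1 / (real n + 2))"
  have "open (half_strip (x0 + 1) - {z. Re z \<le> x0})"
    by (intro open_Diff open_half_strip closed_Collect_le continuous_intros)
  then have "open W" unfolding W_def
    by (rule open_univalent_image[OF hol inj]) (use x0 in \<open>auto simp: half_strip_def\<close>)
  then have W: "W \<in> fmeasurable lborel" using bdd by (rule measure_open_fmeasurable)
  have h1: "1 \<le> h n" "h n \<le> 2" "h n < pi / 2" for n
  proof -
    have "1 / (real n + 2) \<le> 1 / 2" by (rule frac_le) auto
    moreover have "1 / (real n + 2) > 0" by simp
    ultimately show "1 \<le> h n" "h n \<le> 2" "h n < pi / 2"
      using pi_gt3 pi_less_4 unfolding h_def by linarith+
  qed
  have sub: "cbox (Complex x0 (- h n)) (Complex (x0 + 1) (h n)) \<subseteq> half_strip b" for n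
    using h1(3)[of n] x0 by (auto simp: in_cbox_complex_iff half_strip_def)
  have box: "measure lborel (\<Phi> ` box (Complex x0 (- h n)) (Complex (x0 + 1) (h n))) \<le> measure lborel W" for n
  proof (rule measure_mono_fmeasurable[OF _ _ W])
    show "\<Phi> ` box (Complex x0 (- h n)) (Complex (x0 + 1) (h n)) \<subseteq> W"
      unfolding W_def using h1(3)[of n]
      by (intro image_mono) (auto simp: in_box_complex_iff half_strip_def)
    have "open (\<Phi> ` box (Complex x0 (- h n)) (Complex (x0 + 1) (h n)))"
      by (rule open_univalent_image[OF hol inj open_box]) (use sub[of n] box_subset_cbox in blast)
    then show "\<Phi> ` box (Complex x0 (- h n)) (Complex (x0 + 1) (h n)) \<in> sets lborel" by simp
  qed
  have "\<exists>s\<in>{x0..x0+1}. \<forall>y\<in>{-h n..h n}. \<forall>y'\<in>{-h n..h n}.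
      dist (\<Phi> (Complex s y)) (\<Phi> (Complex s y')) \<le> 192 * sqrt (measure lborel W)" for n
    using univalent_short_crosscut[OF open_half_strip hol inj sub h1(1,2), of n] box[of n]
    by (meson order_trans mult_left_mono real_sqrt_le_mono zero_le_numeral)
  then obtain s where s: "\<And>n. s n \<in> {x0..x0+1}"
    and d: "\<And>n y y'. y \<in> {-h n..h n} \<Longrightarrow> y' \<in> {-h n..h n} \<Longrightarrow>
      dist (\<Phi> (Complex (s n) y)) (\<Phi> (Complex (s n) y')) \<le> 192 * sqrt (measure lborel W)"
    by metis
  obtain l r where l: "l \<in> {x0..x0+1}" and r: "strict_mono r" and lim: "(s \<circ> r) \<longlonglongrightarrow> l"
    using compact_Icc[of x0 "x0 + 1"] s unfolding compact_def by metis
  have hr: "(\<lambda>n. h (r n)) \<longlonglongrightarrow> pi / 2"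
  proof -
    have "h \<longlonglongrightarrow> pi / 2 - 0" unfolding h_def
      by (intro tendsto_diff tendsto_const) real_asymp
    then show ?thesis using LIMSEQ_subseq_LIMSEQ[OF _ r, of h] by (simp add: o_def)
  qed
  have cont: "(\<lambda>n. \<Phi> (Complex (s (r n)) y)) \<longlonglongrightarrow> \<Phi> (Complex l y)" if "\<bar>y\<bar> < pi / 2" for y
  proof -
    have "Complex l y \<in> half_strip b" using l x0 that by (auto simp: half_strip_def)
    then have "isCont \<Phi> (Complex l y)"
      using holomorphic_on_imp_continuous_on[OF hol] open_half_strip continuous_on_eq_continuous_at by blast
    moreover have "(\<lambda>n. Complex (s (r n)) y) \<longlonglongrightarrow> Complex l y"
      using lim by (auto intro: tendsto_Complex simp: o_def)
    ultimately show ?thesis by (rule isCont_tendsto_compose)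
  qed
  have "dist (\<Phi> (Complex l y)) (\<Phi> (Complex l y')) \<le> 192 * sqrt (measure lborel W)"
    if y: "\<bar>y\<bar> < pi / 2" "\<bar>y'\<bar> < pi / 2" for y y'
  proof (rule tendsto_upperbound[OF tendsto_dist[OF cont[OF y(1)] cont[OF y(2)]]])
    have "\<forall>\<^sub>F n in sequentially. \<bar>y\<bar> < h (r n)" "\<forall>\<^sub>F n in sequentially. \<bar>y'\<bar> < h (r n)"
      using order_tendstoD(1)[OF hr] y by blast+
    then show "\<forall>\<^sub>F n in sequentially. dist (\<Phi> (Complex (s (r n)) y)) (\<Phi> (Complex (s (r n)) y'))
        \<le> 192 * sqrt (measure lborel W)"
      by eventually_elim (auto intro!: d)
  qed simp
  then show ?thesis using l by blast
qed

text \<open>Length-area argument: the crosscut property bounds the area beyond a short crosscut by the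
  area of the adjacent cell, so the area of the image of a half strip decays geometrically.\<close>

lemma univalent_strip_decay:
  assumes hol: "\<Phi> holomorphic_on half_strip 0" and inj: "inj_on \<Phi> (half_strip 0)"
    and B: "0 < B" "\<And>z. z \<in> half_strip (-1) \<Longrightarrow> norm (\<Phi> z) \<le> B"
    and M: "0 < M"
    and crosscut: "\<And>s p r. s < 0 \<Longrightarrow> 0 < r \<Longrightarrow> (\<And>y. \<bar>y\<bar> < pi / 2 \<Longrightarrow> \<Phi> (Complex s y) \<in> cball p r) \<Longrightarrow>
       \<Phi> ` half_strip s \<subseteq> cball p (M * r)"
    and z: "z \<in> half_strip (- real n - 2)" and w: "w \<in> half_strip (- real n - 2)"
  defines "\<kappa> \<equiv> 4 * (192 * M)\<^sup>2"
  shows "dist (\<Phi> z) (\<Phi> w) \<le> 768 * M * B * sqrt ((\<kappa> / (1 + \<kappa>)) ^ n)"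
proof -
  \<comment> \<open>The count starts at abscissa -1, to the left of which \<open>\<Phi>\<close> is
    bounded by \<open>B\<close>. The cell \<open>C n\<close> below lies between the abscissas -n-2
    and -n-1, so a crosscut inside it still has all of \<open>half_strip (- real n - 2)\<close>
    beyond it.\<close>
  define A where "A = (\<lambda>n. measure lborel (\<Phi> ` half_strip (- real n - 1)))"
  have bdd: "bounded (\<Phi> ` half_strip (- real n - 1))" for n
    using B(2) half_strip_mono[of "- real n - 1" "-1"] unfolding bounded_iff by force
  have meas: "\<Phi> ` T \<in> fmeasurable lborel" if "open T" "T \<subseteq> half_strip (-1)" for T
  proof (rule measure_open_fmeasurable)
    show "open (\<Phi> ` T)"
      by (rule open_univalent_image[OF hol inj that(1)])
         (use that(2) half_strip_mono[of "-1" 0] in auto)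
    show "bounded (\<Phi> ` T)" using bdd[of 0] that(2) by (auto intro: bounded_subset image_mono)
  qed
  have meas_strip: "\<Phi> ` half_strip (- real n - 1) \<in> fmeasurable lborel" for n
    by (rule meas[OF open_half_strip half_strip_mono]) simp
  define C where "C = (\<lambda>n. half_strip (- real n - 1) - {z. Re z \<le> - real n - 2})"
  have openC: "open (C n)" for n
    unfolding C_def by (intro open_Diff open_half_strip closed_Collect_le continuous_intros)
  have measC: "\<Phi> ` C n \<in> fmeasurable lborel" for n
    by (rule meas[OF openC]) (auto simp: C_def half_strip_def)
  have add: "A (Suc n) + measure lborel (\<Phi> ` C n) \<le> A n" for n
  proof -
    have disj: "\<Phi> ` half_strip (- real (Suc n) - 1) \<inter> \<Phi> ` C n = {}"
    proof -
      have "half_strip (- real (Suc n) - 1) \<inter> C n = {}" by (auto simp: C_def half_strip_def)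
      moreover have "half_strip (- real (Suc n) - 1) \<subseteq> half_strip 0" "C n \<subseteq> half_strip 0"
        by (auto simp: C_def half_strip_def)
      ultimately show ?thesis by (metis image_empty inj_on_image_Int inj)
    qed
    have "measure lborel (\<Phi> ` half_strip (- real (Suc n) - 1) \<union> \<Phi> ` C n) =
        A (Suc n) + measure lborel (\<Phi> ` C n)"
      unfolding A_def
      using measure_Union[OF _ _ _ _ disj, of lborel] fmeasurableD2[OF measC[of n]]
        fmeasurableD[OF measC[of n]] fmeasurableD2[OF meas_strip[of "Suc n"]]
        fmeasurableD[OF meas_strip[of "Suc n"]] by simp
    moreover have "measure lborel (\<Phi> ` half_strip (- real (Suc n) - 1) \<union> \<Phi> ` C n) \<le> A n"
      unfolding A_def
    proof (rule measure_mono_fmeasurable[OF _ _ meas_strip])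
      show "\<Phi> ` half_strip (- real (Suc n) - 1) \<union> \<Phi> ` C n \<subseteq> \<Phi> ` half_strip (- real n - 1)"
        by (auto simp: C_def half_strip_def)
      show "\<Phi> ` half_strip (- real (Suc n) - 1) \<union> \<Phi> ` C n \<in> sets lborel"
        using meas_strip[of "Suc n"] measC[of n] by (intro sets.Un) (auto dest: fmeasurableD)
    qed
    ultimately show ?thesis by simp
  qed
  have disc: "\<exists>p. \<Phi> ` half_strip (- real n - 2) \<subseteq> cball p (M * (192 * sqrt (measure lborel (\<Phi> ` C n))))" for n
  proof -
    define a where "a = measure lborel (\<Phi> ` C n)"
    have eq: "half_strip (- real n - 2 + 1) - {z. Re z \<le> - real n - 2} = C n"
      by (auto simp: C_def half_strip_def)
    have "bounded (\<Phi> ` C n)" using bdd[of n] by (rule bounded_subset) (auto simp: C_def)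
    then obtain s where s: "s \<in> {- real n - 2..- real n - 2 + 1}"
      and d: "\<And>y y'. \<bar>y\<bar> < pi / 2 \<Longrightarrow> \<bar>y'\<bar> < pi / 2 \<Longrightarrow>
        dist (\<Phi> (Complex s y)) (\<Phi> (Complex s y')) \<le> 192 * sqrt a"
      using univalent_short_crosscut_strip[OF hol inj, of "- real n - 2"] unfolding eq a_def by auto
    have p1: "\<bar>1::real\<bar> < pi / 2" using pi_gt3 by simp
    have "s < 0" using s by simp
    \<comment> \<open>Injectivity makes the image of the crosscut nondegenerate, so that the radius
      passed to \<open>crosscut\<close> is positive.\<close>
    then have "\<Phi> (Complex s 0) \<noteq> \<Phi> (Complex s 1)"
      using inj_onD[OF inj, of "Complex s 0" "Complex s 1"] p1 by (auto simp: half_strip_def)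
    then have "0 < dist (\<Phi> (Complex s 0)) (\<Phi> (Complex s 1))" by simp
    also have "\<dots> \<le> 192 * sqrt a" using p1 by (intro d) auto
    finally have r: "0 < 192 * sqrt a" .
    have "\<Phi> ` half_strip s \<subseteq> cball (\<Phi> (Complex s 0)) (M * (192 * sqrt a))"
      by (rule crosscut[OF \<open>s < 0\<close> r]) (auto intro: d)
    then show ?thesis using half_strip_mono[of "- real n - 2" s] s unfolding a_def by auto
  qed
  have \<kappa>: "\<kappa> > 0" using M by (simp add: \<kappa>_def)
  \<comment> \<open>With \<open>a\<close> the area of the image of the cell, everything beyond it
    lies in a disc of radius \<open>192 * M * sqrt a\<close>, of area at most
    \<open>\<kappa> * a\<close> because pi < 4. The cell is lost on passing from \<open>A n\<close>
    to \<open>A (Suc n)\<close>, so \<open>a\<close> is at most their difference; solving for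
    \<open>A (Suc n)\<close> gives the ratio.\<close>
  have step: "A (Suc n) \<le> \<kappa> / (1 + \<kappa>) * A n" for n
  proof -
    define a where "a = measure lborel (\<Phi> ` C n)"
    obtain p where "\<Phi> ` half_strip (- real n - 2) \<subseteq> cball p (M * (192 * sqrt a))"
      using disc[of n] unfolding a_def by blast
    then have "\<Phi> ` half_strip (- real (Suc n) - 1) \<subseteq> cball p (M * (192 * sqrt a))"
      using half_strip_mono[of "- real (Suc n) - 1" "- real n - 2"] by auto
    then have "A (Suc n) \<le> 4 * (M * (192 * sqrt a))\<^sup>2"
      unfolding A_def by (rule measure_le_cball[OF meas_strip]) (use M in \<open>simp add: a_def\<close>)
    also have "\<dots> = \<kappa> * a" by (simp add: \<kappa>_def power_mult_distrib a_def)
    also have "\<dots> \<le> \<kappa> * (A n - A (Suc n))"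
      using \<kappa> add[of n] unfolding a_def by (intro mult_left_mono) auto
    finally show ?thesis using \<kappa> by (simp add: field_simps)
  qed
  have "A n \<le> (\<kappa> / (1 + \<kappa>)) ^ n * (4 * B\<^sup>2)" for n
  proof (induction n)
    case 0
    have "A 0 \<le> 4 * B\<^sup>2"
      unfolding A_def by (rule measure_le_cball[OF meas_strip, of 0 0]) (use B in auto)
    then show ?case by simp
  next
    case (Suc n)
    have "A (Suc n) \<le> \<kappa> / (1 + \<kappa>) * A n" by (rule step)
    also have "\<dots> \<le> \<kappa> / (1 + \<kappa>) * ((\<kappa> / (1 + \<kappa>)) ^ n * (4 * B\<^sup>2))"
      using \<kappa> by (intro mult_left_mono Suc.IH) auto
    finally show ?case by (simp add: mult.assoc)
  qed
  moreover have "measure lborel (\<Phi> ` C n) \<le> A n"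
    using add[of n] measure_nonneg[of lborel "\<Phi> ` half_strip (- real (Suc n) - 1)"] unfolding A_def by linarith
  ultimately have "measure lborel (\<Phi> ` C n) \<le> (\<kappa> / (1 + \<kappa>)) ^ n * (4 * B\<^sup>2)"
    by (metis order_trans)
  then have "sqrt (measure lborel (\<Phi> ` C n)) \<le> sqrt ((\<kappa> / (1 + \<kappa>)) ^ n * (4 * B\<^sup>2))"
    by (rule real_sqrt_le_mono)
  also have "\<dots> = sqrt ((\<kappa> / (1 + \<kappa>)) ^ n) * (2 * B)"
    using B by (simp add: real_sqrt_mult)
  finally have sq: "M * (192 * sqrt (measure lborel (\<Phi> ` C n))) \<le> M * (192 * (sqrt ((\<kappa> / (1 + \<kappa>)) ^ n) * (2 * B)))"
    using M by (intro mult_left_mono) auto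
  obtain p where p: "\<Phi> ` half_strip (- real n - 2) \<subseteq> cball p (M * (192 * sqrt (measure lborel (\<Phi> ` C n))))"
    using disc[of n] by blast
  have "\<Phi> z \<in> cball p (M * (192 * sqrt (measure lborel (\<Phi> ` C n))))"
    "\<Phi> w \<in> cball p (M * (192 * sqrt (measure lborel (\<Phi> ` C n))))"
    using p z w by blast+
  \<comment> \<open>768 = 2 * 192 * 2: the diameter is twice the radius, and the square root of the
    initial area bound 4 B^2 is 2 B.\<close>
  then have "dist (\<Phi> z) (\<Phi> w) \<le> 2 * (M * (192 * sqrt (measure lborel (\<Phi> ` C n))))"
    using dist_triangle3[of "\<Phi> z" "\<Phi> w" p] unfolding mem_cball by linarith
  also have "\<dots> \<le> 2 * (M * (192 * (sqrt ((\<kappa> / (1 + \<kappa>)) ^ n) * (2 * B))))" using sq by simp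
  finally show ?thesis by (simp add: mult_ac)
qed

section \<open>Quasiarcs through infinity\<close>

lemma homeomorphic_if_homeomorphic_space:
  "top_of_set S homeomorphic_space top_of_set T \<Longrightarrow> S homeomorphic T"
proof -
  assume "top_of_set S homeomorphic_space top_of_set T"
  then obtain f g where "homeomorphic_maps (top_of_set S) (top_of_set T) f g"
    unfolding homeomorphic_space_def by blast
  then have "homeomorphism S T f g"
    by (intro homeomorphismI) (auto simp: homeomorphic_maps_def continuous_map_in_subtopology)
  then show ?thesis unfolding homeomorphic_def by blast
qed

section \<open>Closures in the sphere and Jordan curves through infinity\<close>

lemma sphere_closure_bounded:
  assumes "closed A" "bounded A" shows "sphere_closure A = Some ` A"
proof -
  have "closedin riemann_sphere (Some ` A)"
    using assms by (simp add: compact_eq_bounded_closed)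
  then show ?thesis unfolding sphere_closure_def by (rule closure_of_closedin)
qed

lemma sphere_closure_unbounded:
  assumes "closed A" "\<not> bounded A" shows "sphere_closure A = insert None (Some ` A)"
proof
  have "closedin riemann_sphere (insert None (Some ` A))"
    unfolding closedin_Alexandroff_compactification using assms(1)
    by (intro disjI2 exI[of _ "- A"]) (auto simp: open_Compl)
  then show "sphere_closure A \<subseteq> insert None (Some ` A)"
    unfolding sphere_closure_def by (intro closure_of_minimal) auto
  have "None \<in> sphere_closure A"
    unfolding sphere_closure_def in_closure_of
  proof (intro conjI allI impI)
    fix T :: "complex option set"
    assume "None \<in> T \<and> openin riemann_sphere T"
    then obtain C where C: "compact C" "T = insert None (Some ` (UNIV - C))"
      by (auto simp: openin_Alexandroff_compactification)
    then have "\<not> A \<subseteq> C" using assms(2) bounded_subset compact_imp_bounded by blast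
    then show "\<exists>y. y \<in> Some ` A \<and> y \<in> T" using C(2) by auto
  qed auto
  moreover have "Some ` A \<subseteq> sphere_closure A"
    unfolding sphere_closure_def by (rule closure_of_subset) auto
  ultimately show "insert None (Some ` A) \<subseteq> sphere_closure A" by auto
qed

lemma homeomorphic_space_image_Some:
  "top_of_set A homeomorphic_space subtopology riemann_sphere (Some ` A)"
proof -
  have "homeomorphic_map euclidean (subtopology riemann_sphere (range Some)) Some"
    using embedding_map_Some[of "euclidean :: complex topology"] unfolding embedding_map_def by simp
  then have "homeomorphic_map (top_of_set A)
      (subtopology (subtopology riemann_sphere (range Some)) (Some ` A)) Some"
    by (rule homeomorphic_map_subtopologies) auto
  moreover have "range Some \<inter> Some ` A = Some ` A" by auto
  ultimately show ?thesis
    unfolding subtopology_subtopology homeomorphic_space by auto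
qed

lemma punctured_circle_homeomorphic_line:
  assumes "p \<in> sphere (0::complex) 1"
  shows "(sphere 0 1 - {p}) homeomorphic (UNIV :: real set)"
proof -
  have "(sphere 0 1 - {p}) homeomorphic {x::complex. 1 \<bullet> x = 0}"
    using assms by (intro homeomorphic_punctured_sphere_hyperplane) auto
  moreover have "homeomorphism {x::complex. 1 \<bullet> x = 0} (UNIV :: real set) Im (Complex 0)"
    by (rule homeomorphismI) (auto simp: inner_complex_def complex_eq_iff intro!: continuous_intros
        continuous_on_Complex image_eqI[of _ Im "Complex 0 _"])
  ultimately show ?thesis by (meson homeomorphic_def homeomorphic_trans)
qed

text \<open>Deleting infinity from the Jordan curve leaves a punctured circle, hence a line.\<close>

lemma jordan_curve_through_infinity_homeomorphic_line:
  assumes "closed J" "\<not> bounded J"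
    and "subtopology riemann_sphere (sphere_closure J) homeomorphic_space top_of_set (sphere (0::complex) 1)"
  shows "J homeomorphic (UNIV :: real set)"
proof -
  have "topspace (subtopology riemann_sphere (sphere_closure J)) = insert None (Some ` J)"
    by (auto simp: sphere_closure_unbounded[OF assms(1,2)])
  moreover obtain h where h: "homeomorphic_map (subtopology riemann_sphere (sphere_closure J))
      (top_of_set (sphere (0::complex) 1)) h"
    using assms(3) by (auto simp: homeomorphic_space)
  ultimately have im: "h ` insert None (Some ` J) = sphere 0 1" and inj: "inj_on h (insert None (Some ` J))"
    using homeomorphic_imp_surjective_map[OF h] homeomorphic_imp_injective_map[OF h] by auto
  have "h ` Some ` J = sphere 0 1 - {h None}"
    using im inj by (auto simp: inj_on_def)
  then have "homeomorphic_map (subtopology (subtopology riemann_sphere (sphere_closure J)) (Some ` J))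
      (subtopology (top_of_set (sphere (0::complex) 1)) (sphere 0 1 - {h None})) h"
    by (intro homeomorphic_map_subtopologies[OF h])
      (auto simp: sphere_closure_unbounded[OF assms(1,2)] inf.absorb2)
  moreover have "insert None (Some ` J) \<inter> Some ` J = Some ` J" by auto
  moreover have "sphere 0 1 \<inter> (sphere 0 1 - {h None}) = sphere 0 1 - {h None}" by auto
  ultimately have "subtopology riemann_sphere (Some ` J) homeomorphic_space
      top_of_set (sphere 0 1 - {h None})"
    unfolding subtopology_subtopology sphere_closure_unbounded[OF assms(1,2)] homeomorphic_space by auto
  then have "J homeomorphic (sphere 0 1 - {h None})"
    using homeomorphic_space_trans[OF homeomorphic_space_image_Some] homeomorphic_if_homeomorphic_space by blast
  moreover have "h None \<in> sphere 0 1" using im by auto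
  ultimately show ?thesis
    using homeomorphic_trans punctured_circle_homeomorphic_line by blast
qed

section \<open>The three-point condition on a line and the rays of a quasiarc\<close>

lemma not_bounded_real_rays:
  fixes s :: real
  shows "\<not> bounded {..s}" "\<not> bounded {..<s}" "\<not> bounded {s..}" "\<not> bounded {s<..}"
proof -
  have "\<exists>x<s. c < \<bar>x\<bar>" "\<exists>x>s. c < \<bar>x\<bar>" for c
    by (rule exI[of _ "- \<bar>s\<bar> - \<bar>c\<bar> - 1"], force) (rule exI[of _ "\<bar>s\<bar> + \<bar>c\<bar> + 1"], force)
  then show "\<not> bounded {..<s}" "\<not> bounded {s<..}"
    unfolding bounded_iff real_norm_def by (metis lessThan_iff not_le) (metis \<open>\<And>c. \<exists>x>s. c < \<bar>x\<bar>\<close> greaterThan_iff not_le)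
  then show "\<not> bounded {..s}" "\<not> bounded {s..}"
    using bounded_subset[of "{..s}" "{..<s}"] bounded_subset[of "{s..}" "{s<..}"]
    by (auto simp: subset_iff)
qed

text \<open>\<open>\<psi>\<close> is proper: a bounded part of the closed set \<open>J\<close> lies
  in a compact one, whose image under the continuous inverse is bounded. In particular both ends of
  the line run to infinity in the plane.\<close>

lemma closed_line_tails_unbounded:
  fixes \<psi> :: "real \<Rightarrow> complex"
  assumes "homeomorphism UNIV J \<psi> \<psi>'" "closed J" "bounded (\<psi> ` T)"
  shows "bounded T"
proof -
  obtain R where R: "\<psi> ` T \<subseteq> cball 0 R" using assms(3) by (auto simp: bounded_iff image_subset_iff)
  have J: "\<psi> ` UNIV = J" and inv: "\<And>t. \<psi>' (\<psi> t) = t" and cont: "continuous_on J \<psi>'"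
    using assms(1) by (auto simp: homeomorphism_def)
  have "compact (J \<inter> cball 0 R)" using assms(2) by (simp add: closed_Int_compact)
  then have "compact (\<psi>' ` (J \<inter> cball 0 R))"
    using cont by (intro compact_continuous_image) (auto intro: continuous_on_subset)
  moreover have "T \<subseteq> \<psi>' ` (J \<inter> cball 0 R)"
  proof
    fix t assume "t \<in> T"
    then have "\<psi> t \<in> J \<inter> cball 0 R" using R J by auto
    then show "t \<in> \<psi>' ` (J \<inter> cball 0 R)" using inv[of t] by (metis imageI)
  qed
  ultimately show ?thesis using bounded_subset compact_imp_bounded by blast
qed

text \<open>Removing two points from the line leaves two rays and an interval. The images of the
  rays are unbounded, so the bounded component in the definition of a quasicircle is the image of
  the interval, and its diameter bounds all distances on the closed arc.\<close>

lemma quasicircle_line_three_point: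
  fixes \<psi> :: "real \<Rightarrow> complex"
  assumes hom: "homeomorphism UNIV J \<psi> \<psi>'" and "closed J"
    and C: "\<And>x y. x \<in> J \<Longrightarrow> y \<in> J \<Longrightarrow> x \<noteq> y \<Longrightarrow>
        \<exists>K\<in>components (J - {x, y}). bounded K \<and> diameter K \<le> C * dist x y"
    and le: "s < u" "u < t"
  shows "dist (\<psi> s) (\<psi> u) \<le> C * dist (\<psi> s) (\<psi> t)" "dist (\<psi> u) (\<psi> t) \<le> C * dist (\<psi> s) (\<psi> t)"
proof -
  have J: "\<psi> ` UNIV = J" and cont: "continuous_on UNIV \<psi>" and inv: "\<And>t. \<psi>' (\<psi> t) = t"
    using hom by (auto simp: homeomorphism_def)
  have inj: "\<psi> a = \<psi> b \<longleftrightarrow> a = b" for a b using inv by metis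
  have sub: "\<psi> ` X \<subseteq> J - {\<psi> s, \<psi> t}" if "s \<notin> X" "t \<notin> X" for X using that J inj by auto
  have con: "connected (\<psi> ` X)" if "connected X" for X
    using that cont by (meson connected_continuous_image continuous_on_subset subset_UNIV)
  obtain K where K: "K \<in> components (J - {\<psi> s, \<psi> t})" "bounded K" "diameter K \<le> C * dist (\<psi> s) (\<psi> t)"
    using C[of "\<psi> s" "\<psi> t"] J inj le by auto
  have swallow: "\<psi> ` X \<subseteq> K" if "connected X" "s \<notin> X" "t \<notin> X" "\<psi> v \<in> K" "v \<in> X" for X v
    using that by (intro components_maximal[OF K(1) con sub]) auto
  obtain z where "z \<in> K" using K(1) in_components_nonempty by fastforce
  then obtain v where v: "\<psi> v \<in> K" using in_components_subset[OF K(1)] J by blast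
  then have "v \<noteq> s" "v \<noteq> t" using in_components_subset[OF K(1)] by auto
  moreover have "\<not> v < s"
  proof
    assume "v < s"
    then have "\<psi> ` {..<s} \<subseteq> K" using v le by (intro swallow) auto
    then have "bounded {..<s}"
      using closed_line_tails_unbounded[OF hom \<open>closed J\<close>] K(2) bounded_subset by blast
    then show False by (simp add: not_bounded_real_rays)
  qed
  moreover have "\<not> t < v"
  proof
    assume "t < v"
    then have "\<psi> ` {t<..} \<subseteq> K" using v le by (intro swallow) auto
    then have "bounded {t<..}"
      using closed_line_tails_unbounded[OF hom \<open>closed J\<close>] K(2) bounded_subset by blast
    then show False by (simp add: not_bounded_real_rays)
  qed
  ultimately have "v \<in> {s<..<t}" by auto
  then have sK: "\<psi> ` {s<..<t} \<subseteq> K" using v by (intro swallow) auto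
  have cl: "\<psi> r \<in> closure K" if "r \<in> {s..t}" for r
  proof -
    have "\<psi> ` closure {s<..<t} \<subseteq> closure (\<psi> ` {s<..<t})"
      by (rule image_closure_subset[OF continuous_on_subset[OF cont]]) (auto simp: closure_subset)
    moreover have "\<psi> r \<in> \<psi> ` closure {s<..<t}" using that le by simp
    ultimately show ?thesis using closure_mono[OF sK] by blast
  qed
  have d: "dist (\<psi> a) (\<psi> b) \<le> C * dist (\<psi> s) (\<psi> t)" if "a \<in> {s..t}" "b \<in> {s..t}" for a b
    using diameter_bounded_bound[of "closure K" "\<psi> a" "\<psi> b"] cl that K(2,3)
    by (simp add: diameter_closure bounded_closure)
  show "dist (\<psi> s) (\<psi> u) \<le> C * dist (\<psi> s) (\<psi> t)" "dist (\<psi> u) (\<psi> t) \<le> C * dist (\<psi> s) (\<psi> t)"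
    using le by (auto intro!: d)
qed

lemma circle_not_homeomorphic_segment: "\<not> {0..1::real} homeomorphic sphere (0::complex) 1"
proof
  assume "{0..1::real} homeomorphic sphere (0::complex) 1"
  then have "contractible (sphere (0::complex) 1)"
    using homeomorphic_contractible convex_imp_contractible[of "{0..1::real}"] by blast
  then show False by (simp add: contractible_sphere)
qed

text \<open>The part of \<open>A\<close> on the arc from \<open>\<psi> e\<close> to
  \<open>\<psi> u\<close> is compact and stays clear of both ends. If it were nonempty, it and the
  closed rest, to which infinity belongs, would disconnect the closure of \<open>A\<close> in the
  sphere.\<close>

lemma connected_sphere_closure_interval:
  fixes \<psi> :: "real \<Rightarrow> complex"
  assumes hom: "homeomorphism UNIV J \<psi> \<psi>'" and "closed J" and A: "closed A" "\<not> bounded A" "A \<subseteq> J"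
    and con: "connected_space (subtopology riemann_sphere (sphere_closure A))"
    and e: "\<psi> e \<notin> A" "\<psi> u \<notin> A" and t: "e < t" "t < u"
  shows "\<psi> t \<notin> A"
proof
  assume tA: "\<psi> t \<in> A"
  have J: "\<psi> ` UNIV = J" and cont: "continuous_on UNIV \<psi>" and inv: "\<And>t. \<psi>' (\<psi> t) = t"
    and cont': "continuous_on J \<psi>'"
    using hom by (auto simp: homeomorphism_def)
  have inj: "\<psi> a = \<psi> b \<longleftrightarrow> a = b" for a b using inv by metis
  define B where "B = A \<inter> \<psi> ` {e..u}"
  define D where "D = A \<inter> \<psi>' -` (- {e<..<u})"
  have "compact (\<psi> ` {e..u})"
    by (rule compact_continuous_image[OF continuous_on_subset[OF cont]]) auto
  then have B: "compact B" unfolding B_def using A(1) by (simp add: closed_Int_compact)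
  have "closed D" unfolding D_def
    by (rule continuous_closed_preimage[OF continuous_on_subset[OF cont' A(3)] A(1)]) (simp add: closed_Compl)
  have BD: "B \<inter> D = {}"
  proof -
    have "v \<in> {e<..<u}" if "\<psi> v \<in> A" "v \<in> {e..u}" for v
      using that e by (cases "v = e \<or> v = u") auto
    then show ?thesis by (auto simp: B_def D_def inv)
  qed
  have AU: "A = B \<union> D"
  proof -
    have "x \<in> B \<union> D" if x: "x \<in> A" for x
    proof -
      obtain v where v: "x = \<psi> v" using x A(3) J by blast
      show ?thesis
        using x by (cases "v \<in> {e<..<u}") (auto simp: B_def D_def v inv)
    qed
    moreover have "B \<union> D \<subseteq> A" by (auto simp: B_def D_def)
    ultimately show ?thesis by blast
  qed
  have S: "sphere_closure A = insert None (Some ` A)" by (rule sphere_closure_unbounded[OF A(1,2)])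
  have "closedin riemann_sphere (Some ` B)" using B compact_imp_closed by auto
  then have cB: "closedin (subtopology riemann_sphere (sphere_closure A)) (Some ` B)"
    unfolding S by (rule closedin_subset_topspace) (auto simp: AU)
  have "closedin riemann_sphere (insert None (Some ` D))"
    unfolding closedin_Alexandroff_compactification using \<open>closed D\<close>
    by (intro disjI2 exI[of _ "- D"]) (auto simp: open_Compl)
  then have cD: "closedin (subtopology riemann_sphere (sphere_closure A)) (insert None (Some ` D))"
    unfolding S by (rule closedin_subset_topspace) (auto simp: AU)
  have "Some (\<psi> t) \<in> Some ` B" using tA t by (auto simp: B_def)
  then have "Some ` B \<noteq> {}" by blast
  moreover have "topspace (subtopology riemann_sphere (sphere_closure A)) \<subseteq> Some ` B \<union> insert None (Some ` D)"
    unfolding S using AU by auto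
  moreover have "Some ` B \<inter> insert None (Some ` D) = {}" using BD by auto
  ultimately show False using con cB cD unfolding connected_space_closedin by blast
qed

text \<open>A circle is not an arc, so \<open>A\<close> is a proper part of the quasicircle, which
  yields \<open>e\<close>. Connectedness through infinity then forces \<open>A\<close> to consist of
  at most one closed ray on each side of \<open>e\<close>. The whole line \<open>\<psi>\<close> is
  kept because the three-point condition will also be applied to the point \<open>\<psi> e\<close>
  outside \<open>A\<close>.\<close>

lemma unbounded_quasiarc_parametrization:
  assumes "quasiarc A" and A: "closed A" "\<not> bounded A"
  shows "\<exists>(\<psi> :: real \<Rightarrow> complex) C e. continuous_on UNIV \<psi> \<and> 0 < C \<and>
    (\<forall>s u t. s < u \<longrightarrow> u < t \<longrightarrow> dist (\<psi> s) (\<psi> u) \<le> C * dist (\<psi> s) (\<psi> t)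
      \<and> dist (\<psi> u) (\<psi> t) \<le> C * dist (\<psi> s) (\<psi> t)) \<and>
    A \<subseteq> range \<psi> \<and> \<psi> e \<notin> A \<and>
    (\<forall>t u. \<psi> t \<in> A \<longrightarrow> e < t \<longrightarrow> t < u \<longrightarrow> \<psi> u \<in> A) \<and>
    (\<forall>t u. \<psi> t \<in> A \<longrightarrow> t < e \<longrightarrow> u < t \<longrightarrow> \<psi> u \<in> A) \<and>
    (\<forall>s. \<not> bounded (\<psi> ` {s..}) \<and> \<not> bounded (\<psi> ` {..s}))"
proof -
  obtain J where J: "quasicircle J" "A \<subseteq> J"
    and arc: "subtopology riemann_sphere (sphere_closure A) homeomorphic_space top_of_set {0..1::real}"
    using assms(1) unfolding quasiarc_def by blast
  have clJ: "closed J" and unb: "\<not> bounded J"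
    and circ: "subtopology riemann_sphere (sphere_closure J) homeomorphic_space top_of_set (sphere (0::complex) 1)"
    using J A bounded_subset unfolding quasicircle_def by blast+
  obtain C where C: "C > 0" "\<And>x y. x \<in> J \<Longrightarrow> y \<in> J \<Longrightarrow> x \<noteq> y \<Longrightarrow>
        \<exists>K\<in>components (J - {x, y}). bounded K \<and> diameter K \<le> C * dist x y"
    using J(1) unfolding quasicircle_def by blast
  obtain \<psi> :: "real \<Rightarrow> complex" and \<psi>' where hom: "homeomorphism UNIV J \<psi> \<psi>'"
    using jordan_curve_through_infinity_homeomorphic_line[OF clJ unb circ] homeomorphic_sym
    unfolding homeomorphic_def by blast
  have rng: "range \<psi> = J" and cont: "continuous_on UNIV \<psi>"
    using hom by (auto simp: homeomorphism_def)
  have "A \<noteq> J"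
  proof
    assume "A = J"
    then have "top_of_set {0..1::real} homeomorphic_space top_of_set (sphere (0::complex) 1)"
      using arc circ homeomorphic_space_sym homeomorphic_space_trans by blast
    then show False using circle_not_homeomorphic_segment homeomorphic_if_homeomorphic_space by blast
  qed
  then obtain e where e: "\<psi> e \<notin> A" using J(2) rng by blast
  have con: "connected_space (subtopology riemann_sphere (sphere_closure A))"
    using homeomorphic_connected_space[OF arc] by (simp add: connected_space_subtopology)
  note gap = connected_sphere_closure_interval[OF hom clJ A J(2) con]
  show ?thesis
  proof (intro exI conjI allI impI)
    show "continuous_on UNIV \<psi>" "0 < C" by fact+
    show "dist (\<psi> s) (\<psi> u) \<le> C * dist (\<psi> s) (\<psi> t)" "dist (\<psi> u) (\<psi> t) \<le> C * dist (\<psi> s) (\<psi> t)"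
      if "s < u" "u < t" for s u t
      using quasicircle_line_three_point[OF hom clJ C(2) that] by auto
    show "A \<subseteq> range \<psi>" using J(2) rng by simp
    show "\<psi> e \<notin> A" by fact
    show "\<psi> u \<in> A" if "\<psi> t \<in> A" "e < t" "t < u" for t u
      using gap[of e u t] e that by blast
    show "\<psi> u \<in> A" if "\<psi> t \<in> A" "t < e" "u < t" for t u
      using gap[of u e t] e that by blast
    show "\<not> bounded (\<psi> ` {s..})" for s
      using closed_line_tails_unbounded[OF hom clJ] not_bounded_real_rays by blast
    show "\<not> bounded (\<psi> ` {..s})" for s
      using closed_line_tails_unbounded[OF hom clJ] not_bounded_real_rays by blast
  qed
qed

text \<open>A bounded quasiarc is a compact arc and does not separate the plane, so
  \<open>U\<close>, which has no boundary point in the connected complement of the arc, is all of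
  this complement. An unbounded \<open>U\<close> is excluded because simple connectedness would make
  the components of its frontier unbounded; for bounded \<open>U\<close> the whole plane would be
  bounded.\<close>

lemma quasiarc_frontier_unbounded:
  fixes U :: "complex set"
  assumes U: "open U" "connected U" "simply_connected U" and Q: "quasiarc (frontier U)"
  shows "\<not> bounded (frontier U)"
proof
  assume bdd: "bounded (frontier U)"
  define A where "A = frontier U"
  have "closed A" by (simp add: A_def)
  have "subtopology riemann_sphere (Some ` A) homeomorphic_space top_of_set {0..1::real}"
    using Q sphere_closure_bounded[OF \<open>closed A\<close>] bdd unfolding quasiarc_def A_def by simp
  then have "top_of_set {0..1::real} homeomorphic_space top_of_set A"
    using homeomorphic_space_image_Some homeomorphic_space_trans homeomorphic_space_sym by blast
  then have "{0..1::real} homeomorphic A" by (rule homeomorphic_if_homeomorphic_space)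
  then obtain g g' where g: "homeomorphism {0..1::real} A g g'" unfolding homeomorphic_def by blast
  then have "arc g" "path_image g = A"
    unfolding arc_def path_def path_image_def homeomorphism_def by (auto intro: inj_on_inverseI)
  then have con: "connected (- A)" and conA: "connected A" and ne: "A \<noteq> {}"
    using connected_arc_complement[of g] connected_path_image[of g] arc_imp_path[of g] by auto
  have "bounded U"
  proof (rule ccontr)
    assume "\<not> bounded U"
    then have "\<not> bounded A"
      using U(3) simply_connected_eq_frontier_properties[OF U(1)] conA ne
      using in_components_self[of A] unfolding A_def by auto
    then show False using bdd by (simp add: A_def)
  qed
  have "U \<subseteq> - A" using U(1) by (auto simp: A_def frontier_def interior_open)
  moreover have "U \<noteq> {}" using ne by (auto simp: A_def)
  moreover have "- A \<subseteq> U"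
    using connected_Int_frontier[OF con, of U] \<open>U \<subseteq> - A\<close> \<open>U \<noteq> {}\<close> unfolding A_def by blast
  ultimately have "- A = U" by blast
  then have "bounded (UNIV :: complex set)"
    using \<open>bounded U\<close> bdd unfolding A_def by (metis Compl_partition bounded_Un sup_commute)
  then show False by (rule not_bounded_UNIV[THEN notE])
qed

section \<open>Inversion of the boundary and its linear connectedness\<close>

text \<open>The image of \<open>A\<close> and of the point at infinity under the inversion \<open>x \<mapsto> 1 / (x - w)\<close>.\<close>

definition inverted :: "complex \<Rightarrow> complex set \<Rightarrow> complex set" where
  "inverted w A = insert 0 {y. y \<noteq> 0 \<and> w + 1 / y \<in> A}"

text \<open>A variant of the bounded turning condition. The centre \<open>p\<close> ranges over the
  whole plane because the discs that enclose images of crosscuts are centred off the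
  boundary.\<close>

definition linearly_connected :: "real \<Rightarrow> complex set \<Rightarrow> bool" where
  "linearly_connected M \<alpha> \<longleftrightarrow> (\<forall>p r. 0 < r \<longrightarrow>
     (\<exists>\<sigma>. connected \<sigma> \<and> \<alpha> \<inter> cball p r \<subseteq> \<sigma> \<and> \<sigma> \<subseteq> \<alpha> \<inter> cball p (M * r)))"

lemma dist_inversion:
  fixes w :: complex
  assumes "x \<noteq> w" "y \<noteq> w"
  shows "dist (1 / (x - w)) (1 / (y - w)) = dist x y / (norm (x - w) * norm (y - w))"
proof -
  have "1 / (x - w) - 1 / (y - w) = (y - x) / ((x - w) * (y - w))"
    using assms by (simp add: field_simps)
  then show ?thesis by (simp add: dist_norm norm_divide norm_mult norm_minus_commute)
qed

text \<open>One of the two rays of \<open>A\<close>, together with the rest of the line, which is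
  needed for the point \<open>\<psi> e\<close>; the other ray is a second instance with reversed
  parameter. \<open>\<rho>\<close> is a lower bound for the distance of \<open>A\<close> from the
  pole \<open>w\<close> of the inversion.\<close>

locale quasiarc_ray =
  fixes \<psi> :: "real \<Rightarrow> complex" and A :: "complex set" and C e \<rho> :: real and w :: complex
  assumes cont: "continuous_on UNIV \<psi>" and C: "1 \<le> C"
    and qc1: "\<And>s u t. s < u \<Longrightarrow> u < t \<Longrightarrow> dist (\<psi> s) (\<psi> u) \<le> C * dist (\<psi> s) (\<psi> t)"
    and qc2: "\<And>s u t. s < u \<Longrightarrow> u < t \<Longrightarrow> dist (\<psi> u) (\<psi> t) \<le> C * dist (\<psi> s) (\<psi> t)"
    and tail: "\<And>t u. \<psi> t \<in> A \<Longrightarrow> e < t \<Longrightarrow> t < u \<Longrightarrow> \<psi> u \<in> A"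
    and unb: "\<And>s. \<not> bounded (\<psi> ` {s..})"
    and \<rho>: "0 < \<rho>" "\<And>x. x \<in> A \<Longrightarrow> \<rho> \<le> norm (x - w)"
begin

definition v :: "real \<Rightarrow> complex" where "v t = 1 / (\<psi> t - w)"

definition X :: "real \<Rightarrow> real" where "X t = norm (\<psi> t - w)"

definition ray :: "real set" where "ray = {t. e < t \<and> \<psi> t \<in> A}"

definition c1 :: real where "c1 = C * (X e / \<rho>) + C + 1"

lemma c1: "1 \<le> c1"
  using C \<rho>(1) by (simp add: c1_def X_def)

lemma ray_up: "t \<in> ray \<Longrightarrow> t \<le> u \<Longrightarrow> u \<in> ray"
  using tail[of t u] by (cases "t = u") (auto simp: ray_def)

lemma X_ge: "t \<in> ray \<Longrightarrow> \<rho> \<le> X t"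
  using \<rho>(2) by (auto simp: ray_def X_def)

lemma X_pos: "t \<in> ray \<Longrightarrow> 0 < X t"
  using X_ge[of t] \<rho>(1) by linarith

lemma ne_w: "t \<in> ray \<Longrightarrow> \<psi> t \<noteq> w"
  using X_pos[of t] by (auto simp: X_def)

lemma norm_v: "norm (v t) = 1 / X t"
  by (simp add: v_def X_def norm_divide)

lemma dist_v: "s \<in> ray \<Longrightarrow> t \<in> ray \<Longrightarrow> dist (v s) (v t) = dist (\<psi> s) (\<psi> t) / (X s * X t)"
  unfolding v_def X_def by (rule dist_inversion) (auto dest: ne_w)

lemma v_in_inverted: "t \<in> ray \<Longrightarrow> v t \<in> inverted w A"
  using ne_w[of t] by (auto simp: inverted_def v_def ray_def)

text \<open>The three-point condition for e < t < u bounds \<open>dist (\<psi> t) (\<psi> u)\<close>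
  by \<open>C * (X e + X u)\<close>, and \<open>X e\<close> is absorbed since \<open>X u\<close> is
  at least \<open>\<rho>\<close>; \<open>c1\<close> collects the resulting factors. After inversion
  this says that the ray approaches 0 monotonically up to the factor \<open>c1\<close>.\<close>

lemma X_le:
  assumes "t \<in> ray" "t \<le> u"
  shows "X t \<le> c1 * X u"
proof (cases "t = u")
  case True
  then show ?thesis using mult_right_mono[OF c1, of "X t"] by (simp add: X_def)
next
  case False
  have u: "u \<in> ray" by (rule ray_up[OF assms])
  have "dist (\<psi> t) (\<psi> u) \<le> C * dist (\<psi> e) (\<psi> u)"
    using assms False by (intro qc2) (auto simp: ray_def)
  also have "\<dots> \<le> C * (X e + X u)"
    using norm_triangle_ineq4[of "\<psi> e - w" "\<psi> u - w"] C by (intro mult_left_mono) (auto simp: dist_norm X_def)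
  also have "X e \<le> X e / \<rho> * X u"
    using mult_left_mono[OF X_ge[OF u], of "X e / \<rho>"] \<rho>(1) by (simp add: X_def)
  finally have "dist (\<psi> t) (\<psi> u) \<le> C * (X e / \<rho> * X u + X u)" using C by simp
  moreover have "X t \<le> X u + dist (\<psi> t) (\<psi> u)"
    using norm_triangle_ineq[of "\<psi> u - w" "\<psi> t - \<psi> u"] by (simp add: X_def dist_norm)
  ultimately show ?thesis by (simp add: c1_def algebra_simps)
qed

lemma norm_v_le:
  assumes "t \<in> ray" "t \<le> u"
  shows "norm (v u) \<le> c1 * norm (v t)"
  using X_le[OF assms] X_pos[OF assms(1)] X_pos[OF ray_up[OF assms]]
  by (simp add: norm_v field_simps)

text \<open>Inversion divides distances by the product of the distances to \<open>w\<close>, so the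
  three-point condition survives once the quotient \<open>X s / X u\<close> is bounded, which is
  \<open>X_le\<close>.\<close>

lemma dist_v_le:
  assumes s: "s \<in> ray" and "s \<le> u" "u \<le> t"
  shows "dist (v u) (v t) \<le> C * c1 * dist (v s) (v t)"
proof -
  have u: "u \<in> ray" and t: "t \<in> ray" using assms ray_up by (meson order_trans)+
  have Cc: "1 \<le> C * c1" using mult_mono[OF C c1] C by simp
  consider "u = s" | "u = t" | "s < u" "u < t" using assms by linarith
  then show ?thesis
  proof cases
    case 1
    then show ?thesis using mult_right_mono[OF Cc, of "dist (v s) (v t)"] by simp
  next
    case 2
    then show ?thesis using Cc by simp
  next
    case 3
    have "dist (v u) (v t) = dist (\<psi> u) (\<psi> t) / (X u * X t)" by (rule dist_v[OF u t])
    also have "\<dots> \<le> C * dist (\<psi> s) (\<psi> t) / (X u * X t)"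
      using qc2[OF 3] X_pos[OF u] X_pos[OF t] by (intro divide_right_mono) auto
    also have "\<dots> = C * dist (\<psi> s) (\<psi> t) / X t * (1 / X u)" by simp
    also have "\<dots> \<le> C * dist (\<psi> s) (\<psi> t) / X t * (c1 / X s)"
      using X_le[OF s assms(2)] X_pos[OF u] X_pos[OF s] X_pos[OF t] C
      by (intro mult_left_mono) (auto simp: field_simps)
    also have "\<dots> = C * c1 * dist (v s) (v t)" by (simp add: dist_v[OF s t] mult_ac)
    finally show ?thesis .
  qed
qed

lemma continuous_on_v: "S \<subseteq> ray \<Longrightarrow> continuous_on S v"
  unfolding v_def using ne_w
  by (intro continuous_intros continuous_on_subset[OF cont]) auto

text \<open>0 stands for infinity: \<open>\<psi>\<close> is unbounded on every tail, so
  \<open>v\<close> comes arbitrarily close to 0 there.\<close>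

lemma connected_tail:
  assumes t: "t \<in> ray"
  shows "connected (insert 0 (v ` {t..}))"
proof (rule connected_intermediate_closure)
  show "connected (v ` {t..})"
    using ray_up[OF t] by (intro connected_continuous_image continuous_on_v) auto
  have "0 \<in> closure (v ` {t..})"
    unfolding closure_approachable
  proof (intro allI impI)
    fix \<epsilon> :: real assume \<epsilon>: "0 < \<epsilon>"
    obtain u where u: "u \<ge> t" "norm (\<psi> u) > norm w + 1 / \<epsilon>"
      using unb[of t] unfolding bounded_iff by (force simp: not_le)
    then have "1 / \<epsilon> < X u" using norm_triangle_sub[of "\<psi> u" w] by (simp add: X_def)
    then have "norm (v u) < \<epsilon>"
      using \<epsilon> X_pos[OF ray_up[OF t u(1)]] by (simp add: norm_v field_simps)
    then show "\<exists>y\<in>v ` {t..}. dist y 0 < \<epsilon>" using u(1) by auto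
  qed
  then show "insert 0 (v ` {t..}) \<subseteq> closure (v ` {t..})" by (simp add: closure_subset)
qed auto

lemma tail_subset: "t \<in> ray \<Longrightarrow> insert 0 (v ` {t..}) \<subseteq> inverted w A"
  using v_in_inverted ray_up by (auto simp: inverted_def)

text \<open>\<open>\<sigma>\<close> is the image of the smallest parameter interval containing
  \<open>S\<close>. Each of its points lies between some \<open>v s\<close> and \<open>v t\<close>
  in the disc, which are at most \<open>2 * r\<close> apart, so the transported three-point
  condition keeps it within \<open>2 * C * c1 * r\<close> of \<open>v t\<close>.\<close>

lemma hull:
  assumes S: "S \<subseteq> ray" and sub: "v ` S \<subseteq> cball p r"
  shows "\<exists>\<sigma>. connected \<sigma> \<and> v ` S \<subseteq> \<sigma> \<and> \<sigma> \<subseteq> inverted w A \<inter> cball p ((1 + 2 * C * c1) * r)"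
proof -
  define I where "I = {u. \<exists>s\<in>S. \<exists>t\<in>S. s \<le> u \<and> u \<le> t}"
  have Ir: "I \<subseteq> ray" using S ray_up by (auto simp: I_def)
  have "is_interval I" unfolding is_interval_1 by (auto simp: I_def intro: order_trans)
  then have "connected I" by (rule is_interval_connected)
  then have "connected (v ` I)" by (rule connected_continuous_image[OF continuous_on_v[OF Ir]])
  moreover have "v ` S \<subseteq> v ` I" by (auto simp: I_def)
  moreover have "v ` I \<subseteq> cball p ((1 + 2 * C * c1) * r)"
  proof
    fix y assume "y \<in> v ` I"
    then obtain u s t where y: "y = v u" and st: "s \<in> S" "t \<in> S" "s \<le> u" "u \<le> t" by (auto simp: I_def)
    have ps: "dist p (v s) \<le> r" and pt: "dist p (v t) \<le> r" using sub st by auto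
    have "dist (v u) (v t) \<le> C * c1 * dist (v s) (v t)" using S st by (intro dist_v_le) auto
    also have "\<dots> \<le> C * c1 * (2 * r)"
      using dist_triangle3[of "v s" "v t" p] ps pt C c1 by (intro mult_left_mono) auto
    finally show "y \<in> cball p ((1 + 2 * C * c1) * r)"
      using dist_triangle2[of p "v u" "v t"] pt by (simp add: y algebra_simps)
  qed
  ultimately show ?thesis using v_in_inverted Ir by (intro exI[of _ "v ` I"]) auto
qed

end

text \<open>The position of the disc relative to 0, the image of infinity, decides. If some point of
  the inverted arc in the disc is within \<open>N * r\<close> of 0, the points of the arc in the
  disc are joined through 0 along tails of the rays. Otherwise the disc is too far from 0 to meet
  both rays, and a piece of a single ray joins them.\<close>

lemma linearly_connected_inverted_quasiarc:
  assumes Q: "quasiarc A" and A: "closed A" "\<not> bounded A" and w: "w \<notin> A"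
  shows "\<exists>M>0. linearly_connected M (inverted w A)"
proof -
  have ne: "A \<noteq> {}" using A(2) by auto
  obtain \<psi> :: "real \<Rightarrow> complex" and C0 e where
    cont: "continuous_on UNIV \<psi>" and C0: "0 < C0" and
    q: "\<forall>s u t. s < u \<longrightarrow> u < t \<longrightarrow> dist (\<psi> s) (\<psi> u) \<le> C0 * dist (\<psi> s) (\<psi> t)
      \<and> dist (\<psi> u) (\<psi> t) \<le> C0 * dist (\<psi> s) (\<psi> t)" and
    rng: "A \<subseteq> range \<psi>" and e: "\<psi> e \<notin> A" and
    up: "\<forall>t u. \<psi> t \<in> A \<longrightarrow> e < t \<longrightarrow> t < u \<longrightarrow> \<psi> u \<in> A" and
    down: "\<forall>t u. \<psi> t \<in> A \<longrightarrow> t < e \<longrightarrow> u < t \<longrightarrow> \<psi> u \<in> A" and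
    unb: "\<forall>s. \<not> bounded (\<psi> ` {s..}) \<and> \<not> bounded (\<psi> ` {..s})"
    using unbounded_quasiarc_parametrization[OF Q A] by blast
  define C where "C = max 1 C0"
  have C: "1 \<le> C" by (simp add: C_def)
  have q1: "dist (\<psi> s) (\<psi> u) \<le> C * dist (\<psi> s) (\<psi> t)"
    and q2: "dist (\<psi> u) (\<psi> t) \<le> C * dist (\<psi> s) (\<psi> t)" if "s < u" "u < t" for s u t
    using q[rule_format, OF that] mult_right_mono[of C0 C "dist (\<psi> s) (\<psi> t)"] by (auto simp: C_def)
  define \<rho> where "\<rho> = infdist w A"
  have \<rho>: "0 < \<rho>" "\<And>x. x \<in> A \<Longrightarrow> \<rho> \<le> norm (x - w)"
    using in_closed_iff_infdist_zero[OF A(1) ne, of w] w infdist_nonneg[of w A] infdist_le[of _ A w]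
    by (auto simp: \<rho>_def dist_norm norm_minus_commute)
  define \<eta> where "\<eta> = infdist (\<psi> e) A"
  have \<eta>: "0 < \<eta>" "\<And>x. x \<in> A \<Longrightarrow> \<eta> \<le> dist (\<psi> e) x"
    using in_closed_iff_infdist_zero[OF A(1) ne, of "\<psi> e"] e infdist_nonneg[of "\<psi> e" A] infdist_le[of _ A "\<psi> e"]
    by (auto simp: \<eta>_def)
  interpret R: quasiarc_ray \<psi> A C e \<rho> w
    by unfold_locales (use cont C q1 q2 up unb \<rho> in auto)
  interpret L: quasiarc_ray "\<lambda>t. \<psi> (- t)" A C "- e" \<rho> w
  proof unfold_locales
    show "continuous_on UNIV (\<lambda>t. \<psi> (- t))"
      by (intro continuous_on_compose2[OF cont] continuous_intros) auto
    show "dist (\<psi> (- s)) (\<psi> (- u)) \<le> C * dist (\<psi> (- s)) (\<psi> (- t))"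
      "dist (\<psi> (- u)) (\<psi> (- t)) \<le> C * dist (\<psi> (- s)) (\<psi> (- t))" if "s < u" "u < t" for s u t
      using q1[of "- t" "- u" "- s"] q2[of "- t" "- u" "- s"] that by (auto simp: dist_commute)
    show "\<psi> (- u) \<in> A" if "\<psi> (- t) \<in> A" "- e < t" "t < u" for t u
      using down[rule_format, of "- t" "- u"] that by auto
    show "\<not> bounded ((\<lambda>t. \<psi> (- t)) ` {s..})" for s
    proof -
      have "(\<lambda>t. \<psi> (- t)) ` {s..} = \<psi> ` {.. - s}"
        by (simp add: image_image[symmetric, of \<psi> uminus])
      then show ?thesis using unb by simp
    qed
  qed (use C \<rho> in auto)
  have c1: "L.c1 = R.c1" by (simp add: L.c1_def R.c1_def L.X_def R.X_def)
  define E where "E = norm (\<psi> e - w)"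
  define c2 where "c2 = C + E * C / \<eta>"
  have c2: "1 \<le> c2" using C \<eta>(1) by (simp add: c2_def E_def add_increasing2)
  \<comment> \<open>The point \<open>\<psi> e\<close> lies between the rays on the line and has
    distance \<open>\<eta>\<close> from \<open>A\<close>. By the three-point condition,
    \<open>C\<close> times the distance of two points on opposite rays bounds both
    \<open>\<eta>\<close> and \<open>dist (\<psi> e) (\<psi> t)\<close>, hence a multiple of that
    distance bounds \<open>R.X t\<close>; dividing by \<open>L.X s * R.X t\<close> gives the claim
    after inversion.\<close>
  have opposite: "norm (L.v s) \<le> c2 * dist (L.v s) (R.v t)" if s: "s \<in> L.ray" and t: "t \<in> R.ray" for s t
  proof -
    have st: "- s < e" "e < t" "\<psi> (- s) \<in> A" "\<psi> t \<in> A" using s t by (auto simp: L.ray_def R.ray_def)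
    have ed: "dist (\<psi> e) (\<psi> t) \<le> C * dist (\<psi> (- s)) (\<psi> t)" by (rule q2[OF st(1,2)])
    have "\<eta> \<le> C * dist (\<psi> (- s)) (\<psi> t)" using \<eta>(2)[OF st(4)] ed by simp
    then have "E * \<eta> \<le> E * (C * dist (\<psi> (- s)) (\<psi> t))" by (rule mult_left_mono) (simp add: E_def)
    then have "E \<le> E * C / \<eta> * dist (\<psi> (- s)) (\<psi> t)" using \<eta>(1) by (simp add: field_simps)
    moreover have "R.X t \<le> E + dist (\<psi> e) (\<psi> t)"
      using norm_triangle_ineq[of "\<psi> e - w" "\<psi> t - \<psi> e"] by (simp add: R.X_def E_def dist_norm norm_minus_commute)
    ultimately have "R.X t \<le> c2 * dist (\<psi> (- s)) (\<psi> t)" using ed by (simp add: c2_def algebra_simps)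
    then have "R.X t / (L.X s * R.X t) \<le> c2 * dist (\<psi> (- s)) (\<psi> t) / (L.X s * R.X t)"
      using L.X_pos[OF s] R.X_pos[OF t] by (intro divide_right_mono) auto
    moreover have "dist (L.v s) (R.v t) = dist (\<psi> (- s)) (\<psi> t) / (L.X s * R.X t)"
      unfolding L.v_def R.v_def L.X_def R.X_def
      by (rule dist_inversion) (use L.ne_w[OF s] R.ne_w[OF t] in auto)
    ultimately show ?thesis
      using L.X_pos[OF s] R.X_pos[OF t] by (simp add: L.norm_v)
  qed
  \<comment> \<open>Two points of a disc of radius \<open>r\<close> are at most \<open>2 * r\<close>
    apart, so with this \<open>N\<close> points on opposite rays further than \<open>N * r\<close>
    from 0 contradict \<open>opposite\<close>. \<open>M\<close> adds up the factors needed in the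
    two cases.\<close>
  define N where "N = 2 * c2"
  define M where "M = (N + 1 + R.c1 * (N + 2)) + (1 + 2 * C * R.c1)"
  have pos: "0 < N" "1 \<le> R.c1" using c2 R.c1 by (auto simp: N_def)
  have M: "0 < M" using pos C by (simp add: M_def add_pos_pos)
  have param: "y = 0 \<or> y \<in> R.v ` R.ray \<or> y \<in> L.v ` L.ray" if y: "y \<in> inverted w A" for y
  proof (cases "y = 0")
    case False
    then have wy: "w + 1 / y \<in> A" using y by (auto simp: inverted_def)
    then obtain t where t: "\<psi> t = w + 1 / y" using rng by (metis rangeE subsetD)
    have "t \<noteq> e" using e t wy by metis
    then consider "e < t" | "t < e" by linarith
    then show ?thesis
    proof cases
      case 1
      then show ?thesis using t wy by (auto simp: R.v_def R.ray_def intro!: image_eqI[of _ _ t])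
    next
      case 2
      then show ?thesis using t wy by (auto simp: L.v_def L.ray_def intro!: image_eqI[of _ _ "- t"])
    qed
  qed simp
  have "\<exists>\<sigma>. connected \<sigma> \<and> inverted w A \<inter> cball p r \<subseteq> \<sigma> \<and> \<sigma> \<subseteq> inverted w A \<inter> cball p (M * r)"
    if r: "0 < r" for p r
  proof (cases "\<exists>x\<in>inverted w A \<inter> cball p r. norm x \<le> N * r")
    case True
    then obtain x where x: "dist p x \<le> r" "norm x \<le> N * r" by auto
    have p: "norm p \<le> (N + 1) * r"
      using norm_triangle_sub[of p x] x by (simp add: dist_norm algebra_simps)
    have near: "norm y \<le> (N + 2) * r" if "dist p y \<le> r" for y
      using norm_triangle_sub[of y p] p that by (simp add: dist_norm norm_minus_commute algebra_simps)
    \<comment> \<open>All members contain 0, so the union is connected; \<open>{0}\<close> keeps the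
      family nonempty.\<close>
    define F where "F = insert {0} ((\<lambda>t. insert 0 (R.v ` {t..})) ` {t \<in> R.ray. dist p (R.v t) \<le> r} \<union>
      (\<lambda>t. insert 0 (L.v ` {t..})) ` {t \<in> L.ray. dist p (L.v t) \<le> r})"
    have "connected (\<Union>F)"
    proof (rule connected_Union)
      show "connected S" if "S \<in> F" for S
        using that R.connected_tail L.connected_tail by (auto simp: F_def)
      show "\<Inter>F \<noteq> {}" by (auto simp: F_def)
    qed
    moreover have "inverted w A \<inter> cball p r \<subseteq> \<Union>F"
    proof
      fix y assume y: "y \<in> inverted w A \<inter> cball p r"
      then have "y = 0 \<or> y \<in> R.v ` R.ray \<or> y \<in> L.v ` L.ray" using param by blast
      then show "y \<in> \<Union>F" using y by (auto simp: F_def)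
    qed
    moreover have "\<Union>F \<subseteq> inverted w A"
    proof (rule Sup_least)
      show "S \<subseteq> inverted w A" if SF: "S \<in> F" for S
      proof -
        consider "S = {0}" | t where "t \<in> R.ray" "S = insert 0 (R.v ` {t..})"
          | t where "t \<in> L.ray" "S = insert 0 (L.v ` {t..})"
          using SF unfolding F_def by blast
        then show ?thesis
        proof cases
          case 1
          then show ?thesis by (simp add: inverted_def)
        next
          case 2
          then show ?thesis using R.tail_subset by simp
        next
          case 3
          then show ?thesis using L.tail_subset by simp
        qed
      qed
    qed
    moreover have "\<Union>F \<subseteq> cball p (M * r)"
    proof
      fix y assume "y \<in> \<Union>F"
      then consider "y = 0" | t u where "t \<in> R.ray" "dist p (R.v t) \<le> r" "t \<le> u" "y = R.v u"
        | t u where "t \<in> L.ray" "dist p (L.v t) \<le> r" "t \<le> u" "y = L.v u"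
        by (auto simp: F_def split: if_splits)
      then have "norm y \<le> R.c1 * ((N + 2) * r)"
      proof cases
        case 1
        then show ?thesis using pos r by simp
      next
        case 2
        have "norm y \<le> R.c1 * norm (R.v t)" using R.norm_v_le 2 by blast
        also have "\<dots> \<le> R.c1 * ((N + 2) * r)" using pos by (intro mult_left_mono near 2) auto
        finally show ?thesis .
      next
        case 3
        have "norm y \<le> R.c1 * norm (L.v t)" using L.norm_v_le 3 c1 by metis
        also have "\<dots> \<le> R.c1 * ((N + 2) * r)" using pos by (intro mult_left_mono near 3) auto
        finally show ?thesis .
      qed
      then have "dist p y \<le> (N + 1) * r + R.c1 * ((N + 2) * r)"
        using p norm_triangle_ineq4[of p y] by (simp add: dist_norm)
      also have "\<dots> = (N + 1 + R.c1 * (N + 2)) * r" by (simp add: algebra_simps)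
      also have "\<dots> \<le> M * r"
        using r pos C by (intro mult_right_mono) (auto simp: M_def)
      finally show "y \<in> cball p (M * r)" by simp
    qed
    ultimately show ?thesis by blast
  next
    case False
    have far: "N * r < norm y" if "y \<in> inverted w A" "dist p y \<le> r" for y
      using False that by (meson IntI mem_cball not_le)
    have big: "(1 + 2 * C * R.c1) * r \<le> M * r"
      using r pos C by (intro mult_right_mono) (auto simp: M_def)
    define SR where "SR = {t \<in> R.ray. dist p (R.v t) \<le> r}"
    define SL where "SL = {t \<in> L.ray. dist p (L.v t) \<le> r}"
    have cover: "inverted w A \<inter> cball p r \<subseteq> R.v ` SR \<union> L.v ` SL"
    proof
      fix y assume y: "y \<in> inverted w A \<inter> cball p r"
      then have "y \<noteq> 0" using far[of y] mult_pos_pos[OF pos(1) r] by auto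
      then show "y \<in> R.v ` SR \<union> L.v ` SL" using param[of y] y by (auto simp: SR_def SL_def)
    qed
    have "SR = {} \<or> SL = {}"
    proof (rule ccontr)
      assume "\<not> ?thesis"
      then obtain s t where st: "s \<in> SL" "t \<in> SR" by blast
      then have "N * r < norm (L.v s)" by (intro far L.v_in_inverted) (auto simp: SL_def)
      also have "\<dots> \<le> c2 * dist (L.v s) (R.v t)" using st by (intro opposite) (auto simp: SL_def SR_def)
      also have "\<dots> \<le> c2 * (2 * r)"
        using dist_triangle3[of "L.v s" "R.v t" p] st c2 by (intro mult_left_mono) (auto simp: SL_def SR_def)
      finally show False by (simp add: N_def)
    qed
    then show ?thesis
    proof
      assume "SR = {}"
      with cover have cov: "inverted w A \<inter> cball p r \<subseteq> L.v ` SL" by simp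
      have "\<exists>\<sigma>. connected \<sigma> \<and> L.v ` SL \<subseteq> \<sigma> \<and> \<sigma> \<subseteq> inverted w A \<inter> cball p ((1 + 2 * C * R.c1) * r)"
        unfolding c1[symmetric] by (rule L.hull) (auto simp: SL_def)
      then obtain \<sigma> where \<sigma>: "connected \<sigma>" "L.v ` SL \<subseteq> \<sigma>"
        "\<sigma> \<subseteq> inverted w A \<inter> cball p ((1 + 2 * C * R.c1) * r)" by blast
      show ?thesis
        using \<sigma> cov subset_cball[OF big, of p] by (intro exI[of _ \<sigma>]) blast
    next
      assume "SL = {}"
      with cover have cov: "inverted w A \<inter> cball p r \<subseteq> R.v ` SR" by simp
      have "\<exists>\<sigma>. connected \<sigma> \<and> R.v ` SR \<subseteq> \<sigma> \<and> \<sigma> \<subseteq> inverted w A \<inter> cball p ((1 + 2 * C * R.c1) * r)"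
        by (rule R.hull) (auto simp: SR_def)
      then obtain \<sigma> where \<sigma>: "connected \<sigma>" "R.v ` SR \<subseteq> \<sigma>"
        "\<sigma> \<subseteq> inverted w A \<inter> cball p ((1 + 2 * C * R.c1) * r)" by blast
      show ?thesis
        using \<sigma> cov subset_cball[OF big, of p] by (intro exI[of _ \<sigma>]) blast
    qed
  qed
  then show ?thesis using M unfolding linearly_connected_def by blast
qed

lemma closed_inverted:
  assumes "closed A" "w \<notin> A" shows "closed (inverted w A)"
proof (cases "A = {}")
  case True
  then show ?thesis by (simp add: inverted_def)
next
  case False
  have "open {y \<in> - {0}. w + 1 / y \<in> - A}"
    unfolding Collect_conj_eq
  proof -
    have "open ((- {0}) \<inter> (\<lambda>y. w + 1 / y) -` (- A))"
      using assms(1) by (intro continuous_open_preimage continuous_intros) (auto simp: open_Compl)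
    then show "open ({y. y \<in> - {0}} \<inter> {y. w + 1 / y \<in> - A})"
      by (simp add: vimage_def Compl_eq)
  qed
  moreover have "{y \<in> - {0}. w + 1 / y \<in> - A} = - inverted w A" by (auto simp: inverted_def)
  ultimately show ?thesis by (simp add: closed_def)
qed

section \<open>Crosscuts of the complement of a quasiarc\<close>

text \<open>This is - tanh (z/2), the conformal map of the strip |Im z| < pi/2 onto the disc. The
  left end of the strip goes to the boundary point 1, the negative real axis to the radius ending
  there, and vertical segments to the circular arcs around 1 on which |(1 - \<zeta>) / (1 +
  \<zeta>)| is constant. \<open>half_strip 0\<close> becomes the right half of the disc and misses
  0, where the inverted Riemann map has its pole.\<close>

definition strip_to_disc :: "complex \<Rightarrow> complex" where
  "strip_to_disc z = (1 - exp z) / (1 + exp z)"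

lemma Re_exp_pos: "\<bar>Im z\<bar> < pi / 2 \<Longrightarrow> 0 < Re (exp z)"
  unfolding Re_exp by (intro mult_pos_pos cos_gt_zero_pi) auto

lemma one_plus_neq_0: "0 < Re w \<Longrightarrow> 1 + w \<noteq> 0"
  by (auto simp: complex_eq_iff)

lemma norm_diff_less_norm_add: "0 < Re w \<Longrightarrow> norm (1 - w) < norm (1 + w)"
  unfolding norm_complex_def by (auto simp: power2_eq_square algebra_simps)

lemma cayley_involution:
  fixes w :: complex
  assumes "1 + w \<noteq> 0"
  shows "(1 - (1 - w) / (1 + w)) / (1 + (1 - w) / (1 + w)) = w"
proof -
  have "1 - (1 - w) / (1 + w) = 2 * w / (1 + w)" "1 + (1 - w) / (1 + w) = 2 / (1 + w)"
    using assms by (simp_all add: field_simps)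
  then show ?thesis using assms by simp
qed

lemma strip_to_disc_in_disc:
  assumes "\<bar>Im z\<bar> < pi / 2" shows "strip_to_disc z \<in> ball 0 1"
  using norm_diff_less_norm_add[OF Re_exp_pos[OF assms]] one_plus_neq_0[OF Re_exp_pos[OF assms]]
  by (simp add: strip_to_disc_def norm_divide)

lemma cayley_strip_to_disc:
  assumes "\<bar>Im z\<bar> < pi / 2"
  shows "(1 - strip_to_disc z) / (1 + strip_to_disc z) = exp z"
  unfolding strip_to_disc_def by (rule cayley_involution[OF one_plus_neq_0[OF Re_exp_pos[OF assms]]])

lemma inj_strip_to_disc: "inj_on strip_to_disc (half_strip b)"
proof (rule inj_onI)
  fix z w assume zw: "z \<in> half_strip b" "w \<in> half_strip b" "strip_to_disc z = strip_to_disc w"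
  then have "exp z = exp w"
    using cayley_strip_to_disc[of z] cayley_strip_to_disc[of w] by (simp add: half_strip_def)
  then have "Ln (exp z) = Ln (exp w)" by simp
  then show "z = w" using zw pi_gt_zero by (auto simp: half_strip_def)
qed

text \<open>The segment covers the whole arc inside the disc: the Cayley transform takes the disc
  into the right half plane, where the principal logarithm has imaginary part of modulus below
  pi/2.\<close>

lemma strip_to_disc_surj:
  assumes "\<zeta> \<in> ball 0 1" "norm ((1 - \<zeta>) / (1 + \<zeta>)) = exp s"
  obtains y where "\<bar>y\<bar> < pi / 2" "strip_to_disc (Complex s y) = \<zeta>"
proof -
  define w where "w = (1 - \<zeta>) / (1 + \<zeta>)"
  have ne: "1 + \<zeta> \<noteq> 0" using assms(1) by (auto simp: add_eq_0_iff)
  have "Re w = (1 - (norm \<zeta>)\<^sup>2) / (norm (1 + \<zeta>))\<^sup>2"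
    unfolding w_def by (simp add: Re_divide cmod_power2) (simp add: power2_eq_square algebra_simps)
  moreover have "(norm \<zeta>)\<^sup>2 < 1" using assms(1) by (simp add: power_less_one_iff abs_square_less_1)
  ultimately have Rw: "0 < Re w" using ne by simp
  then have w0: "w \<noteq> 0" by auto
  have "Complex s (Im (Ln w)) = Ln w"
    using w0 assms(2) by (simp add: complex_eq_iff Re_Ln w_def)
  then have "exp (Complex s (Im (Ln w))) = w" using w0 by simp
  then have "strip_to_disc (Complex s (Im (Ln w))) = \<zeta>"
    unfolding strip_to_disc_def w_def using cayley_involution[OF ne] by simp
  moreover have "\<bar>Im (Ln w)\<bar> < pi / 2" using Re_Ln_pos_lt[OF w0] Rw by simp
  ultimately show ?thesis by (rule that[rotated])
qed

lemma norm_cayley_strip_to_disc: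
  "\<bar>Im z\<bar> < pi / 2 \<Longrightarrow> norm ((1 - strip_to_disc z) / (1 + strip_to_disc z)) = exp (Re z)"
  by (simp add: cayley_strip_to_disc)

lemma holomorphic_strip_to_disc: "strip_to_disc holomorphic_on half_strip b"
  unfolding strip_to_disc_def[abs_def]
proof (intro holomorphic_intros)
  show "1 + exp z \<noteq> 0" if "z \<in> half_strip b" for z
    using that by (intro one_plus_neq_0 Re_exp_pos) (simp add: half_strip_def)
qed

lemma strip_to_disc_neq_0:
  assumes "z \<in> half_strip 0" shows "strip_to_disc z \<noteq> 0"
proof
  assume "strip_to_disc z = 0"
  then have "exp z = 1" using cayley_strip_to_disc[of z] assms by (simp add: half_strip_def)
  then have "exp (Re z) = 1" by (metis norm_exp_eq_Re norm_one)
  then show False using assms by (simp add: half_strip_def)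
qed

text \<open>The value 1/3 is (1 - 1/2) / (1 + 1/2), with 1/2 as an upper bound for exp (-1).\<close>

lemma norm_strip_to_disc_ge:
  assumes "z \<in> half_strip (-1)" shows "1 / 3 \<le> norm (strip_to_disc z)"
proof -
  have "norm (exp z) \<le> 1 / 2"
  proof -
    have "exp (Re z) \<le> exp (-1)" using assms by (simp add: half_strip_def)
    also have "exp (-1::real) \<le> 1 / 2"
      using exp_ge_add_one_self[of "1::real"] by (simp add: exp_minus field_simps)
    finally show ?thesis by simp
  qed
  then have "1 / 2 \<le> norm (1 - exp z)" "norm (1 + exp z) \<le> 3 / 2"
    using norm_triangle_ineq2[of 1 "exp z"] norm_triangle_ineq[of 1 "exp z"] by auto
  moreover have "0 < norm (1 + exp z)"
    using assms one_plus_neq_0[OF Re_exp_pos[of z]] by (simp add: half_strip_def)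
  ultimately have "1 / 2 / (3 / 2) \<le> norm (1 - exp z) / norm (1 + exp z)"
    by (intro frac_le) auto
  then show ?thesis by (simp add: strip_to_disc_def norm_divide)
qed

lemma strip_to_disc_tendsto_1:
  "(\<lambda>k. strip_to_disc (of_real (c - real k))) \<longlonglongrightarrow> 1"
proof -
  have "(\<lambda>k. exp (c - real k)) \<longlonglongrightarrow> 0" by real_asymp
  from tendsto_of_real[OF this, where 'a = complex]
  have lim: "(\<lambda>k. of_real (exp (c - real k)) :: complex) \<longlonglongrightarrow> 0" by simp
  have "(\<lambda>k. (1 - of_real (exp (c - real k))) / (1 + of_real (exp (c - real k))) :: complex)
      \<longlonglongrightarrow> (1 - 0) / (1 + 0)"
    by (rule tendsto_divide[OF tendsto_diff[OF tendsto_const lim] tendsto_add[OF tendsto_const lim]]) simp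
  then show ?thesis by (simp add: strip_to_disc_def flip: exp_of_real)
qed

text \<open>Janiszewski's theorem joins \<open>a\<close> and \<open>b\<close> off the union of two
  sets, neither of which separates them, if the intersection of these sets is connected. The disc
  may meet \<open>\<alpha>\<close> in a disconnected set, so the closure of \<open>\<sigma>\<close>
  is added to it: the intersection becomes the closure of \<open>\<sigma>\<close>, the union with
  \<open>\<alpha>\<close> is unchanged, and the enlarged disc stays inside \<open>cball p R\<close>,
  outside of which \<open>a\<close> and \<open>b\<close> can be joined.\<close>

lemma Janiszewski_hull:
  fixes \<alpha> :: "complex set"
  assumes \<alpha>: "closed \<alpha>" and \<sigma>: "connected \<sigma>" "\<alpha> \<inter> cball p r \<subseteq> \<sigma>" "\<sigma> \<subseteq> \<alpha> \<inter> cball p R" and "r \<le> R"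
    and ab: "a \<notin> cball p R" "b \<notin> cball p R" "connected_component (- \<alpha>) a b"
  shows "connected_component (- (cball p r \<union> \<alpha>)) a b"
proof -
  have cl: "closure \<sigma> \<subseteq> \<alpha> \<inter> cball p R"
    using \<sigma>(3) \<alpha> by (intro closure_minimal) auto
  have "connected_component (- ((cball p r \<union> closure \<sigma>) \<union> \<alpha>)) a b"
  proof (rule Janiszewski[OF _ \<alpha> _ _ ab(3)])
    have "bounded (closure \<sigma>)" using cl by (meson bounded_cball bounded_subset le_inf_iff)
    then have "compact (closure \<sigma>)" by (simp add: compact_eq_bounded_closed)
    then show "compact (cball p r \<union> closure \<sigma>)" by (intro compact_Un) auto
    have "(cball p r \<union> closure \<sigma>) \<inter> \<alpha> = closure \<sigma>"
      using cl \<sigma>(2) closure_subset[of \<sigma>] by blast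
    then show "connected ((cball p r \<union> closure \<sigma>) \<inter> \<alpha>)"
      using connected_imp_connected_closure \<sigma>(1) by simp
    have "connected (- cball p R)" by (rule connected_complement_bounded_convex) auto
    moreover have "- cball p R \<subseteq> - (cball p r \<union> closure \<sigma>)"
      using cl subset_cball[OF \<open>r \<le> R\<close>, of p] by auto
    ultimately show "connected_component (- (cball p r \<union> closure \<sigma>)) a b"
      unfolding connected_component_def using ab(1,2) by blast
  qed
  moreover have "(cball p r \<union> closure \<sigma>) \<union> \<alpha> = cball p r \<union> \<alpha>" using cl by auto
  ultimately show ?thesis by simp
qed

section \<open>The inverted Riemann map in strip coordinates\<close>

context disc_conformal
begin

definition \<Phi> :: "complex \<Rightarrow> complex" where
  "\<Phi> z = 1 / (f (strip_to_disc z) - f 0)"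

lemma f_eq_iff: "\<zeta> \<in> ball 0 1 \<Longrightarrow> \<zeta>' \<in> ball 0 1 \<Longrightarrow> f \<zeta> = f \<zeta>' \<longleftrightarrow> \<zeta> = \<zeta>'"
  using inj_onD[OF inj_f] by auto

lemma f0_notin_frontier: "f 0 \<notin> frontier U"
  using f_in[of 0] open_U by (auto simp: frontier_def interior_open)

lemma disc_half_strip: "z \<in> half_strip 0 \<Longrightarrow> strip_to_disc z \<in> ball 0 1 - {0}"
  using strip_to_disc_in_disc strip_to_disc_neq_0 by (auto simp: half_strip_def)

lemma f_minus_f0: "\<zeta> \<in> ball 0 1 - {0} \<Longrightarrow> f \<zeta> - f 0 \<noteq> 0"
  using f_eq_iff[of \<zeta> 0] by auto

lemma holomorphic_\<Phi>: "\<Phi> holomorphic_on half_strip 0"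
proof -
  have "(f \<circ> strip_to_disc) holomorphic_on half_strip 0"
    using disc_half_strip by (intro holomorphic_on_compose_gen[OF holomorphic_strip_to_disc holf]) auto
  then have "(\<lambda>z. f (strip_to_disc z)) holomorphic_on half_strip 0" by (simp add: o_def)
  then show ?thesis unfolding \<Phi>_def[abs_def]
    using f_minus_f0[OF disc_half_strip] by (intro holomorphic_intros) auto
qed

lemma inj_\<Phi>: "inj_on \<Phi> (half_strip 0)"
proof (rule inj_onI)
  fix z w assume zw: "z \<in> half_strip 0" "w \<in> half_strip 0" "\<Phi> z = \<Phi> w"
  then have "f (strip_to_disc z) = f (strip_to_disc w)" by (simp add: \<Phi>_def divide_inverse)
  then have "strip_to_disc z = strip_to_disc w"
    using f_eq_iff disc_half_strip[OF zw(1)] disc_half_strip[OF zw(2)] by blast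
  then show "z = w" using inj_onD[OF inj_strip_to_disc _ zw(1,2)] by blast
qed

text \<open>To the left of abscissa -1 the argument of \<open>f\<close> has modulus at least 1/3. By
  injectivity \<open>f\<close> then avoids the image of the disc of radius 1/3, and with it a
  neighbourhood of the pole \<open>f 0\<close>.\<close>

lemma \<Phi>_bound:
  assumes B: "0 < B" "ball (f 0) (1 / B) \<subseteq> f ` ball 0 (1 / 3)" and z: "z \<in> half_strip (-1)"
  shows "norm (\<Phi> z) \<le> B"
proof -
  have z0: "strip_to_disc z \<in> ball 0 1 - {0}"
    using disc_half_strip z half_strip_mono[of "-1" 0] by auto
  have "f (strip_to_disc z) \<notin> f ` ball 0 (1 / 3)"
    using norm_strip_to_disc_ge[OF z] f_eq_iff z0 by (force simp: image_iff)
  then have "1 / B \<le> norm (f (strip_to_disc z) - f 0)"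
    using B(2) by (force simp: dist_norm norm_minus_commute not_less)
  then have "1 / norm (f (strip_to_disc z) - f 0) \<le> 1 / (1 / B)"
    using B(1) f_minus_f0[OF z0] by (intro divide_left_mono) auto
  then show ?thesis by (simp add: \<Phi>_def norm_divide)
qed

lemma connected_avoiding_frontier:
  assumes "connected S" "S \<inter> frontier U = {}" "S \<inter> U \<noteq> {}"
  shows "S \<subseteq> U"
  using connected_Int_frontier[OF assms(1,3)] assms(2) by blast

lemma connected_component_inverted:
  assumes "connected U" "a \<in> U - {f 0}" "b \<in> U - {f 0}"
  shows "connected_component (- inverted (f 0) (frontier U)) (1 / (a - f 0)) (1 / (b - f 0))"
proof -
  define W where "W = (\<lambda>x. 1 / (x - f 0)) ` (U - {f 0})"
  have "connected (U - {f 0})"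
    using assms(1) open_U by (intro connected_open_delete) auto
  then have "connected W" unfolding W_def
    by (intro connected_continuous_image continuous_intros) auto
  moreover have "W \<subseteq> - inverted (f 0) (frontier U)"
    using open_U by (auto simp: W_def inverted_def frontier_def interior_open)
  ultimately show ?thesis
    unfolding connected_component_def using assms(2,3) by (intro exI[of _ W]) (auto simp: W_def)
qed

text \<open>As \<zeta> tends to 0, the inverted map tends to infinity while |(1 - \<zeta>) / (1 +
  \<zeta>)| tends to 1 > exp s. This yields a point on the far side of the crosscut and outside any
  prescribed disc.\<close>

lemma far_point_near_pole:
  assumes "s < 0"
  obtains \<zeta> where "\<zeta> \<in> ball 0 1 - {0}" "K < norm (1 / (f \<zeta> - f 0))" "exp s < norm ((1 - \<zeta>) / (1 + \<zeta>))"
proof -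
  have "f \<midarrow>0\<rightarrow> f 0"
    using holomorphic_on_imp_continuous_on[OF holf] continuous_on_eq_continuous_at[of "ball 0 1" f]
    by (auto simp: isCont_def)
  then have "((\<lambda>\<zeta>. norm (f \<zeta> - f 0)) \<longlongrightarrow> 0) (at 0)"
    by (rule tendsto_norm_zero[OF LIM_zero])
  then have 1: "\<forall>\<^sub>F \<zeta> in at 0. norm (f \<zeta> - f 0) < 1 / (\<bar>K\<bar> + 1)"
    by (rule order_tendstoD) simp
  have "((\<lambda>\<zeta>::complex. norm ((1 - \<zeta>) / (1 + \<zeta>))) \<longlongrightarrow> norm ((1 - 0) / (1 + 0) :: complex)) (at 0)"
    by (intro tendsto_intros) auto
  then have 2: "\<forall>\<^sub>F \<zeta>::complex in at 0. exp s < norm ((1 - \<zeta>) / (1 + \<zeta>))"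
    by (rule order_tendstoD) (use assms in simp)
  have 3: "\<forall>\<^sub>F \<zeta>::complex in at 0. \<zeta> \<in> ball 0 1 - {0}"
    unfolding eventually_at by (intro exI[of _ 1]) (auto simp: dist_norm)
  have "\<exists>\<zeta>. \<zeta> \<in> ball 0 1 - {0} \<and> norm (f \<zeta> - f 0) < 1 / (\<bar>K\<bar> + 1) \<and> exp s < norm ((1 - \<zeta>) / (1 + \<zeta>))"
    using eventually_happens'[OF at_neq_bot eventually_conj[OF 3 eventually_conj[OF 1 2]]] by blast
  then obtain \<zeta> where \<zeta>: "\<zeta> \<in> ball 0 1 - {0}" "norm (f \<zeta> - f 0) < 1 / (\<bar>K\<bar> + 1)"
    "exp s < norm ((1 - \<zeta>) / (1 + \<zeta>))" by blast
  have "0 < norm (f \<zeta> - f 0)" using f_minus_f0[OF \<zeta>(1)] by simp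
  then have "\<bar>K\<bar> + 1 < 1 / norm (f \<zeta> - f 0)" using \<zeta>(2) by (simp add: field_simps)
  then show ?thesis using \<zeta> by (intro that[of \<zeta>]) (auto simp: norm_divide)
qed

text \<open>A point of the image beyond the crosscut and outside the large disc could be joined to a point
  near infinity outside the small disc, which contains the image of the crosscut.\<close>

lemma crosscut_image:
  assumes con: "connected U"
    and M: "1 \<le> M" and hull: "linearly_connected M (inverted (f 0) (frontier U))"
    and s: "s < 0" and r: "0 < r"
    and cross: "\<And>y. \<bar>y\<bar> < pi / 2 \<Longrightarrow> \<Phi> (Complex s y) \<in> cball p r"
  shows "\<Phi> ` half_strip s \<subseteq> cball p (M * r)"
proof (rule image_subsetI, rule ccontr)
  fix z assume z: "z \<in> half_strip s" and out: "\<Phi> z \<notin> cball p (M * r)"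
  define \<alpha> where "\<alpha> = inverted (f 0) (frontier U)"
  have z0: "z \<in> half_strip 0" using z half_strip_mono[of s 0] s by auto
  define \<zeta>1 where "\<zeta>1 = strip_to_disc z"
  have \<zeta>1: "\<zeta>1 \<in> ball 0 1 - {0}" unfolding \<zeta>1_def by (rule disc_half_strip[OF z0])
  obtain \<zeta>2 where \<zeta>2: "\<zeta>2 \<in> ball 0 1 - {0}" "norm p + M * r < norm (1 / (f \<zeta>2 - f 0))"
    "exp s < norm ((1 - \<zeta>2) / (1 + \<zeta>2))"
    by (rule far_point_near_pole[OF s])
  have out2: "1 / (f \<zeta>2 - f 0) \<notin> cball p (M * r)"
    using \<zeta>2(2) norm_triangle_sub[of "1 / (f \<zeta>2 - f 0)" p] by (auto simp: dist_norm norm_minus_commute)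
  have fU: "f \<zeta>1 \<in> U - {f 0}" "f \<zeta>2 \<in> U - {f 0}"
    using \<zeta>1 \<zeta>2(1) f_in f_minus_f0 by auto
  have "connected_component (- \<alpha>) (\<Phi> z) (1 / (f \<zeta>2 - f 0))"
    using connected_component_inverted[OF con fU] by (simp add: \<alpha>_def \<Phi>_def \<zeta>1_def)
  moreover have cl: "closed \<alpha>" unfolding \<alpha>_def by (rule closed_inverted[OF _ f0_notin_frontier]) simp
  moreover obtain \<sigma> where "connected \<sigma>" "\<alpha> \<inter> cball p r \<subseteq> \<sigma>" "\<sigma> \<subseteq> \<alpha> \<inter> cball p (M * r)"
    using hull r unfolding \<alpha>_def linearly_connected_def by blast
  moreover have "r \<le> M * r" using M r by simp
  ultimately have "connected_component (- (cball p r \<union> \<alpha>)) (\<Phi> z) (1 / (f \<zeta>2 - f 0))"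
    using out out2 by (intro Janiszewski_hull)
  then obtain C where C: "connected C" "C \<subseteq> - (cball p r \<union> \<alpha>)" "\<Phi> z \<in> C" "1 / (f \<zeta>2 - f 0) \<in> C"
    unfolding connected_component_def by blast
  have C0: "0 \<notin> C" using C(2) by (auto simp: \<alpha>_def inverted_def)
  \<comment> \<open>The connecting set, taken back by the inversion. It avoids the frontier and
    meets \<open>U\<close>, so it lies in \<open>U\<close>, where \<open>g\<close> can be
    applied.\<close>
  define D where "D = (\<lambda>y. f 0 + 1 / y) ` C"
  have "connected D" unfolding D_def using C(1) C0
    by (intro connected_continuous_image continuous_intros) auto
  moreover have "D \<inter> frontier U = {}" using C(2) C0 by (auto simp: D_def \<alpha>_def inverted_def)
  moreover have D1: "f \<zeta>1 \<in> D" using C(3) unfolding D_def \<Phi>_def \<zeta>1_def by force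
  moreover have D2: "f \<zeta>2 \<in> D" using C(4) unfolding D_def by force
  ultimately have DU: "D \<subseteq> U" using fU by (intro connected_avoiding_frontier) auto
  have contg: "continuous_on D g"
    using holomorphic_on_imp_continuous_on[OF holg] DU by (rule continuous_on_subset)
  \<comment> \<open>\<open>u\<close> is the exponential of the abscissa in the strip. It is at most
    \<open>exp s\<close> at one end of the connection and at least \<open>exp s\<close> at the
    other, so it takes this value on \<open>D\<close>: the connection crosses the image of the
    crosscut, although that image lies in the disc it avoids.\<close>
  define u where "u = (\<lambda>x. norm ((1 - g x) / (1 + g x)))"
  have gx: "g x \<in> ball 0 1" if "x \<in> D" for x using g_in DU that by auto
  then have "1 + g x \<noteq> 0" if "x \<in> D" for x using that by (fastforce simp: add_eq_0_iff)
  then have "continuous_on D u" unfolding u_def by (intro continuous_intros contg) auto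
  then have "connected (u ` D)" using \<open>connected D\<close> by (intro connected_continuous_image)
  moreover have "u (f \<zeta>1) \<in> u ` D" "u (f \<zeta>2) \<in> u ` D" using D1 D2 by auto
  moreover have "u (f \<zeta>1) \<le> exp s"
    using \<zeta>1 norm_cayley_strip_to_disc[of z] z by (simp add: u_def gf \<zeta>1_def half_strip_def)
  moreover have "exp s \<le> u (f \<zeta>2)" using \<zeta>2 by (simp add: u_def gf)
  ultimately have "exp s \<in> u ` D" unfolding connected_iff_interval by blast
  then obtain x where x: "x \<in> D" "u x = exp s" by (metis imageE)
  obtain y where y: "\<bar>y\<bar> < pi / 2" "strip_to_disc (Complex s y) = g x"
    using strip_to_disc_surj[OF gx[OF x(1)]] x(2) unfolding u_def by metis
  obtain c where c: "c \<in> C" "x = f 0 + 1 / c" using x(1) by (auto simp: D_def)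
  have "f (g x) = x" using DU x(1) by (intro fg) auto
  then have "\<Phi> (Complex s y) = c" using c C0 by (simp add: \<Phi>_def y(2))
  then show False using cross[OF y(1)] c(1) C(2) by auto
qed

text \<open>The decay estimate compares \<open>\<Phi> z\<close> with points \<open>x k\<close>
  running along the real axis to the left end of the strip. Their images accumulate at some
  \<open>y\<close> by boundedness. This \<open>y\<close> is on the inverted boundary: otherwise
  \<open>f\<close> would converge to a point \<open>w\<close> of \<open>U\<close> along a sequence
  tending to 1, and continuity of \<open>g\<close> would give \<open>g w = 1\<close>.\<close>

lemma infdist_\<Phi>_le:
  assumes con: "connected U"
    and M: "1 \<le> M" and hull: "linearly_connected M (inverted (f 0) (frontier U))"
    and B: "0 < B" "ball (f 0) (1 / B) \<subseteq> f ` ball 0 (1 / 3)"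
    and z: "z \<in> half_strip (- real n - 2)"
  defines "\<kappa> \<equiv> 4 * (192 * M)\<^sup>2"
  shows "infdist (\<Phi> z) (inverted (f 0) (frontier U)) \<le> 768 * M * B * sqrt ((\<kappa> / (1 + \<kappa>)) ^ n)"
proof -
  define \<alpha> where "\<alpha> = inverted (f 0) (frontier U)"
  define x where "x = (\<lambda>k. complex_of_real (- real n - 3 - real k))"
  have xs: "x k \<in> half_strip (- real n - 2)" for k using pi_gt_zero by (auto simp: x_def half_strip_def)
  have xs1: "x k \<in> half_strip (-1)" and xs0: "x k \<in> half_strip 0" for k
    using xs[of k] half_strip_mono[of "- real n - 2" "-1"] half_strip_mono[of "- real n - 2" 0] by auto
  have d: "dist (\<Phi> z) (\<Phi> (x k)) \<le> 768 * M * B * sqrt ((\<kappa> / (1 + \<kappa>)) ^ n)" for k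
    unfolding \<kappa>_def using M
    by (intro univalent_strip_decay[OF holomorphic_\<Phi> inj_\<Phi> B(1) \<Phi>_bound[OF B] _
          crosscut_image[OF con M hull] z xs]) auto
  have "\<forall>k. \<Phi> (x k) \<in> cball 0 B" using \<Phi>_bound[OF B xs1] by simp
  then obtain y r where r: "strict_mono r" and lim: "((\<lambda>k. \<Phi> (x k)) \<circ> r) \<longlonglongrightarrow> y"
    using compact_cball[of "0::complex" B] unfolding compact_def by metis
  have "y \<in> \<alpha>"
  proof (rule ccontr)
    assume y: "y \<notin> \<alpha>"
    then have y0: "y \<noteq> 0" by (auto simp: \<alpha>_def inverted_def)
    define w where "w = f 0 + 1 / y"
    have wA: "w \<notin> frontier U" using y y0 by (auto simp: \<alpha>_def inverted_def w_def)
    have f\<Phi>: "f (strip_to_disc (x k)) = f 0 + 1 / \<Phi> (x k)" for k by (simp add: \<Phi>_def)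
    have limf: "(\<lambda>k. f (strip_to_disc (x (r k)))) \<longlonglongrightarrow> w"
      unfolding f\<Phi> w_def using lim y0 by (intro tendsto_intros) (auto simp: o_def)
    moreover have fU: "f (strip_to_disc (x k)) \<in> U" for k using f_in disc_half_strip[OF xs0] by auto
    ultimately have "w \<in> closure U" unfolding closure_sequential by (intro exI conjI allI)
    then have wU: "w \<in> U" using wA open_U by (auto simp: frontier_def interior_open)
    then have "isCont g w"
      using holomorphic_on_imp_continuous_on[OF holg] open_U continuous_on_eq_continuous_at by blast
    then have "(\<lambda>k. g (f (strip_to_disc (x (r k))))) \<longlonglongrightarrow> g w" by (rule isCont_tendsto_compose[OF _ limf])
    moreover have "g (f (strip_to_disc (x k))) = strip_to_disc (x k)" for k
      using gf disc_half_strip[OF xs0] by auto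
    ultimately have "(\<lambda>k. strip_to_disc (x (r k))) \<longlonglongrightarrow> g w" by simp
    moreover have "(\<lambda>k. strip_to_disc (x (r k))) \<longlonglongrightarrow> 1"
      using LIMSEQ_subseq_LIMSEQ[OF strip_to_disc_tendsto_1[of "- real n - 3"] r] by (simp add: o_def x_def)
    ultimately have "g w = 1" using LIMSEQ_unique by blast
    then show False using g_in[OF wU] by simp
  qed
  have "dist (\<Phi> z) y \<le> 768 * M * B * sqrt ((\<kappa> / (1 + \<kappa>)) ^ n)"
    using lim d by (intro tendsto_upperbound[OF tendsto_dist[OF tendsto_const lim]]) (auto simp: o_def)
  then show ?thesis using infdist_le[OF \<open>y \<in> \<alpha>\<close>, of "\<Phi> z"] unfolding \<alpha>_def by simp
qed

text \<open>Inversion turns the distance from \<open>w\<close> to a boundary point \<open>x\<close>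
  into \<open>dist w x / (R * X)\<close>, where \<open>R\<close> and \<open>X\<close> are the
  distances of \<open>w\<close> and \<open>x\<close> from the pole. If \<open>x\<close> is not much
  further from the pole than \<open>w\<close>, one power of the gauge is spent on
  \<open>dist w x\<close> and two on \<open>R\<close> and \<open>X\<close>, as the gauge times
  \<open>R\<close> is bounded; hence the exponent 3. For distant \<open>x\<close> and for infinity
  (y = 0) the inverted distance is at least 1 / (2 R), and one power is enough.\<close>

lemma gauge_le_infdist_inverted:
  assumes w: "w \<in> U - {f 0}"
  shows "boundary_gauge U w ^ 3 \<le>
    2 * (1 + norm (f 0))\<^sup>2 * infdist (1 / (w - f 0)) (inverted (f 0) (frontier U))"
proof -
  define \<alpha> where "\<alpha> = inverted (f 0) (frontier U)"
  define g' where "g' = boundary_gauge U w"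
  define k where "k = 1 + norm (f 0)"
  define R where "R = norm (w - f 0)"
  have "closed \<alpha>" unfolding \<alpha>_def by (rule closed_inverted[OF _ f0_notin_frontier]) simp
  moreover have "\<alpha> \<noteq> {}" by (simp add: \<alpha>_def inverted_def)
  ultimately obtain y where y: "y \<in> \<alpha>" "infdist (1 / (w - f 0)) \<alpha> = dist (1 / (w - f 0)) y"
    using infdist_attains_inf by blast
  have g': "0 < g'" "g' \<le> 1" using boundary_gauge_pos[OF open_U U_ne, of w] w boundary_gauge_le_1
    by (auto simp: g'_def)
  have k: "1 \<le> k" by (simp add: k_def)
  have R: "0 < R" using w by (simp add: R_def)
  have "R \<le> norm w + norm (f 0)" unfolding R_def by (rule norm_triangle_ineq4)
  also have "\<dots> \<le> k * (1 + norm w)" by (simp add: k_def algebra_simps)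
  finally have "g' * R \<le> k * (g' * (1 + norm w))"
    using mult_left_mono[of R "k * (1 + norm w)" g'] g' by (simp add: mult_ac)
  also have "\<dots> \<le> k * 1"
    using boundary_gauge_le_inverse_norm[of U w] k by (intro mult_left_mono) (auto simp: g'_def)
  finally have gR: "g' * R \<le> k" by simp
  have cube: "g' ^ 3 \<le> g'" using g' power_decreasing[of 1 3 g'] by simp
  have k2: "k \<le> 2 * k\<^sup>2" "2 * k \<le> 2 * k\<^sup>2" using k by (auto simp: power2_eq_square intro: order_trans[of _ "k * k"])
  have low: "g' ^ 3 \<le> 2 * k\<^sup>2 * d" if "1 / (c * R) \<le> d" "c * k \<le> 2 * k\<^sup>2" "0 < c" for d c :: real
  proof -
    have "g' \<le> k / R" using gR R by (simp add: field_simps)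
    also have "\<dots> = c * k * (1 / (c * R))" using that by simp
    also have "\<dots> \<le> c * k * d" using that k by (intro mult_left_mono) auto
    also have "\<dots> \<le> 2 * k\<^sup>2 * d"
      using that R by (intro mult_right_mono) (auto intro: order_trans[of _ "1 / (c * R)"])
    finally show ?thesis using cube by linarith
  qed
  have "g' ^ 3 \<le> 2 * k\<^sup>2 * dist (1 / (w - f 0)) y"
  proof (cases "y = 0")
    case True
    then show ?thesis using k2 by (intro low[of 1]) (auto simp: R_def norm_divide)
  next
    case False
    define x where "x = f 0 + 1 / y"
    have x: "x \<in> frontier U" using y(1) False by (auto simp: \<alpha>_def inverted_def x_def)
    then have xU: "x \<notin> U" using open_U by (auto simp: frontier_def interior_open)
    have x0: "x \<noteq> f 0" using x f0_notin_frontier by metis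
    define X where "X = norm (x - f 0)"
    have X: "0 < X" using x0 by (simp add: X_def)
    have "y = 1 / (x - f 0)" by (simp add: x_def)
    then have d: "dist (1 / (w - f 0)) y = dist w x / (R * X)"
      using dist_inversion[of w "f 0" x] w x0 by (simp add: R_def X_def)
    have gd: "g' \<le> dist w x" unfolding g'_def by (rule boundary_gauge_le_dist[OF xU])
    show ?thesis
    proof (cases "X \<le> 2 * R")
      case True
      have "g' ^ 3 = g' * (g' * g')" by (simp add: power3_eq_cube)
      also have "\<dots> \<le> dist w x * (k / R * (k / R))"
        using gR R g' gd k by (intro mult_mono) (auto simp: field_simps)
      also have "\<dots> = 2 * k\<^sup>2 * (dist w x / (R * (2 * R)))" by (simp add: power2_eq_square)
      also have "\<dots> \<le> 2 * k\<^sup>2 * (dist w x / (R * X))"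
        using True R X by (intro mult_left_mono divide_left_mono) auto
      finally show ?thesis by (simp add: d)
    next
      case False
      have "X \<le> dist w x + R"
        using norm_triangle_ineq[of "x - w" "w - f 0"] by (simp add: X_def R_def dist_norm norm_minus_commute)
      then have "X / 2 \<le> dist w x" using False by simp
      then have "X / 2 / (R * X) \<le> dist w x / (R * X)" using R X by (intro divide_right_mono) auto
      then have "1 / (2 * R) \<le> dist w x / (R * X)" using X by simp
      then show ?thesis unfolding d using k2 by (intro low[of 2]) auto
    qed
  qed
  then show ?thesis using y(2) by (simp add: g'_def k_def \<alpha>_def)
qed

text \<open>On the radius the strip coordinate is the real number \<open>- L\<close>, with
  \<open>exp (- L)\<close> comparable to \<open>1 - t\<close>. The cube of the gauge decays like
  \<open>sqrt (q ^ n)\<close>; since \<open>q ^ m\<close> is at most exp (-1), raising this to the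
  power \<open>2 * m\<close> gives at most exp (- n), which is at most
  \<open>exp 3 * (1 - t)\<close>. The exponent \<open>6 * m\<close> is 3 times
  \<open>2 * m\<close>.\<close>

lemma radial_gauge_le:
  assumes con: "connected U"
    and M: "1 \<le> M" and hull: "linearly_connected M (inverted (f 0) (frontier U))"
    and B: "0 < B" "ball (f 0) (1 / B) \<subseteq> f ` ball 0 (1 / 3)"
    and m: "(4 * (192 * M)\<^sup>2 / (1 + 4 * (192 * M)\<^sup>2)) ^ m \<le> exp (- 1)"
    and t: "0 \<le> t" "t < 1"
  shows "boundary_gauge U (f (of_real t)) ^ (6 * m) \<le>
    max (exp 2) ((2 * (1 + norm (f 0))\<^sup>2 * (768 * M * B)) ^ (2 * m) * exp 3) * (1 - t)"
    (is "_ \<le> max _ (?K ^ _ * _) * _")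
proof -
  define q where "q = 4 * (192 * M)\<^sup>2 / (1 + 4 * (192 * M)\<^sup>2)"
  have q: "0 \<le> q" by (simp add: q_def)
  define L where "L = ln ((1 + t) / (1 - t))"
  have eL: "exp (- L) = (1 - t) / (1 + t)" using t by (simp add: L_def exp_minus)
  have eL1: "exp (- L) \<le> 1 - t"
    unfolding eL using t divide_left_mono[of 1 "1 + t" "1 - t"] by simp
  show ?thesis
  proof (cases "L \<le> 2")
    case True
    have "boundary_gauge U (f (of_real t)) ^ (6 * m) \<le> 1"
      by (intro power_le_one boundary_gauge_nonneg boundary_gauge_le_1)
    also have "1 = exp 2 * exp (- 2 :: real)" by (simp flip: exp_add)
    also have "\<dots> \<le> exp 2 * (1 - t)"
      using True eL1 by (intro mult_left_mono) (auto intro: order_trans[of _ "exp (- L)"])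
    also have "\<dots> \<le> max (exp 2) (?K ^ (2 * m) * exp 3) * (1 - t)"
      using t by (intro mult_right_mono) auto
    finally show ?thesis .
  next
    case False
    \<comment> \<open>L > 2 makes this the natural number with n + 2 < L <= n + 3; the strict
      inequality puts \<open>- L\<close> into the open half strip.\<close>
    define n where "n = nat (\<lceil>L\<rceil> - 3)"
    have n: "real n + 2 < L" "L \<le> real n + 3" using False unfolding n_def by linarith+
    define z where "z = complex_of_real (- L)"
    have z: "z \<in> half_strip (- real n - 2)" using n(1) pi_gt_zero by (simp add: z_def half_strip_def)
    have sz: "strip_to_disc z = of_real t"
    proof -
      have "exp z = of_real (exp (- L))" unfolding z_def by (rule exp_of_real)
      also have "\<dots> = (1 - of_real t) / (1 + of_real t)" unfolding eL by simp
      finally show ?thesis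
        unfolding strip_to_disc_def using t
        by (simp only:) (rule cayley_involution, auto simp: complex_eq_iff)
    qed
    have fU: "f (of_real t) \<in> U - {f 0}"
      using disc_half_strip[of z] z half_strip_mono[of "- real n - 2" 0] f_in f_minus_f0[of "of_real t"] sz by auto
    define \<delta> where "\<delta> = infdist (1 / (f (of_real t) - f 0)) (inverted (f 0) (frontier U))"
    have "\<delta> \<le> 768 * M * B * sqrt (q ^ n)"
      using infdist_\<Phi>_le[OF con M hull B z] by (simp add: \<delta>_def \<Phi>_def sz q_def)
    then have "2 * (1 + norm (f 0))\<^sup>2 * \<delta> \<le> 2 * (1 + norm (f 0))\<^sup>2 * (768 * M * B * sqrt (q ^ n))"
      by (rule mult_left_mono) simp
    with gauge_le_infdist_inverted[OF fU, folded \<delta>_def]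
    have "boundary_gauge U (f (of_real t)) ^ 3 \<le> 2 * (1 + norm (f 0))\<^sup>2 * (768 * M * B * sqrt (q ^ n))"
      by (rule order_trans)
    then have "boundary_gauge U (f (of_real t)) ^ 3 \<le> ?K * sqrt (q ^ n)" by (simp only: mult.assoc)
    then have "(boundary_gauge U (f (of_real t)) ^ 3) ^ (2 * m) \<le> (?K * sqrt (q ^ n)) ^ (2 * m)"
      by (rule power_mono) (simp add: boundary_gauge_nonneg)
    also have "\<dots> = ?K ^ (2 * m) * (q ^ m) ^ n"
    proof -
      have "sqrt (q ^ n) ^ (2 * m) = (sqrt (q ^ n) ^ 2) ^ m" by (rule power_mult)
      also have "\<dots> = (q ^ m) ^ n" using q by (simp add: mult.commute flip: power_mult)
      finally show ?thesis by (simp only: power_mult_distrib)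
    qed
    also have "\<dots> \<le> ?K ^ (2 * m) * (exp (- 1)) ^ n"
      using q m M B by (intro mult_left_mono power_mono) (auto simp: q_def)
    also have "exp (- 1 :: real) ^ n = exp (- real n)" by (simp flip: exp_of_nat_mult)
    also have "?K ^ (2 * m) * exp (- real n) \<le> ?K ^ (2 * m) * exp (3 - L)"
      using n(2) M B by (intro mult_left_mono) auto
    also have "\<dots> = ?K ^ (2 * m) * exp 3 * exp (- L)" by (simp add: exp_diff exp_minus divide_inverse)
    also have "\<dots> \<le> ?K ^ (2 * m) * exp 3 * (1 - t)"
      using eL1 M B by (intro mult_left_mono) auto
    also have "\<dots> \<le> max (exp 2) (?K ^ (2 * m) * exp 3) * (1 - t)"
      using t by (intro mult_right_mono) auto
    finally show ?thesis by (simp flip: power_mult)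
  qed
qed

text \<open>Reduces an arbitrary radius to the positive real one.\<close>

lemma rotated:
  assumes "norm \<tau> = 1"
  shows "disc_conformal U (\<lambda>z. f (\<tau> * z)) (\<lambda>w. g w / \<tau>)"
proof
  have \<tau>0: "\<tau> \<noteq> 0" using assms by auto
  have rot: "\<tau> * z \<in> ball 0 1 \<longleftrightarrow> z \<in> ball 0 1" for z using assms by (simp add: norm_mult)
  have "(f \<circ> (\<lambda>z. \<tau> * z)) holomorphic_on ball 0 1"
    using rot by (intro holomorphic_on_compose_gen[OF _ holf] holomorphic_intros) auto
  then show "(\<lambda>z. f (\<tau> * z)) holomorphic_on ball 0 1" by (simp add: o_def)
  show "(\<lambda>w. g w / \<tau>) holomorphic_on U" using \<tau>0 by (intro holomorphic_intros holg) auto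
  show "f (\<tau> * z) \<in> U" "g (f (\<tau> * z)) / \<tau> = z" if "z \<in> ball 0 1" for z
    using f_in[of "\<tau> * z"] gf[of "\<tau> * z"] that rot \<tau>0 by auto
  show "g w / \<tau> \<in> ball 0 1" "f (\<tau> * (g w / \<tau>)) = w" if "w \<in> U" for w
    using g_in[OF that] fg[OF that] assms \<tau>0 by (auto simp: norm_divide)
qed (use open_U U_ne in auto)

end

theorem theorem5p3:
  fixes U :: "complex set"
  assumes "open U" and "connected U" and "simply_connected U"
    and "quasiarc (frontier U)"
  shows "schwartz_equivalent U (ball 0 1)"
proof -
  have unb: "\<not> bounded (frontier U)"
    by (rule quasiarc_frontier_unbounded[OF assms])
  \<comment> \<open>The empty set and the whole plane have empty, hence bounded, frontier.\<close>
  then have U: "U \<noteq> {}" "U \<noteq> UNIV" by auto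
  then obtain f g where fg: "f holomorphic_on ball 0 1" "g holomorphic_on U"
    "\<And>w. w \<in> U \<Longrightarrow> g w \<in> ball 0 1 \<and> f (g w) = w" "\<And>z. z \<in> ball 0 1 \<Longrightarrow> f z \<in> U \<and> g (f z) = z"
    using simply_connected_eq_biholomorphic_to_disc[OF assms(1)] assms(3) by blast
  interpret disc_conformal U f g
    by unfold_locales (use assms(1) U fg in auto)
  obtain M0 where M0: "0 < M0" "linearly_connected M0 (inverted (f 0) (frontier U))"
    using linearly_connected_inverted_quasiarc[OF assms(4) _ unb f0_notin_frontier] by auto
  define M where "M = max 1 M0"
  have M: "1 \<le> M" by (simp add: M_def)
  have "cball p (M0 * r) \<subseteq> cball p (M * r)" if "0 < r" for p :: complex and r
    using that by (intro subset_cball mult_right_mono) (auto simp: M_def)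
  then have hull: "linearly_connected M (inverted (f 0) (frontier U))"
    using M0(2) unfolding linearly_connected_def by (meson Int_mono order_refl order_trans)
  have "open (f ` ball 0 (1 / 3))"
    by (rule open_univalent_image[OF holf inj_f]) auto
  then obtain \<epsilon> where \<epsilon>: "0 < \<epsilon>" "ball (f 0) \<epsilon> \<subseteq> f ` ball 0 (1 / 3)"
    unfolding open_contains_ball by force
  define q where "q = 4 * (192 * M)\<^sup>2 / (1 + 4 * (192 * M)\<^sup>2)"
  have "0 \<le> q" "q < 1" by (auto simp: q_def add_pos_nonneg)
  then obtain m where m: "q ^ m \<le> exp (- 1)"
    using real_arch_pow_inv[of "exp (- 1)" q] by (auto intro: less_imp_le)
  \<comment> \<open>One constant serves all radii: a rotation of the disc changes neither the value
    of the map at 0 nor the image of the disc of radius 1/3.\<close>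
  define K where "K = max (exp 2) ((2 * (1 + norm (f 0))\<^sup>2 * (768 * M * (1 / \<epsilon>))) ^ (2 * m) * exp 3)"
  have "boundary_gauge U (f z) ^ (6 * m) \<le> K * (1 - norm z)" if z: "z \<in> ball 0 1" for z
  proof -
    obtain \<tau> where \<tau>: "norm \<tau> = 1" "z = \<tau> * of_real (norm z)"
    proof (cases "z = 0")
      case True
      then show ?thesis by (intro that[of 1]) auto
    next
      case False
      then show ?thesis by (intro that[of "sgn z"]) (simp add: norm_sgn, simp add: sgn_eq)
    qed
    interpret rot: disc_conformal U "\<lambda>z. f (\<tau> * z)" "\<lambda>w. g w / \<tau>" by (rule rotated[OF \<tau>(1)])
    have "(\<lambda>z. f (\<tau> * z)) ` ball 0 (1 / 3) = f ` ball 0 (1 / 3)"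
    proof -
      have "(\<lambda>z. \<tau> * z) ` ball 0 (1 / 3) = ball 0 (1 / 3)"
      proof (intro equalityI subsetI)
        fix w assume "w \<in> ball (0::complex) (1 / 3)"
        then show "w \<in> (\<lambda>z. \<tau> * z) ` ball 0 (1 / 3)"
          using \<tau>(1) by (intro image_eqI[of _ _ "w / \<tau>"]) (auto simp: norm_divide)
      qed (use \<tau>(1) in \<open>auto simp: norm_mult\<close>)
      then show ?thesis by (metis image_image)
    qed
    then have "boundary_gauge U (f (\<tau> * of_real (norm z))) ^ (6 * m) \<le>
      max (exp 2) ((2 * (1 + norm (f (\<tau> * 0)))\<^sup>2 * (768 * M * (1 / \<epsilon>))) ^ (2 * m) * exp 3) * (1 - norm z)"
      using \<epsilon> z m hull unfolding q_def
      by (intro rot.radial_gauge_le[OF assms(2) M]) auto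
    then show ?thesis using \<tau>(2) by (simp add: K_def)
  qed
  then show ?thesis by (intro equivalent_disc) blast
qed

end
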